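(* Let $\beta_2>\beta_1>0$ and suppose $\frac{\beta_2}{\beta_1}=\frac{m}{n}$ for positive integers $m,n$. Then $$\beta_1^{2/3}\, H_{m,\beta_1}\ \succeq\ \beta_2^{2/3}\, H_{n,\beta_2}.$$
   Context: For real $\beta>0$ and integer $N\ge1$, the Hermite $\beta$-ensemble is the random point configuration $\lambda_1\ge\lambda_2\ge\dots\ge\lambda_N$ in $\mathbb{R}$ with joint density $$\frac{1}{Z_N^{\beta}}\prod_{k=1}^{N}e^{-\frac{\beta}{4}\lambda_k^2}\prod_{j<k}|\lambda_j-\lambda_k|^{\beta}$$ ($Z_N^\beta$ a normalizing constant). Let $\lambda_1^{(N,H,\beta)}$ denote its largest point, and define $H_{N,\beta}:=\left(\frac{\lambda_1^{(N,H,\beta)}}{\sqrt N}-2\right)N^{2/3}$. For real random variables $X,Y$, $X\succeq Y$ (stochastic domination) means $\mathbb{P}(X>t)\ge\mathbb{P}(Y>t)$ for all $t\in\mathbb{R}$. *)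

theory Defs
  imports "HOL-Probability.Probability"
begin

text \<open>Configurations of N points are functions x :: nat => real on the index set {..<N}
  (index k stands for lambda_(k+1)), with the product Lebesgue measure.\<close>

definition config_space :: "nat \<Rightarrow> (nat \<Rightarrow> real) measure" where
  "config_space N = PiM {..<N} (\<lambda>_. lborel)"

definition hermite_chamber :: "nat \<Rightarrow> (nat \<Rightarrow> real) set" where
  "hermite_chamber N = {x \<in> space (config_space N). \<forall>i j. i \<le> j \<and> j < N \<longrightarrow> x j \<le> x i}"

definition hermite_weight :: "real \<Rightarrow> nat \<Rightarrow> (nat \<Rightarrow> real) \<Rightarrow> real" where
  "hermite_weight \<beta> N x =
     (\<Prod>k<N. exp (- (\<beta> / 4) * (x k)\<^sup>2)) *
     (\<Prod>j<N. \<Prod>k\<in>{j<..<N}. \<bar>x j - x k\<bar> powr \<beta>)"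

definition hermite_Z :: "real \<Rightarrow> nat \<Rightarrow> ennreal" where
  "hermite_Z \<beta> N = (\<integral>\<^sup>+ x. ennreal (indicator (hermite_chamber N) x * hermite_weight \<beta> N x)
                        \<partial>config_space N)"

definition hermite_ensemble :: "real \<Rightarrow> nat \<Rightarrow> (nat \<Rightarrow> real) measure" where
  "hermite_ensemble \<beta> N = density (config_space N)
     (\<lambda>x. ennreal (indicator (hermite_chamber N) x * hermite_weight \<beta> N x) / hermite_Z \<beta> N)"

definition H_edge :: "nat \<Rightarrow> (nat \<Rightarrow> real) \<Rightarrow> real" where
  "H_edge N x = (x 0 / sqrt (real N) - 2) * real N powr (2/3)"

definition stoch_dominates ::
  "'a measure \<Rightarrow> ('a \<Rightarrow> real) \<Rightarrow> 'b measure \<Rightarrow> ('b \<Rightarrow> real) \<Rightarrow> bool" where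
  "stoch_dominates M X M' Y \<longleftrightarrow>
     (\<forall>t::real. measure M {\<omega> \<in> space M. X \<omega> > t} \<ge> measure M' {\<omega> \<in> space M'. Y \<omega> > t})"

end

theory Submission
  imports Defs
begin

text \<open>After rescaling, the ensemble of size \<open>N\<close> is the spectrum of the Dumitriu--Edelman random Jacobi
  matrix, whose squared off-diagonal entries are gamma variables of shapes \<open>k \<beta> / 2\<close>, \<open>k < N\<close>, and whose
  diagonal is standard Gaussian. The largest eigenvalue is below \<open>t\<close> iff all pivots of \<open>t\<close> minus the
  matrix are positive, and the pivots satisfy a Riccati recursion that is monotone in the off-diagonal
  entries. Since \<open>\<beta>\<^sub>1 m = \<beta>\<^sub>2 n\<close>, aligning both recursions at the last row shows that the matrix for
  \<open>(\<beta>\<^sub>1, m)\<close> has stochastically larger off-diagonal entries and additional rows, hence a larger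
  top eigenvalue.

  The matrix model is replaced by its effect on the Weyl function: attaching independent gamma
  weights to the points, the law of \<open>\<Sum>i. v i / (t - x i)\<close> for size \<open>N + 1\<close> is obtained from that for size
  \<open>N\<close> by one Riccati step. This follows by introducing the interlacing zeros \<open>m\<close> of the Weyl function:
  for fixed \<open>x\<close> the weights are residues at the nodes \<open>x\<close>, for fixed \<open>m\<close> the points \<open>x\<close> are encoded by the
  residues at the nodes \<open>m\<close>, and both changes of variables reduce to one-dimensional ones.\<close>

subsection \<open>One-dimensional substitution and finite products of Lebesgue measure\<close>

text \<open>The weights have shape b = \<beta> / 2 because the squared first eigenvector components
  of the Jacobi matrix are Dirichlet distributed with that parameter; multiplied by an independent
  gamma total of shape \<open>N * b\<close> they become independent gamma variables. This total is
  in turn the squared off-diagonal entry that joins the next row, so points with weights reproduce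
  the same structure at size \<open>N + 1\<close>, and the shapes in the recursion run up to
  \<open>N * b\<close>. The comparison works row by row: at distance d from the last row the shapes
  are \<open>\<beta>\<^sub>1 * (m - d) / 2\<close> and \<open>\<beta>\<^sub>2 * (n - d) / 2\<close>,
  whose difference is d times half of \<open>\<beta>\<^sub>2 - \<beta>\<^sub>1\<close>. The
  agreement of the products also gives both ensembles the same rescaled threshold. A pivot that
  fails is recorded by the value 1, an absorbing state above all values of the test function. This
  makes the whole tail probability a monotone expression in the shapes and in the test
  function.\<close>

lemma nn_integral_change_of_variables_1:
  fixes g g' :: "real \<Rightarrow> real" and f :: "real \<Rightarrow> ennreal"
  assumes [measurable]: "S \<in> sets borel" "B \<in> sets borel"
    and der: "\<And>x. x \<in> S \<Longrightarrow> (g has_real_derivative g' x) (at x)"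
    and bij: "bij_betw g S B"
    and [measurable]: "g \<in> borel_measurable borel" "g' \<in> borel_measurable borel"
      "f \<in> borel_measurable borel"
  shows "(\<integral>\<^sup>+x. f (g x) * ennreal \<bar>g' x\<bar> * indicator S x \<partial>lborel) = (\<integral>\<^sup>+y. f y * indicator B y \<partial>lborel)"
proof -
  have eq: "(\<integral>\<^sup>+x. ennreal \<bar>g' x\<bar> * indicator (S \<inter> g -` A) x \<partial>lborel) = emeasure lborel (A \<inter> B)"
    (is "?l = ?r") if [measurable]: "A \<in> sets borel" for A
  proof -
    define T where "T = S \<inter> g -` A"
    have gA: "g -` A \<in> sets borel" using measurable_sets[of g borel borel A] by simp
    have [measurable]: "T \<in> sets borel" unfolding T_def using gA by auto
    have im: "g ` T = A \<inter> B" using bij unfolding T_def bij_betw_def by auto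
    have inj: "inj_on g T" using bij unfolding T_def bij_betw_def by (auto intro: inj_on_subset)
    \<comment> \<open>Stated for a finite value \<open>r\<close>, because the substitution theorem
      speaks of integrable functions only. Taking for \<open>r\<close> the real part of either side
      shows that the two sides are finite together and then equal, or both infinite.\<close>
    have *: "?l = ennreal r \<longleftrightarrow> ?r = ennreal r" if r: "0 \<le> r" for r
    proof -
      have "?l = (\<integral>\<^sup>+x. ennreal (\<bar>g' x\<bar> * indicator T x) \<partial>lborel)"
        by (auto intro!: nn_integral_cong simp: T_def split: split_indicator)
      then have "?l = ennreal r \<longleftrightarrow> ((\<lambda>x. \<bar>g' x\<bar> * indicator T x) has_integral r) UNIV"
        using nn_integral_has_integral[of "\<lambda>x. \<bar>g' x\<bar> * indicator T x" r]
          nn_integral_has_integral_lborel[of "\<lambda>x. \<bar>g' x\<bar> * indicator T x" r] r by auto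
      also have "\<dots> \<longleftrightarrow> ((\<lambda>x. \<bar>g' x\<bar>) has_integral r) T"
      proof -
        have "(\<lambda>x. \<bar>g' x\<bar> * indicator T x) = (\<lambda>x. if x \<in> T then \<bar>g' x\<bar> else 0)"
          by (simp add: fun_eq_iff indicator_def)
        then show ?thesis by (simp only: has_integral_restrict_UNIV)
      qed
      also have "\<dots> \<longleftrightarrow> (\<lambda>x. \<bar>g' x\<bar> * 1) absolutely_integrable_on T \<and> integral T (\<lambda>x. \<bar>g' x\<bar> * 1) = r"
        by (auto simp: has_integral_integrable_integral intro: nonnegative_absolutely_integrable_1
              set_lebesgue_integral_eq_integral)
      also have "\<dots> \<longleftrightarrow> (\<lambda>_. 1::real) absolutely_integrable_on (g ` T) \<and> integral (g ` T) (\<lambda>_. 1::real) = r"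
        by (rule has_absolute_integral_change_of_variables_1')
           (use inj der in \<open>auto simp: T_def intro: has_field_derivative_at_within\<close>)
      also have "\<dots> \<longleftrightarrow> ((\<lambda>_. 1::real) has_integral r) (A \<inter> B)"
        unfolding im
        by (auto simp: has_integral_integrable_integral intro: nonnegative_absolutely_integrable_1
              set_lebesgue_integral_eq_integral)
      also have "\<dots> \<longleftrightarrow> ?r = ennreal r"
        using has_integral_iff_emeasure_lborel[of "A \<inter> B" r] r by auto
      finally show ?thesis .
    qed
    show ?thesis
      using *[of "enn2real ?l"] *[of "enn2real ?r"] by (metis enn2real_nonneg ennreal_enn2real less_top)
  qed
  \<comment> \<open>The equality on sets says that two measures on the target coincide; integrating
    \<open>f\<close> against both gives the general case.\<close>
  have M: "distr (density lborel (\<lambda>x. ennreal \<bar>g' x\<bar> * indicator S x)) borel g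
      = density lborel (indicator B)" (is "?M1 = ?M2")
  proof (rule measure_eqI)
    fix A assume A: "A \<in> sets ?M1"
    then have [measurable]: "A \<in> sets borel" by simp
    have gA: "g -` A \<in> sets borel" using measurable_sets[of g borel borel A] by simp
    have "emeasure ?M1 A = (\<integral>\<^sup>+x. ennreal \<bar>g' x\<bar> * indicator (S \<inter> g -` A) x \<partial>lborel)"
      using gA by (auto simp: emeasure_distr emeasure_density intro!: nn_integral_cong split: split_indicator)
    also have "\<dots> = emeasure ?M2 A"
      using eq by (simp add: emeasure_density nn_integral_indicator flip: indicator_inter_arith)
        (simp add: Int_commute)
    finally show "emeasure ?M1 A = emeasure ?M2 A" .
  qed simp
  have "(\<integral>\<^sup>+x. f (g x) * ennreal \<bar>g' x\<bar> * indicator S x \<partial>lborel) = (\<integral>\<^sup>+y. f y \<partial>?M1)"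
    by (simp add: nn_integral_distr nn_integral_density mult_ac)
  also have "\<dots> = (\<integral>\<^sup>+y. f y \<partial>?M2)" by (simp only: M)
  also have "\<dots> = (\<integral>\<^sup>+y. f y * indicator B y \<partial>lborel)"
    by (simp add: nn_integral_density mult_ac)
  finally show ?thesis .
qed

section \<open>Integration over finitely many real coordinates, one at a time\<close>

abbreviation L :: "nat \<Rightarrow> (nat \<Rightarrow> real) measure" where
  "L N \<equiv> PiM {..<N} (\<lambda>_. lborel)"

interpretation lborel_product: product_sigma_finite "\<lambda>_::nat. lborel :: real measure"
  by unfold_locales

lemma sigma_finite_L: "sigma_finite_measure (L N)"
  by (rule lborel_product.sigma_finite) simp

lemma sigma_finite_pair_L: "pair_sigma_finite (L N) (L M)" "pair_sigma_finite (L M) lborel"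
  by (simp_all add: pair_sigma_finite_def sigma_finite_L lborel.sigma_finite_measure_axioms)

lemma borel_measurable_nn_integral_L[measurable (raw)]:
  "(\<lambda>(x, y). f x y) \<in> borel_measurable (M \<Otimes>\<^sub>M L N) \<Longrightarrow> (\<lambda>x. \<integral>\<^sup>+y. f x y \<partial>L N) \<in> borel_measurable M"
  by (rule sigma_finite_measure.borel_measurable_nn_integral[OF sigma_finite_L])

lemma space_L: "space (L N) = extensional {..<N}"
  by (simp add: space_PiM PiE_def)

lemma measurable_L_upd[measurable]:
  "(\<lambda>(x, y). x(N := y)) \<in> measurable (L N \<Otimes>\<^sub>M lborel) (L (Suc N))"
  using measurable_add_dim[of N "{..<N}" "\<lambda>_. lborel"] by (simp add: lessThan_Suc)

lemma measurable_L_upd'[measurable (raw)]: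
  assumes "f \<in> measurable M (L N)" "g \<in> measurable M borel"
  shows "(\<lambda>w. (f w)(N := g w)) \<in> measurable M (L (Suc N))"
  using measurable_compose[OF measurable_Pair[OF assms(1), of g lborel] measurable_L_upd] assms(2) by simp

lemma nn_integral_L_0: "integral\<^sup>N (L 0) F = F (\<lambda>_. undefined)"
  by (simp add: lessThan_0 PiM_empty nn_integral_count_space_finite)

lemma nn_integral_L_Suc:
  assumes "F \<in> borel_measurable (L (Suc N))"
  shows "integral\<^sup>N (L (Suc N)) F = (\<integral>\<^sup>+x. (\<integral>\<^sup>+y. F (x(N := y)) \<partial>lborel) \<partial>L N)"
  using lborel_product.product_nn_integral_insert[of "{..<N}" N F] assms by (simp add: lessThan_Suc)

lemma nn_integral_L_Suc':
  assumes "F \<in> borel_measurable (L (Suc N))"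
  shows "integral\<^sup>N (L (Suc N)) F = (\<integral>\<^sup>+y. (\<integral>\<^sup>+x. F (x(N := y)) \<partial>L N) \<partial>lborel)"
  using lborel_product.product_nn_integral_insert_rev[of "{..<N}" N F] assms by (simp add: lessThan_Suc)

lemma measurable_L_restrict[measurable (raw)]:
  assumes "\<And>i. i < N \<Longrightarrow> (\<lambda>w. f w i) \<in> borel_measurable M"
  shows "(\<lambda>w. \<lambda>i\<in>{..<N}. f w i) \<in> measurable M (L N)"
  using assms by (intro measurable_restrict) auto

text \<open>Diagonal maps are handled one coordinate at a time. They are used to pass between
  residues for different numbers of roots or nodes, to reflect signs and to rescale the ensemble.
  The restriction keeps the image among the extensional functions on which the product measure
  lives.\<close>

lemma nn_integral_L_scale:
  assumes "\<And>i. i < N \<Longrightarrow> c i \<noteq> 0" "F \<in> borel_measurable (L N)"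
  shows "ennreal (\<Prod>i<N. \<bar>c i\<bar>) * (\<integral>\<^sup>+x. F (\<lambda>i\<in>{..<N}. c i * x i) \<partial>L N) = integral\<^sup>N (L N) F"
  using assms
proof (induction N arbitrary: F)
  case 0
  show ?case by (simp only: nn_integral_L_0) (simp add: restrict_def)
next
  case (Suc N)
  note [measurable] = Suc.prems(2)
  have upd: "(\<lambda>i\<in>{..<Suc N}. c i * (x(N := y)) i) = (\<lambda>i\<in>{..<N}. c i * x i)(N := c N * y)" for x y
    by (auto simp: fun_eq_iff restrict_def)
  have I: "(\<integral>\<^sup>+x. F (\<lambda>i\<in>{..<Suc N}. c i * x i) \<partial>L (Suc N))
      = (\<integral>\<^sup>+x. (\<integral>\<^sup>+y. F ((\<lambda>i\<in>{..<N}. c i * x i)(N := c N * y)) \<partial>lborel) \<partial>L N)"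
    by (subst nn_integral_L_Suc) (measurable, simp only: upd)
  have "ennreal \<bar>c N\<bar> * (\<integral>\<^sup>+x. F (\<lambda>i\<in>{..<Suc N}. c i * x i) \<partial>L (Suc N)) = (\<integral>\<^sup>+x. ennreal \<bar>c N\<bar> * (\<integral>\<^sup>+y. F ((\<lambda>i\<in>{..<N}. c i * x i)(N := c N * y)) \<partial>lborel) \<partial>L N)"
    unfolding I by (rule nn_integral_cmult[symmetric]) measurable
  also have "\<dots> = (\<integral>\<^sup>+x. (\<integral>\<^sup>+y. F ((\<lambda>i\<in>{..<N}. c i * x i)(N := y)) \<partial>lborel) \<partial>L N)"
  proof (rule nn_integral_cong)
    fix x assume "x \<in> space (L N)"
    have "(\<lambda>i\<in>{..<N}. c i * x i) \<in> space (L N)" by (auto simp: space_L)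
    then have [measurable]: "(\<lambda>y. F ((\<lambda>i\<in>{..<N}. c i * x i)(N := y))) \<in> borel_measurable borel"
      by measurable
    show "ennreal \<bar>c N\<bar> * (\<integral>\<^sup>+y. F ((\<lambda>i\<in>{..<N}. c i * x i)(N := c N * y)) \<partial>lborel)
      = (\<integral>\<^sup>+y. F ((\<lambda>i\<in>{..<N}. c i * x i)(N := y)) \<partial>lborel)"
      by (rule nn_integral_real_affine[of "\<lambda>y. F ((\<lambda>i\<in>{..<N}. c i * x i)(N := y))" "c N" 0, unfolded add_0, symmetric])
        (use Suc.prems(1) in \<open>simp_all only: lessI not_False_eq_True, measurable\<close>)
  qed
  finally have "ennreal (\<Prod>i<Suc N. \<bar>c i\<bar>) * (\<integral>\<^sup>+x. F (\<lambda>i\<in>{..<Suc N}. c i * x i) \<partial>L (Suc N))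
    = ennreal (\<Prod>i<N. \<bar>c i\<bar>) * (\<integral>\<^sup>+x. (\<integral>\<^sup>+y. F ((\<lambda>i\<in>{..<N}. c i * x i)(N := y)) \<partial>lborel) \<partial>L N)"
    by (simp only: prod.lessThan_Suc ennreal_mult prod_nonneg abs_ge_zero mult.assoc)
  also have "\<dots> = (\<integral>\<^sup>+x. (\<integral>\<^sup>+y. F (x(N := y)) \<partial>lborel) \<partial>L N)"
  proof (rule Suc.IH)
    show "(\<lambda>x. \<integral>\<^sup>+y. F (x(N := y)) \<partial>lborel) \<in> borel_measurable (L N)" by measurable
  qed (use Suc.prems(1) in auto)
  finally show ?case by (simp only: nn_integral_L_Suc[OF Suc.prems(2)])
qed

subsection \<open>Partial fractions\<close>

text \<open>For distinct nodes, the residue at \<open>t i\<close> of the rational function with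
  zeros \<open>x k\<close> and poles \<open>t j\<close>. The two counts are separate because
  numerators of degree one below, equal to and one above that of the denominator all occur.\<close>

definition pf_residue :: "nat \<Rightarrow> (nat \<Rightarrow> real) \<Rightarrow> nat \<Rightarrow> (nat \<Rightarrow> real) \<Rightarrow> nat \<Rightarrow> real" where
  "pf_residue N t M x i = (\<Prod>k<M. t i - x k) / (\<Prod>j\<in>{..<N} - {i}. t i - t j)"

lemma pf_residue_Suc_roots: "pf_residue N t (Suc M) x i = (t i - x M) * pf_residue N t M x i"
  by (simp add: pf_residue_def)

lemma pf_residue_Suc_nodes:
  "i < N \<Longrightarrow> pf_residue (Suc N) t M x i = pf_residue N t M x i / (t i - t N)"
proof -
  assume "i < N"
  then have "{..<Suc N} - {i} = insert N ({..<N} - {i})" by auto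
  then show ?thesis by (simp add: pf_residue_def)
qed

lemma pf_residue_last: "pf_residue (Suc N) t M x N = (\<Prod>k<M. t N - x k) / (\<Prod>j<N. t N - t j)"
proof -
  have "{..<Suc N} - {N} = {..<N}" by auto
  then show ?thesis by (simp add: pf_residue_def)
qed

text \<open>A further root multiplies every residue by \<open>t i - x N\<close>, a further node
  divides it by \<open>t i - t N\<close>. The polynomial part thereby picks up the residue sum, so
  expansions and sums need a common induction. \<open>?B\<close> and \<open>?C\<close> are the
  coefficients of 1/z and 1/z^2 at infinity; \<open>?E\<close> is the trace of the square of the
  diagonal matrix \<open>t\<close> bordered by a corner and a column whose squared entries are the
  negated residues.\<close>

lemma partial_fractions_aux:
  fixes t x :: "nat \<Rightarrow> real"
  shows "inj_on t {..<N} \<Longrightarrow>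
    (\<forall>z. (\<forall>i<N. z \<noteq> t i) \<longrightarrow>
       (\<Prod>k<N. z - x k) / (\<Prod>i<N. z - t i) = 1 + (\<Sum>i<N. pf_residue N t N x i / (z - t i))) \<and>
    (\<Sum>i<N. pf_residue N t N x i) = (\<Sum>i<N. t i) - (\<Sum>i<N. x i) \<and>
    2 * (\<Sum>i<N. t i * pf_residue N t N x i) =
      ((\<Sum>i<N. t i) - (\<Sum>i<N. x i))\<^sup>2 + (\<Sum>i<N. (t i)\<^sup>2) - (\<Sum>i<N. (x i)\<^sup>2) \<and>
    (\<forall>z. (\<forall>i<N. z \<noteq> t i) \<longrightarrow>
       (\<Prod>k<Suc N. z - x k) / (\<Prod>i<N. z - t i) =
       z - ((\<Sum>k<Suc N. x k) - (\<Sum>i<N. t i)) + (\<Sum>i<N. pf_residue N t (Suc N) x i / (z - t i))) \<and>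
    (\<Sum>k<Suc N. (x k)\<^sup>2) = (\<Sum>i<N. (t i)\<^sup>2) + ((\<Sum>k<Suc N. x k) - (\<Sum>i<N. t i))\<^sup>2
       - 2 * (\<Sum>i<N. pf_residue N t (Suc N) x i)"
    (is "_ \<Longrightarrow> ?A N \<and> ?B N \<and> ?C N \<and> ?D N \<and> ?E N")
proof -
  have AD: "?D N" if A: "?A N" and B: "?B N" for N
  proof (intro allI impI)
    fix z assume z: "\<forall>i<N. z \<noteq> t i"
    have "(\<Prod>k<Suc N. z - x k) / (\<Prod>i<N. z - t i) = (z - x N) * (1 + (\<Sum>i<N. pf_residue N t N x i / (z - t i)))"
      using A z by (simp add: mult.commute flip: times_divide_eq_right)
    also have "\<dots> = z - x N + (\<Sum>i<N. (z - x N) * (pf_residue N t N x i / (z - t i)))"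
      by (simp add: distrib_left sum_distrib_left)
    also have "(\<Sum>i<N. (z - x N) * (pf_residue N t N x i / (z - t i)))
        = (\<Sum>i<N. pf_residue N t N x i + pf_residue N t (Suc N) x i / (z - t i))"
      by (rule sum.cong) (use z in \<open>auto simp: pf_residue_Suc_roots field_simps\<close>)
    finally show "(\<Prod>k<Suc N. z - x k) / (\<Prod>i<N. z - t i) =
       z - ((\<Sum>k<Suc N. x k) - (\<Sum>i<N. t i)) + (\<Sum>i<N. pf_residue N t (Suc N) x i / (z - t i))"
      using B by (simp add: sum.distrib)
  qed
  have AE: "?E N" if B: "?B N" and C: "?C N" for N
  proof -
    have "(\<Sum>i<N. pf_residue N t (Suc N) x i)
        = (\<Sum>i<N. t i * pf_residue N t N x i) - x N * (\<Sum>i<N. pf_residue N t N x i)"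
      by (simp add: pf_residue_Suc_roots left_diff_distrib sum_subtractf sum_distrib_left)
    then show ?thesis using B C by (simp add: power2_eq_square algebra_simps)
  qed
  show "inj_on t {..<N} \<Longrightarrow> ?A N \<and> ?B N \<and> ?C N \<and> ?D N \<and> ?E N"
  proof (induction N)
    case 0
    show ?case by (simp add: power2_eq_square)
  next
    case (Suc N)
    have "inj_on t {..<N}" using Suc.prems by (rule inj_on_subset) auto
    with Suc.IH have D: "?D N" and E: "?E N" by blast+
    have ne: "t i \<noteq> t N" if "i < N" for i
      using Suc.prems that by (auto simp: inj_on_def)
    define s where "s = (\<Sum>k<Suc N. x k) - (\<Sum>i<N. t i)"
    define r where "r i = pf_residue (Suc N) t (Suc N) x i" for i
    define u where "u i = pf_residue N t (Suc N) x i" for i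
    have u: "u i = (t i - t N) * r i" if "i < N" for i
      using ne[OF that] that unfolding r_def u_def by (simp add: pf_residue_Suc_nodes)
    \<comment> \<open>The residue at the new node is the value there of the expansion without that
      node.\<close>
    have rN: "r N = t N - s - (\<Sum>i<N. r i)"
    proof -
      have "r N = t N - s + (\<Sum>i<N. u i / (t N - t i))"
        using D ne unfolding r_def u_def s_def pf_residue_last by (metis)
      also have "(\<Sum>i<N. u i / (t N - t i)) = - (\<Sum>i<N. r i)"
        unfolding sum_negf[symmetric]
      proof (rule sum.cong)
        fix i assume "i \<in> {..<N}"
        then have "t N - t i \<noteq> 0" "u i = - (t N - t i) * r i" using ne[of i] u by auto
        then show "u i / (t N - t i) = - r i" by (metis minus_mult_commute mult_minus_right nonzero_mult_div_cancel_left)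
      qed simp
      finally show ?thesis by simp
    qed
    have B: "?B (Suc N)" using rN unfolding r_def s_def by simp
    have su: "(\<Sum>i<N. u i) = (\<Sum>i<N. t i * r i) - t N * (\<Sum>i<N. r i)"
      by (simp add: u left_diff_distrib sum_subtractf sum_distrib_left)
    have E': "(\<Sum>k<Suc N. (x k)\<^sup>2) = (\<Sum>i<N. (t i)\<^sup>2) + s\<^sup>2 - 2 * (\<Sum>i<N. u i)"
      using E unfolding s_def u_def .
    have C: "?C (Suc N)"
    proof -
      have "2 * (\<Sum>i<Suc N. t i * r i) = (t N - s)\<^sup>2 + ((\<Sum>i<N. (t i)\<^sup>2) + (t N)\<^sup>2) - (\<Sum>k<Suc N. (x k)\<^sup>2)"
        unfolding E' su sum.lessThan_Suc[of "\<lambda>i. t i * r i"] rN by (simp add: power2_eq_square algebra_simps)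
      then show ?thesis unfolding r_def s_def by (simp add: algebra_simps)
    qed
    have A: "?A (Suc N)"
    proof (intro allI impI)
      fix z assume z: "\<forall>i<Suc N. z \<noteq> t i"
      have "(\<Prod>k<Suc N. z - x k) / (\<Prod>i<Suc N. z - t i) = (z - s + (\<Sum>i<N. u i / (z - t i))) / (z - t N)"
      proof -
        have "(\<Prod>k<Suc N. z - x k) / (\<Prod>i<N. z - t i) = z - s + (\<Sum>i<N. u i / (z - t i))"
          using D z unfolding s_def u_def by (meson less_SucI)
        then show ?thesis by (simp only: prod.lessThan_Suc[of "\<lambda>i. z - t i"] divide_divide_eq_left[symmetric])
      qed
      also have "\<dots> = 1 + (t N - s) / (z - t N) + (\<Sum>i<N. u i / (z - t i) / (z - t N))"
      proof -
        have "(z - s) / (z - t N) = 1 + (t N - s) / (z - t N)" using z by (simp add: field_simps)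
        then show ?thesis by (simp only: add_divide_distrib sum_divide_distrib)
      qed
      also have "(\<Sum>i<N. u i / (z - t i) / (z - t N)) = (\<Sum>i<N. r i / (z - t i) - r i / (z - t N))"
      proof (rule sum.cong)
        fix i assume i: "i \<in> {..<N}"
        then have "z \<noteq> t i" "z \<noteq> t N" using z by auto
        then show "u i / (z - t i) / (z - t N) = r i / (z - t i) - r i / (z - t N)"
          using i u by (simp add: field_simps)
      qed simp
      also have "1 + (t N - s) / (z - t N) + \<dots> = 1 + (\<Sum>i<Suc N. r i / (z - t i))"
        using rN by (simp add: sum_subtractf diff_divide_distrib sum_divide_distrib)
      finally show "(\<Prod>k<Suc N. z - x k) / (\<Prod>i<Suc N. z - t i)
        = 1 + (\<Sum>i<Suc N. pf_residue (Suc N) t (Suc N) x i / (z - t i))" unfolding r_def .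
    qed
    show ?case using A B C AD[OF A B] AE[OF B C] by blast
  qed
qed

lemma
  fixes t x :: "nat \<Rightarrow> real"
  assumes "inj_on t {..<N}"
  shows partial_fractions: "(\<And>i. i < N \<Longrightarrow> z \<noteq> t i) \<Longrightarrow>
       (\<Prod>k<N. z - x k) / (\<Prod>i<N. z - t i) = 1 + (\<Sum>i<N. pf_residue N t N x i / (z - t i))"
    and sum_pf_residue: "(\<Sum>i<N. pf_residue N t N x i) = (\<Sum>i<N. t i) - (\<Sum>i<N. x i)"
    and partial_fractions_Suc: "(\<And>i. i < N \<Longrightarrow> z \<noteq> t i) \<Longrightarrow>
       (\<Prod>k<Suc N. z - x k) / (\<Prod>i<N. z - t i) =
       z - ((\<Sum>k<Suc N. x k) - (\<Sum>i<N. t i)) + (\<Sum>i<N. pf_residue N t (Suc N) x i / (z - t i))"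
    and sum_squares_roots: "(\<Sum>k<Suc N. (x k)\<^sup>2) = (\<Sum>i<N. (t i)\<^sup>2) + ((\<Sum>k<Suc N. x k) - (\<Sum>i<N. t i))\<^sup>2
       - 2 * (\<Sum>i<N. pf_residue N t (Suc N) x i)"
  using partial_fractions_aux[OF assms, of x] by blast+

text \<open>An auxiliary last root \<open>b\<close> reduces this to equal numbers of roots and
  nodes, with residues \<open>(t i - b) * q i\<close>. Comparing \<open>b = 0\<close> with
  \<open>b = 1\<close> isolates the sum of the \<open>q i\<close>.\<close>

lemma
  fixes t m :: "nat \<Rightarrow> real"
  assumes inj: "inj_on t {..<Suc N}"
  shows sum_pf_residue_lower: "(\<Sum>i<Suc N. pf_residue (Suc N) t N m i) = 1"
    and partial_fractions_lower: "(\<And>i. i < Suc N \<Longrightarrow> z \<noteq> t i) \<Longrightarrow>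
      (\<Prod>k<N. z - m k) / (\<Prod>i<Suc N. z - t i) = (\<Sum>i<Suc N. pf_residue (Suc N) t N m i / (z - t i))"
proof -
  define q where "q i = pf_residue (Suc N) t N m i" for i
  have q: "pf_residue (Suc N) t (Suc N) (m(N := b)) i = (t i - b) * q i" for b i
    by (simp add: q_def pf_residue_Suc_roots) (simp add: pf_residue_def)
  have "(\<Sum>i<Suc N. (t i - b) * q i) = (\<Sum>i<Suc N. t i) - (\<Sum>i<N. m i) - b" for b
    using sum_pf_residue[OF inj, of "m(N := b)"] unfolding q by simp
  then have s: "(\<Sum>i<Suc N. t i * q i) - b * (\<Sum>i<Suc N. q i) = (\<Sum>i<Suc N. t i) - (\<Sum>i<N. m i) - b" for b
    by (simp add: left_diff_distrib sum_subtractf sum_distrib_left del: sum.lessThan_Suc)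
  show q1: "(\<Sum>i<Suc N. pf_residue (Suc N) t N m i) = 1"
    using s[of 0] s[of 1] unfolding q_def by linarith
  assume z: "\<And>i. i < Suc N \<Longrightarrow> z \<noteq> t i"
  \<comment> \<open>The auxiliary root \<open>z - 1\<close> contributes the factor 1 at the point
    \<open>z\<close>, so it leaves the quotient unchanged.\<close>
  have "(\<Prod>k<N. z - m k) / (\<Prod>i<Suc N. z - t i) = 1 + (\<Sum>i<Suc N. (t i - (z - 1)) * q i / (z - t i))"
    using partial_fractions[OF inj z, of "m(N := z - 1)"] unfolding q by simp
  also have "(\<Sum>i<Suc N. (t i - (z - 1)) * q i / (z - t i)) = (\<Sum>i<Suc N. q i / (z - t i) - q i)"
  proof (rule sum.cong)
    fix i assume "i \<in> {..<Suc N}"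
    then have "z - t i \<noteq> 0" using z by auto
    then show "(t i - (z - 1)) * q i / (z - t i) = q i / (z - t i) - q i" by (simp add: field_simps)
  qed simp
  finally show "(\<Prod>k<N. z - m k) / (\<Prod>i<Suc N. z - t i) = (\<Sum>i<Suc N. pf_residue (Suc N) t N m i / (z - t i))"
    using q1 unfolding q_def sum_subtractf by simp
qed

subsection \<open>From roots to residues\<close>

definition vandermonde :: "nat \<Rightarrow> (nat \<Rightarrow> real) \<Rightarrow> real" where
  "vandermonde N x = (\<Prod>j<N. \<Prod>k\<in>{j<..<N}. \<bar>x j - x k\<bar>)"

lemma vandermonde_0 [simp]: "vandermonde 0 x = 1"
  by (simp add: vandermonde_def)

lemma vandermonde_Suc: "vandermonde (Suc N) x = vandermonde N x * (\<Prod>j<N. \<bar>x j - x N\<bar>)"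
proof -
  have "(\<Prod>j<N. \<Prod>k\<in>{j<..<Suc N}. \<bar>x j - x k\<bar>) = (\<Prod>j<N. (\<Prod>k\<in>{j<..<N}. \<bar>x j - x k\<bar>) * \<bar>x j - x N\<bar>)"
  proof (rule prod.cong)
    fix j assume "j \<in> {..<N}"
    then have "{j<..<Suc N} = insert N {j<..<N}" by auto
    then show "(\<Prod>k\<in>{j<..<Suc N}. \<bar>x j - x k\<bar>) = (\<Prod>k\<in>{j<..<N}. \<bar>x j - x k\<bar>) * \<bar>x j - x N\<bar>"
      by (simp add: mult.commute)
  qed simp
  moreover have "{N<..<Suc N} = {}" by auto
  ultimately show ?thesis by (simp add: vandermonde_def prod.distrib)
qed

lemma vandermonde_nonneg: "0 \<le> vandermonde N x"
  by (simp add: vandermonde_def prod_nonneg)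

lemma vandermonde_cong: "(\<And>i. i < N \<Longrightarrow> x i = y i) \<Longrightarrow> vandermonde N x = vandermonde N y"
  by (simp add: vandermonde_def)

lemma measurable_vandermonde[measurable]: "vandermonde N \<in> borel_measurable (L N)"
  unfolding vandermonde_def[abs_def] by measurable

lemma pf_residue_cong:
  "(\<And>k. k < M \<Longrightarrow> x k = y k) \<Longrightarrow> pf_residue N t M x i = pf_residue N t M y i"
  by (simp add: pf_residue_def)

lemma measurable_pf_residue[measurable]: "M \<le> K \<Longrightarrow> (\<lambda>x. pf_residue N t M x i) \<in> borel_measurable (L K)"
  unfolding pf_residue_def[abs_def] by measurable

text \<open>Change of variables from the roots \<open>x\<close> to the residues of
  \<open>(\<Prod>k. z - x k) / (\<Prod>i. z - t i)\<close> at fixed nodes \<open>t\<close>. Restricting to functions \<open>F\<close> supported on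
  the image of the box \<open>I\<close> avoids any discussion of the measurability of that image. In the primed
  version there is one root more than there are nodes; the additional coordinate \<open>s\<close> is read off
  the expansion \<open>z - s + (\<Sum>i. u i / (z - t i))\<close>.\<close>

definition "residue_cv N t I \<longleftrightarrow> (\<forall>F \<in> borel_measurable (L N).
   (\<forall>r\<in>space (L N). F r \<noteq> 0 \<longrightarrow>
      (\<exists>x. (\<forall>i<N. x i \<in> I i) \<and> r = (\<lambda>i\<in>{..<N}. pf_residue N t N x i))) \<longrightarrow>
   (\<integral>\<^sup>+x. indicator {x. \<forall>i<N. x i \<in> I i} x * F (\<lambda>i\<in>{..<N}. pf_residue N t N x i) * ennreal (vandermonde N x) \<partial>L N)
     = ennreal (vandermonde N t) * integral\<^sup>N (L N) F)"

definition "residue_cv' N t I \<longleftrightarrow> (\<forall>F \<in> borel_measurable (lborel \<Otimes>\<^sub>M L N).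
   (\<forall>s. \<forall>u\<in>space (L N). F (s, u) \<noteq> 0 \<longrightarrow>
      (\<exists>x. (\<forall>i<Suc N. x i \<in> I i) \<and> s = (\<Sum>i<Suc N. x i) - (\<Sum>i<N. t i) \<and>
         u = (\<lambda>i\<in>{..<N}. pf_residue N t (Suc N) x i))) \<longrightarrow>
   (\<integral>\<^sup>+x. indicator {x. \<forall>i<Suc N. x i \<in> I i} x *
        F ((\<Sum>i<Suc N. x i) - (\<Sum>i<N. t i), \<lambda>i\<in>{..<N}. pf_residue N t (Suc N) x i) *
        ennreal (vandermonde (Suc N) x) \<partial>L (Suc N))
     = ennreal (vandermonde N t) * (\<integral>\<^sup>+u. \<integral>\<^sup>+s. F (s, u) \<partial>lborel \<partial>L N))"

lemma measurable_box[measurable]: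
  assumes [measurable]: "\<And>i. i < N \<Longrightarrow> I i \<in> sets borel"
  shows "Measurable.pred (L N) (\<lambda>x. \<forall>i<N. x i \<in> I i)"
  using assms by measurable

lemma residue_cv_0: "residue_cv 0 t I"
  unfolding residue_cv_def
  by (simp only: nn_integral_L_0) (simp add: indicator_def restrict_def)

text \<open>For fixed residues \<open>u\<close> the last root \<open>l\<close> is a zero of \<open>l - s + (\<Sum>i. u i / (l - t i))\<close>, so exchanging
  \<open>l\<close> for \<open>s\<close> is a one-dimensional substitution, injective because the box contains only one root in
  \<open>I N\<close>. Its Jacobian is exactly what the factors containing \<open>l\<close> in the Vandermonde product leave over.\<close>

lemma residue_cv_imp_cv':
  assumes t: "inj_on t {..<N}"
    and I [measurable]: "\<And>i. i < Suc N \<Longrightarrow> I i \<in> sets borel"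
    and disj: "\<And>i j. i < j \<Longrightarrow> j < Suc N \<Longrightarrow> I i \<inter> I j = {}"
    and tI: "\<And>i j. i < N \<Longrightarrow> j < Suc N \<Longrightarrow> t i \<notin> I j"
    and cv: "residue_cv N t I"
  shows "residue_cv' N t I"
  unfolding residue_cv'_def
proof (intro ballI impI)
  fix F :: "real \<times> (nat \<Rightarrow> real) \<Rightarrow> ennreal"
  assume F [measurable]: "F \<in> borel_measurable (lborel \<Otimes>\<^sub>M L N)"
  assume supp: "\<forall>s. \<forall>u\<in>space (L N). F (s, u) \<noteq> 0 \<longrightarrow>
      (\<exists>x. (\<forall>i<Suc N. x i \<in> I i) \<and> s = (\<Sum>i<Suc N. x i) - (\<Sum>i<N. t i) \<and>
         u = (\<lambda>i\<in>{..<N}. pf_residue N t (Suc N) x i))"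
  \<comment> \<open>\<open>\<sigma> u l\<close> is the value of \<open>s\<close> for which
    \<open>l\<close> becomes a zero of the expansion with residues \<open>u\<close>;
    \<open>\<sigma>'\<close> is its derivative in \<open>l\<close>.\<close>
  define \<sigma> where "\<sigma> u l = l + (\<Sum>i<N. u i / (l - t i))" for u :: "nat \<Rightarrow> real" and l
  define \<sigma>' where "\<sigma>' u l = 1 - (\<Sum>i<N. u i / (l - t i)\<^sup>2)" for u :: "nat \<Rightarrow> real" and l
  define G where "G u l = F (\<sigma> u l, u) * ennreal \<bar>\<sigma>' u l\<bar>" for u l
  have [measurable]: "(\<lambda>(u, l). \<sigma> u l) \<in> borel_measurable (L N \<Otimes>\<^sub>M lborel)"
    unfolding \<sigma>_def by measurable
  have [measurable]: "(\<lambda>(u, l). \<sigma>' u l) \<in> borel_measurable (L N \<Otimes>\<^sub>M lborel)"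
    unfolding \<sigma>'_def by measurable
  have [measurable]: "(\<lambda>(u, l). G u l) \<in> borel_measurable (L N \<Otimes>\<^sub>M lborel)"
    unfolding G_def by measurable
  have [measurable]: "(\<lambda>(l, u). G u l) \<in> borel_measurable (lborel \<Otimes>\<^sub>M L N)"
    unfolding G_def \<sigma>_def \<sigma>'_def by measurable
  \<comment> \<open>A zero of the expansion is one of the \<open>x k\<close>, and disjointness of
    the boxes leaves only \<open>k = N\<close>. This gives the injectivity of the
    substitution.\<close>
  have root: "l = x N"
    if x: "\<forall>i<Suc N. x i \<in> I i" and l: "l \<in> I N"
      and u: "u = (\<lambda>i\<in>{..<N}. pf_residue N t (Suc N) x i)"
      and s: "\<sigma> u l = (\<Sum>i<Suc N. x i) - (\<Sum>i<N. t i)" for x l u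
  proof -
    have ne: "l \<noteq> t i" if "i < N" for i using tI l that by blast
    have "(\<Prod>k<Suc N. l - x k) / (\<Prod>i<N. l - t i) = 0"
      using partial_fractions_Suc[OF t ne, of x] s by (simp add: \<sigma>_def u)
    then have "(\<Prod>k<Suc N. l - x k) = 0" using ne by simp
    then have "\<exists>k\<in>{..<Suc N}. l - x k = 0" by (subst (asm) prod_zero_iff) auto
    then obtain k where k: "k < Suc N" "l = x k" by auto
    then have "\<not> k < N" using disj[of k N] x l by auto
    then show ?thesis using k by (simp add: less_Suc_eq)
  qed
  have root': "\<sigma> u (x N) = (\<Sum>i<Suc N. x i) - (\<Sum>i<N. t i)"
    if x: "\<forall>i<Suc N. x i \<in> I i" and u: "u = (\<lambda>i\<in>{..<N}. pf_residue N t (Suc N) x i)" for x u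
  proof -
    have ne: "x N \<noteq> t i" if "i < N" for i using tI[of i N] x that by auto
    have "(\<Prod>k<Suc N. x N - x k) = 0" by simp
    then show ?thesis
      using partial_fractions_Suc[OF t ne, of x] by (simp add: \<sigma>_def u)
  qed
  have step1: "(\<integral>\<^sup>+x. indicator {x. \<forall>i<Suc N. x i \<in> I i} (x(N := l)) *
        F ((\<Sum>i<Suc N. (x(N := l)) i) - (\<Sum>i<N. t i), \<lambda>i\<in>{..<N}. pf_residue N t (Suc N) (x(N := l)) i) *
        ennreal (vandermonde (Suc N) (x(N := l))) \<partial>L N)
      = ennreal (vandermonde N t) * (indicator (I N) l * (\<integral>\<^sup>+u. G u l \<partial>L N))" for l
  proof (cases "l \<in> I N")
    case False
    then have "indicator {x. \<forall>i<Suc N. x i \<in> I i} (x(N := l)) = (0::ennreal)" for x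
      by (auto simp: indicator_def)
    then show ?thesis using False by (simp only: mult_zero_left) simp
  next
    case l: True
    have ne: "l \<noteq> t i" if "i < N" for i using tI l that by blast
    \<comment> \<open>With the root \<open>l\<close> fixed, \<open>u\<close> is the vector
      \<open>r\<close> of residues for the remaining roots, scaled by \<open>t i - l\<close>; the
      product in front is the Jacobian of that scaling.\<close>
    define Fl where "Fl r = ennreal (\<Prod>i<N. \<bar>t i - l\<bar>) * G (\<lambda>i\<in>{..<N}. (t i - l) * r i) l" for r
    have [measurable]: "Fl \<in> borel_measurable (L N)"
      unfolding Fl_def by measurable
    have [measurable]: "(\<lambda>u. G u l) \<in> borel_measurable (L N)" by measurable
    have sig: "\<sigma> (\<lambda>i\<in>{..<N}. (t i - l) * r i) l = l - (\<Sum>i<N. r i)" for r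
    proof -
      have "(\<Sum>i<N. (t i - l) * r i / (l - t i)) = (\<Sum>i<N. - r i)"
      proof (rule sum.cong)
        fix i assume "i \<in> {..<N}"
        then have "l - t i \<noteq> 0" using ne by auto
        then show "(t i - l) * r i / (l - t i) = - r i"
          by (metis minus_diff_eq minus_mult_commute mult_minus_right nonzero_mult_div_cancel_left)
      qed simp
      then show ?thesis by (simp add: \<sigma>_def sum_negf)
    qed
    have sig': "\<sigma>' (\<lambda>i\<in>{..<N}. (t i - l) * r i) l = 1 + (\<Sum>i<N. r i / (l - t i))" for r
    proof -
      have "(\<Sum>i<N. (t i - l) * r i / (l - t i)\<^sup>2) = (\<Sum>i<N. - (r i / (l - t i)))"
      proof (rule sum.cong)
        fix i assume "i \<in> {..<N}"
        then have "l - t i \<noteq> 0" using ne by auto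
        then show "(t i - l) * r i / (l - t i)\<^sup>2 = - (r i / (l - t i))"
          by (simp add: divide_simps power2_eq_square) (simp add: algebra_simps)
      qed simp
      then show ?thesis by (simp add: \<sigma>'_def sum_negf)
    qed
    have suppl: "\<exists>x. (\<forall>i<N. x i \<in> I i) \<and> r = (\<lambda>i\<in>{..<N}. pf_residue N t N x i)"
      if r: "r \<in> space (L N)" and Fr: "Fl r \<noteq> 0" for r
    proof -
      define u where "u = (\<lambda>i\<in>{..<N}. (t i - l) * r i)"
      have "F (\<sigma> u l, u) \<noteq> 0" using Fr by (auto simp: Fl_def G_def u_def)
      moreover have "u \<in> space (L N)" by (simp add: u_def space_L)
      ultimately obtain x where x: "\<forall>i<Suc N. x i \<in> I i"
        "\<sigma> u l = (\<Sum>i<Suc N. x i) - (\<Sum>i<N. t i)" "u = (\<lambda>i\<in>{..<N}. pf_residue N t (Suc N) x i)"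
        using supp by metis
      have lx: "l = x N" by (rule root) (use x l in auto)
      have "r i = pf_residue N t N x i" if i: "i < N" for i
      proof -
        have "u i = (t i - l) * r i" using i by (simp add: u_def)
        moreover have "u i = pf_residue N t (Suc N) x i" using i by (subst x(3)) simp
        ultimately have "u i = (t i - l) * r i" "u i = pf_residue N t (Suc N) x i" by auto
        then show ?thesis using ne[OF i] lx by (simp add: pf_residue_Suc_roots)
      qed
      then have "r = (\<lambda>i\<in>{..<N}. pf_residue N t N x i)"
        using r by (auto simp: space_L extensional_def restrict_def)
      then show ?thesis using x(1) by (intro exI[of _ x]) auto
    qed
    have "(\<integral>\<^sup>+x. indicator {x. \<forall>i<Suc N. x i \<in> I i} (x(N := l)) *
        F ((\<Sum>i<Suc N. (x(N := l)) i) - (\<Sum>i<N. t i), \<lambda>i\<in>{..<N}. pf_residue N t (Suc N) (x(N := l)) i) *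
        ennreal (vandermonde (Suc N) (x(N := l))) \<partial>L N)
      = (\<integral>\<^sup>+x. indicator {x. \<forall>i<N. x i \<in> I i} x * Fl (\<lambda>i\<in>{..<N}. pf_residue N t N x i) *
           ennreal (vandermonde N x) \<partial>L N)"
    proof (rule nn_integral_cong)
      fix x
      define r where "r = (\<lambda>i\<in>{..<N}. pf_residue N t N x i)"
      have 1: "(indicator {x. \<forall>i<Suc N. x i \<in> I i} (x(N := l)) :: ennreal) = indicator {x. \<forall>i<N. x i \<in> I i} x"
        using l by (auto simp: indicator_def less_Suc_eq)
      have 2: "(\<lambda>i\<in>{..<N}. pf_residue N t (Suc N) (x(N := l)) i) = (\<lambda>i\<in>{..<N}. (t i - l) * r i)"
        by (auto simp: r_def pf_residue_Suc_roots restrict_def fun_eq_iff intro!: pf_residue_cong)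
      have 3: "(\<Sum>i<Suc N. (x(N := l)) i) - (\<Sum>i<N. t i) = \<sigma> (\<lambda>i\<in>{..<N}. (t i - l) * r i) l"
        unfolding sig using sum_pf_residue[OF t, of x] by (simp add: r_def)
      \<comment> \<open>The expansion with one root fewer has the value \<open>\<sigma>'\<close> at
        \<open>l\<close>, so the new Vandermonde factors are exactly the product of the two
        Jacobians.\<close>
      have "(\<Prod>k<N. l - x k) = (\<Prod>i<N. l - t i) * \<sigma>' (\<lambda>i\<in>{..<N}. (t i - l) * r i) l"
        unfolding sig' using partial_fractions[OF t ne, of x] ne by (simp add: r_def field_simps)
      then have "(\<Prod>k<N. \<bar>x k - l\<bar>) = (\<Prod>i<N. \<bar>t i - l\<bar>) * \<bar>\<sigma>' (\<lambda>i\<in>{..<N}. (t i - l) * r i) l\<bar>"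
        by (simp add: abs_minus_commute[of _ l] flip: abs_prod abs_mult)
      moreover have "vandermonde N (x(N := l)) = vandermonde N x" by (rule vandermonde_cong) simp
      ultimately have 4: "vandermonde (Suc N) (x(N := l))
          = (\<Prod>i<N. \<bar>t i - l\<bar>) * \<bar>\<sigma>' (\<lambda>i\<in>{..<N}. (t i - l) * r i) l\<bar> * vandermonde N x"
        by (simp add: vandermonde_Suc)
      show "indicator {x. \<forall>i<Suc N. x i \<in> I i} (x(N := l)) *
        F ((\<Sum>i<Suc N. (x(N := l)) i) - (\<Sum>i<N. t i), \<lambda>i\<in>{..<N}. pf_residue N t (Suc N) (x(N := l)) i) *
        ennreal (vandermonde (Suc N) (x(N := l)))
        = indicator {x. \<forall>i<N. x i \<in> I i} x * Fl (\<lambda>i\<in>{..<N}. pf_residue N t N x i) *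
           ennreal (vandermonde N x)"
        unfolding 1 2 3 4 Fl_def G_def r_def[symmetric]
        by (simp add: ennreal_mult prod_nonneg vandermonde_nonneg mult_ac)
    qed
    also have "\<dots> = ennreal (vandermonde N t) * integral\<^sup>N (L N) Fl"
      using cv suppl unfolding residue_cv_def by (metis (no_types, lifting) \<open>Fl \<in> borel_measurable (L N)\<close>)
    also have "integral\<^sup>N (L N) Fl = (\<integral>\<^sup>+u. G u l \<partial>L N)"
    proof -
      have "integral\<^sup>N (L N) Fl = ennreal (\<Prod>i<N. \<bar>t i - l\<bar>) * (\<integral>\<^sup>+r. G (\<lambda>i\<in>{..<N}. (t i - l) * r i) l \<partial>L N)"
        unfolding Fl_def by (rule nn_integral_cmult) measurable
      also have "\<dots> = (\<integral>\<^sup>+u. G u l \<partial>L N)"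
        by (rule nn_integral_L_scale) (use ne in auto)
      finally show ?thesis .
    qed
    finally show ?thesis by (simp only: l indicator_simps mult_1_left)
  qed
  have step2: "(\<integral>\<^sup>+l. indicator (I N) l * G u l \<partial>lborel) = (\<integral>\<^sup>+s. F (s, u) \<partial>lborel)"
    if u [measurable]: "u \<in> space (L N)" for u
  proof -
    have [measurable]: "(\<lambda>s. F (s, u)) \<in> borel_measurable borel" using u F by simp
    have [measurable]: "\<sigma> u \<in> borel_measurable borel" "\<sigma>' u \<in> borel_measurable borel"
      unfolding \<sigma>_def[abs_def] \<sigma>'_def[abs_def] by measurable
    \<comment> \<open>The support condition on \<open>F\<close> is the only source of injectivity
      and surjectivity, so the substitution runs between the sets on which the integrand is
      nonzero.\<close>
    define S where "S = {l \<in> I N. F (\<sigma> u l, u) \<noteq> 0}"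
    define B where "B = {s. F (s, u) \<noteq> 0}"
    have "S = I N \<inter> {l \<in> space borel. F (\<sigma> u l, u) \<noteq> 0}" by (auto simp: S_def)
    then have [measurable]: "S \<in> sets borel" by simp
    have "B = {s \<in> space borel. F (s, u) \<noteq> 0}" by (auto simp: B_def)
    then have [measurable]: "B \<in> sets borel" by simp
    have "bij_betw (\<sigma> u) S B"
    proof (rule bij_betwI')
      fix l l' assume l: "l \<in> S" "l' \<in> S"
      then obtain x where x: "\<forall>i<Suc N. x i \<in> I i"
        "\<sigma> u l = (\<Sum>i<Suc N. x i) - (\<Sum>i<N. t i)" "u = (\<lambda>i\<in>{..<N}. pf_residue N t (Suc N) x i)"
        using supp u unfolding S_def by blast
      have "l = x N" by (rule root) (use x l in \<open>auto simp: S_def\<close>)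
      moreover have "l' = x N" if "\<sigma> u l = \<sigma> u l'" by (rule root) (use x l that in \<open>auto simp: S_def\<close>)
      ultimately show "(\<sigma> u l = \<sigma> u l') = (l = l')" by auto
    next
      fix s assume "s \<in> B"
      then obtain x where x: "\<forall>i<Suc N. x i \<in> I i"
        "s = (\<Sum>i<Suc N. x i) - (\<Sum>i<N. t i)" "u = (\<lambda>i\<in>{..<N}. pf_residue N t (Suc N) x i)"
        using supp u unfolding B_def by blast
      have s: "\<sigma> u (x N) = s" using root'[OF x(1,3)] x(2) by simp
      show "\<exists>l\<in>S. s = \<sigma> u l"
        by (rule bexI[of _ "x N"]) (use s x(1) \<open>s \<in> B\<close> in \<open>auto simp: S_def B_def\<close>)
    qed (auto simp: S_def B_def)
    moreover have "(\<sigma> u has_real_derivative \<sigma>' u l) (at l)" if "l \<in> S" for l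
    proof -
      have ne: "l - t i \<noteq> 0" if "i < N" for i using tI[of i N] \<open>l \<in> S\<close> that by (auto simp: S_def)
      show ?thesis unfolding \<sigma>_def[abs_def] \<sigma>'_def
        by (rule derivative_eq_intros refl | use ne in force)+
           (auto simp: sum_negf power2_eq_square)
    qed
    ultimately have "(\<integral>\<^sup>+l. F (\<sigma> u l, u) * ennreal \<bar>\<sigma>' u l\<bar> * indicator S l \<partial>lborel)
        = (\<integral>\<^sup>+s. F (s, u) * indicator B s \<partial>lborel)"
      by (intro nn_integral_change_of_variables_1) auto
    moreover have "(\<integral>\<^sup>+l. F (\<sigma> u l, u) * ennreal \<bar>\<sigma>' u l\<bar> * indicator S l \<partial>lborel)
        = (\<integral>\<^sup>+l. indicator (I N) l * G u l \<partial>lborel)"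
      by (rule nn_integral_cong) (auto simp: G_def S_def indicator_def)
    moreover have "(\<integral>\<^sup>+s. F (s, u) * indicator B s \<partial>lborel) = (\<integral>\<^sup>+s. F (s, u) \<partial>lborel)"
      by (rule nn_integral_cong) (auto simp: B_def indicator_def)
    ultimately show ?thesis by simp
  qed
  have [measurable]: "I N \<in> sets borel" by simp
  have "(\<integral>\<^sup>+x. indicator {x. \<forall>i<Suc N. x i \<in> I i} x *
        F ((\<Sum>i<Suc N. x i) - (\<Sum>i<N. t i), \<lambda>i\<in>{..<N}. pf_residue N t (Suc N) x i) *
        ennreal (vandermonde (Suc N) x) \<partial>L (Suc N))
     = (\<integral>\<^sup>+l. ennreal (vandermonde N t) * (indicator (I N) l * (\<integral>\<^sup>+u. G u l \<partial>L N)) \<partial>lborel)"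
  proof (subst nn_integral_L_Suc')
    show "(\<lambda>x. indicator {x. \<forall>i<Suc N. x i \<in> I i} x *
        F ((\<Sum>i<Suc N. x i) - (\<Sum>i<N. t i), \<lambda>i\<in>{..<N}. pf_residue N t (Suc N) x i) *
        ennreal (vandermonde (Suc N) x)) \<in> borel_measurable (L (Suc N))"
      by measurable
  qed (simp only: step1)
  also have "\<dots> = ennreal (vandermonde N t) * (\<integral>\<^sup>+l. (\<integral>\<^sup>+u. indicator (I N) l * G u l \<partial>L N) \<partial>lborel)"
  proof -
    have "(\<integral>\<^sup>+u. indicator (I N) l * G u l \<partial>L N) = indicator (I N) l * (\<integral>\<^sup>+u. G u l \<partial>L N)" for l
      by (rule nn_integral_cmult) measurable
    moreover have "(\<lambda>l. indicator (I N) l * (\<integral>\<^sup>+u. G u l \<partial>L N)) \<in> borel_measurable lborel"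
      by measurable
    ultimately show ?thesis by (simp only: nn_integral_cmult)
  qed
  also have "(\<integral>\<^sup>+l. (\<integral>\<^sup>+u. indicator (I N) l * G u l \<partial>L N) \<partial>lborel)
      = (\<integral>\<^sup>+u. (\<integral>\<^sup>+l. indicator (I N) l * G u l \<partial>lborel) \<partial>L N)"
    by (rule pair_sigma_finite.Fubini'[OF sigma_finite_pair_L(2)]) measurable
  also have "\<dots> = (\<integral>\<^sup>+u. (\<integral>\<^sup>+s. F (s, u) \<partial>lborel) \<partial>L N)"
    by (rule nn_integral_cong) (rule step2)
  finally show "(\<integral>\<^sup>+x. indicator {x. \<forall>i<Suc N. x i \<in> I i} x *
        F ((\<Sum>i<Suc N. x i) - (\<Sum>i<N. t i), \<lambda>i\<in>{..<N}. pf_residue N t (Suc N) x i) *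
        ennreal (vandermonde (Suc N) x) \<partial>L (Suc N))
     = ennreal (vandermonde N t) * (\<integral>\<^sup>+u. (\<integral>\<^sup>+s. F (s, u) \<partial>lborel) \<partial>L N)" .
qed

text \<open>The new residues are an affine image of \<open>(s, u)\<close>: each \<open>u i\<close>
  is divided by \<open>t i - t N\<close>, and the last entry is fixed because all residues sum to
  \<open>t N - s\<close>. The determinant becomes the Vandermonde factors of the node
  \<open>t N\<close>.\<close>

lemma residue_cv'_imp_cv:
  assumes t: "inj_on t {..<Suc N}"
    and I [measurable]: "\<And>i. i < Suc N \<Longrightarrow> I i \<in> sets borel"
    and cv': "residue_cv' N t I"
  shows "residue_cv (Suc N) t I"
  unfolding residue_cv_def
proof (intro ballI impI)
  fix F :: "(nat \<Rightarrow> real) \<Rightarrow> ennreal"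
  assume F [measurable]: "F \<in> borel_measurable (L (Suc N))"
  assume supp: "\<forall>r\<in>space (L (Suc N)). F r \<noteq> 0 \<longrightarrow>
      (\<exists>x. (\<forall>i<Suc N. x i \<in> I i) \<and> r = (\<lambda>i\<in>{..<Suc N}. pf_residue (Suc N) t (Suc N) x i))"
  have t': "inj_on t {..<N}" using t by (rule inj_on_subset) auto
  have ne: "t i - t N \<noteq> 0" if "i < N" for i using t that by (auto simp: inj_on_def)
  define \<rho> where "\<rho> u = (\<lambda>i\<in>{..<N}. u i / (t i - t N))" for u :: "nat \<Rightarrow> real"
  define F' where "F' = (\<lambda>(s, u). F ((\<rho> u)(N := t N - s - (\<Sum>i<N. \<rho> u i))))"
  have [measurable]: "\<rho> \<in> measurable (L N) (L N)"
    unfolding \<rho>_def[abs_def] by measurable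
  have [measurable]: "(\<lambda>u. \<rho> u i) \<in> borel_measurable (L N)" if "i < N" for i
    using that by (simp add: \<rho>_def)
  have [measurable]: "(\<lambda>x. \<Sum>i<N. \<rho> (snd x) i) \<in> borel_measurable (lborel \<Otimes>\<^sub>M L N)"
    by measurable
  have F'm: "F' \<in> borel_measurable (lborel \<Otimes>\<^sub>M L N)"
    unfolding F'_def case_prod_beta by measurable
  have res: "(\<rho> (\<lambda>i\<in>{..<N}. pf_residue N t (Suc N) x i))
      (N := t N - ((\<Sum>i<Suc N. x i) - (\<Sum>i<N. t i)) - (\<Sum>i<N. \<rho> (\<lambda>i\<in>{..<N}. pf_residue N t (Suc N) x i) i))
      = (\<lambda>i\<in>{..<Suc N}. pf_residue (Suc N) t (Suc N) x i)" for x
  proof -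
    have r: "\<rho> (\<lambda>i\<in>{..<N}. pf_residue N t (Suc N) x i) i = pf_residue (Suc N) t (Suc N) x i" if "i < N" for i
      using that by (simp add: \<rho>_def pf_residue_Suc_nodes)
    have "t N - ((\<Sum>i<Suc N. x i) - (\<Sum>i<N. t i)) - (\<Sum>i<N. \<rho> (\<lambda>i\<in>{..<N}. pf_residue N t (Suc N) x i) i)
        = pf_residue (Suc N) t (Suc N) x N"
    proof -
      have "(\<Sum>i<N. \<rho> (\<lambda>i\<in>{..<N}. pf_residue N t (Suc N) x i) i) = (\<Sum>i<N. pf_residue (Suc N) t (Suc N) x i)"
        by (rule sum.cong) (use r in auto)
      then show ?thesis using sum_pf_residue[OF t, of x] by (simp only: sum.lessThan_Suc)
    qed
    then show ?thesis using r by (auto simp: fun_eq_iff less_Suc_eq) (simp add: \<rho>_def)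
  qed
  have supp': "\<exists>x. (\<forall>i<Suc N. x i \<in> I i) \<and> s = (\<Sum>i<Suc N. x i) - (\<Sum>i<N. t i) \<and>
         u = (\<lambda>i\<in>{..<N}. pf_residue N t (Suc N) x i)"
    if u: "u \<in> space (L N)" and Fu: "F' (s, u) \<noteq> 0" for s u
  proof -
    define r where "r = (\<rho> u)(N := t N - s - (\<Sum>i<N. \<rho> u i))"
    have "r \<in> space (L (Suc N))" by (auto simp: r_def \<rho>_def space_L extensional_def)
    moreover have "F r \<noteq> 0" using Fu by (simp add: F'_def r_def)
    ultimately obtain x where x: "\<forall>i<Suc N. x i \<in> I i"
      "r = (\<lambda>i\<in>{..<Suc N}. pf_residue (Suc N) t (Suc N) x i)" using supp by blast
    have rx: "r i = pf_residue (Suc N) t (Suc N) x i" if "i < Suc N" for i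
      using that by (subst x(2)) simp
    have "u i = pf_residue N t (Suc N) x i" if i: "i < N" for i
    proof -
      have "r i = u i / (t i - t N)" using i by (simp add: r_def \<rho>_def)
      then show ?thesis using rx[of i] i ne[OF i] by (simp add: pf_residue_Suc_nodes)
    qed
    then have "u = (\<lambda>i\<in>{..<N}. pf_residue N t (Suc N) x i)"
      using u by (auto simp: space_L extensional_def restrict_def)
    moreover have "(\<Sum>i<Suc N. r i) = t N - s" by (simp add: r_def)
    then have "t N - s = (\<Sum>i<Suc N. pf_residue (Suc N) t (Suc N) x i)" using rx by simp
    then have "t N - s = (\<Sum>i<Suc N. t i) - (\<Sum>i<Suc N. x i)"
      by (simp only: sum_pf_residue[OF t])
    then have "s = (\<Sum>i<Suc N. x i) - (\<Sum>i<N. t i)" by simp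
    ultimately show ?thesis using x(1) by blast
  qed
  have "(\<integral>\<^sup>+x. indicator {x. \<forall>i<Suc N. x i \<in> I i} x * F (\<lambda>i\<in>{..<Suc N}. pf_residue (Suc N) t (Suc N) x i) *
        ennreal (vandermonde (Suc N) x) \<partial>L (Suc N))
     = (\<integral>\<^sup>+x. indicator {x. \<forall>i<Suc N. x i \<in> I i} x *
        F' ((\<Sum>i<Suc N. x i) - (\<Sum>i<N. t i), \<lambda>i\<in>{..<N}. pf_residue N t (Suc N) x i) *
        ennreal (vandermonde (Suc N) x) \<partial>L (Suc N))"
    unfolding F'_def prod.case res ..
  also have "\<dots> = ennreal (vandermonde N t) * (\<integral>\<^sup>+u. \<integral>\<^sup>+s. F' (s, u) \<partial>lborel \<partial>L N)"
    using cv' F'm supp' unfolding residue_cv'_def by blast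
  \<comment> \<open>For fixed \<open>u\<close> the last residue is a reflected and translated
    \<open>s\<close>, which preserves Lebesgue measure.\<close>
  also have "(\<integral>\<^sup>+u. \<integral>\<^sup>+s. F' (s, u) \<partial>lborel \<partial>L N) = (\<integral>\<^sup>+u. \<integral>\<^sup>+y. F ((\<rho> u)(N := y)) \<partial>lborel \<partial>L N)"
  proof (rule nn_integral_cong)
    fix u assume "u \<in> space (L N)"
    then have "\<rho> u \<in> space (L N)" by (simp add: \<rho>_def space_L)
    then have [measurable]: "(\<lambda>y. F ((\<rho> u)(N := y))) \<in> borel_measurable borel" by measurable
    show "(\<integral>\<^sup>+s. F' (s, u) \<partial>lborel) = (\<integral>\<^sup>+y. F ((\<rho> u)(N := y)) \<partial>lborel)"
      using nn_integral_real_affine[of "\<lambda>y. F ((\<rho> u)(N := y))" "-1" "t N - (\<Sum>i<N. \<rho> u i)"]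
      by (simp add: F'_def algebra_simps del: fun_upd_apply)
  qed
  also have "\<dots> = ennreal (\<Prod>i<N. \<bar>t i - t N\<bar>) * (\<integral>\<^sup>+u. \<integral>\<^sup>+y. F (u(N := y)) \<partial>lborel \<partial>L N)"
  proof -
    have sc: "ennreal (\<Prod>i<N. \<bar>1 / (t i - t N)\<bar>) * (\<integral>\<^sup>+u. \<integral>\<^sup>+y. F ((\<lambda>i\<in>{..<N}. 1 / (t i - t N) * u i)(N := y)) \<partial>lborel \<partial>L N)
      = (\<integral>\<^sup>+u. \<integral>\<^sup>+y. F (u(N := y)) \<partial>lborel \<partial>L N)"
    proof (rule nn_integral_L_scale)
      show "(\<lambda>x. \<integral>\<^sup>+y. F (x(N := y)) \<partial>lborel) \<in> borel_measurable (L N)" by measurable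
    qed (use ne in simp)
    moreover have "(\<lambda>i\<in>{..<N}. 1 / (t i - t N) * u i) = \<rho> u" for u by (simp add: \<rho>_def)
    moreover have "ennreal (\<Prod>i<N. \<bar>t i - t N\<bar>) * ennreal (\<Prod>i<N. \<bar>1 / (t i - t N)\<bar>) = 1"
      using ne by (simp add: prod_nonneg flip: ennreal_mult prod.distrib)
    ultimately show ?thesis by (simp only: mult.assoc[symmetric] mult_1_left flip: sc)
  qed
  also have "ennreal (vandermonde N t) * \<dots> = ennreal (vandermonde (Suc N) t) * integral\<^sup>N (L (Suc N)) F"
    by (simp add: nn_integral_L_Suc vandermonde_Suc ennreal_mult vandermonde_nonneg prod_nonneg mult.assoc)
  finally show "(\<integral>\<^sup>+x. indicator {x. \<forall>i<Suc N. x i \<in> I i} x * F (\<lambda>i\<in>{..<Suc N}. pf_residue (Suc N) t (Suc N) x i) *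
        ennreal (vandermonde (Suc N) x) \<partial>L (Suc N))
     = ennreal (vandermonde (Suc N) t) * integral\<^sup>N (L (Suc N)) F" .
qed

text \<open>One root and one node are added in turn; shorter vectors inherit that the boxes are
  disjoint and avoid the nodes.\<close>

lemma residue_cv:
  assumes "inj_on t {..<N}"
    and "\<And>i. i < N \<Longrightarrow> I i \<in> sets borel"
    and "\<And>i j. i < j \<Longrightarrow> j < N \<Longrightarrow> I i \<inter> I j = {}"
    and "\<And>i j. i < N \<Longrightarrow> j < N \<Longrightarrow> t i \<notin> I j"
  shows "residue_cv N t I"
  using assms
proof (induction N)
  case (Suc N)
  have t: "inj_on t {..<N}" using Suc.prems(1) by (rule inj_on_subset) auto
  have "residue_cv N t I"
    by (rule Suc.IH[OF t]) (rule Suc.prems(2-4); simp)+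
  then have "residue_cv' N t I"
    by (intro residue_cv_imp_cv' t) ((rule Suc.prems(2-4); simp)+)
  then show ?case by (intro residue_cv'_imp_cv Suc.prems(1)) ((rule Suc.prems(2); simp)+)
qed (rule residue_cv_0)

subsection \<open>Interlacing\<close>

lemma monic_linear_prod:
  fixes x :: "'a \<Rightarrow> real"
  assumes "finite A"
  shows "degree (\<Prod>i\<in>A. [:- x i, 1:]) = card A" "coeff (\<Prod>i\<in>A. [:- x i, 1:]) (card A) = 1"
proof -
  show d: "degree (\<Prod>i\<in>A. [:- x i, 1:]) = card A"
    by (subst degree_prod_eq_sum_degree) auto
  have "lead_coeff (\<Prod>i\<in>A. [:- x i, 1:]) = 1" by (simp add: lead_coeff_prod)
  then show "coeff (\<Prod>i\<in>A. [:- x i, 1:]) (card A) = 1" by (simp add: d)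
qed

lemma poly_linear_prod: "poly (\<Prod>i\<in>A. [:- x i, 1:]) z = (\<Prod>i\<in>A. z - x i)" for x :: "'a \<Rightarrow> real"
  by (simp add: poly_prod)

text \<open>The intermediate value theorem finds a zero in each of the \<open>n\<close> gaps. These
  are distinct, and a polynomial of degree at most \<open>n\<close> with coefficient 1 at
  \<open>n\<close> is determined by its values at \<open>n\<close> points.\<close>

lemma real_roots_of_alternating_signs:
  fixes p :: "real poly"
  assumes deg: "degree p \<le> n" and lc: "coeff p n = 1"
    and dec: "\<And>i. i < n \<Longrightarrow> \<tau> (Suc i) < \<tau> i"
    and sgn: "\<And>i. i \<le> n \<Longrightarrow> 0 < (-1) ^ i * poly p (\<tau> i)"
  shows "\<exists>x. (\<forall>i<n. \<tau> (Suc i) < x i \<and> x i < \<tau> i) \<and> (\<forall>z. poly p z = (\<Prod>i<n. z - x i))"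
proof -
  have "\<exists>x. \<tau> (Suc i) < x \<and> x < \<tau> i \<and> poly p x = 0" if "i < n" for i
  proof -
    have "0 < ((-1) ^ i * poly p (\<tau> i)) * ((-1) ^ Suc i * poly p (\<tau> (Suc i)))"
      by (rule mult_pos_pos[OF sgn sgn]) (use that in auto)
    also have "\<dots> = ((-1) ^ i * (-1) ^ i) * - (poly p (\<tau> (Suc i)) * poly p (\<tau> i))"
      by (simp add: mult_ac)
    also have "((-1) ^ i * (-1) ^ i :: real) = 1" by (simp flip: power_add)
    finally have "poly p (\<tau> (Suc i)) * poly p (\<tau> i) < 0" by simp
    then show ?thesis using poly_IVT[OF dec[OF that]] by auto
  qed
  then obtain x where x: "\<And>i. i < n \<Longrightarrow> \<tau> (Suc i) < x i \<and> x i < \<tau> i \<and> poly p (x i) = 0" by metis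
  have mono: "\<tau> j \<le> \<tau> i" if "i \<le> j" "j \<le> n" for i j
    using that
  proof (induction j rule: dec_induct)
    case (step k)
    then show ?case using dec[of k] by simp
  qed simp
  have lt: "x j < x i" if "i < j" "j < n" for i j
    using x[of i] x[of j] mono[of "Suc i" j] that by auto
  have inj: "inj_on x {..<n}"
    by (rule inj_onI) (metis lessThan_iff less_irrefl linorder_neqE_nat lt)
  have "p = (\<Prod>i<n. [:- x i, 1:])"
  proof (rule poly_eqI_degree_lead_coeff[where A = "x ` {..<n}" and n = n])
    show "coeff p n = coeff (\<Prod>i<n. [:- x i, 1:]) n" using monic_linear_prod(2)[of "{..<n}" x] lc by simp
    show "degree (\<Prod>i<n. [:- x i, 1:]) \<le> n" using monic_linear_prod(1)[of "{..<n}" x] by simp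
    show "poly p z = poly (\<Prod>i<n. [:- x i, 1:]) z" if "z \<in> x ` {..<n}" for z
      using that x by (auto simp: poly_linear_prod)
  qed (use deg inj in \<open>auto simp: card_image\<close>)
  then have "poly p z = (\<Prod>i<n. z - x i)" for z by (simp add: poly_linear_prod)
  then show ?thesis using x by blast
qed

lemma sgn_prod_split:
  fixes f :: "nat \<Rightarrow> real"
  assumes neg: "\<And>j. j < i \<Longrightarrow> f j < 0" and pos: "\<And>j. j \<in> A \<Longrightarrow> 0 < f j"
    and "A \<inter> {..<i} = {}" "finite A"
  shows "0 < (-1) ^ i * (\<Prod>j\<in>{..<i} \<union> A. f j)"
proof -
  have "0 < (-1) ^ i * (\<Prod>j<i. f j)" using neg
    by (induction i) (auto simp: mult.assoc[symmetric] zero_less_mult_iff mult_less_0_iff)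
  moreover have "0 < (\<Prod>j\<in>A. f j)" using pos by (simp add: prod_pos)
  ultimately have "0 < ((-1) ^ i * (\<Prod>j<i. f j)) * (\<Prod>j\<in>A. f j)" by (rule mult_pos_pos)
  then show ?thesis using assms(3,4) by (subst prod.union_disjoint) (auto simp: mult.assoc)
qed

section \<open>Strict interlacing and the signs of residues\<close>

definition decreasing :: "nat \<Rightarrow> (nat \<Rightarrow> real) \<Rightarrow> bool" where
  "decreasing N x \<longleftrightarrow> (\<forall>i j. i < j \<longrightarrow> j < N \<longrightarrow> x j < x i)"

definition interlacing :: "nat \<Rightarrow> (nat \<Rightarrow> real) \<Rightarrow> (nat \<Rightarrow> real) \<Rightarrow> bool" where
  "interlacing N x m \<longleftrightarrow> (\<forall>j<N. x (Suc j) < m j \<and> m j < x j)"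

lemma decreasing_SucI:
  assumes "\<And>i. Suc i < N \<Longrightarrow> x (Suc i) < x i"
  shows "decreasing N x"
  unfolding decreasing_def
proof (intro allI impI)
  fix i j assume "i < j" "j < N"
  then have "Suc i \<le> j" by simp
  then show "x j < x i" using \<open>j < N\<close>
  proof (induction j rule: dec_induct)
    case base
    then show ?case using assms[of i] by simp
  next
    case (step k)
    then show ?case using assms[of k] by simp
  qed
qed

lemma interlacing_decreasing:
  assumes "interlacing N x m"
  shows "decreasing (Suc N) x" "decreasing N m"
proof -
  show "decreasing (Suc N) x"
    by (rule decreasing_SucI) (use assms in \<open>auto simp: interlacing_def intro: less_trans\<close>)
  show "decreasing N m"
    by (rule decreasing_SucI) (use assms in \<open>auto simp: interlacing_def intro: less_trans\<close>)
qed

lemma decreasing_inj_on: "decreasing N x \<Longrightarrow> inj_on x {..<N}"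
  by (rule inj_onI) (metis decreasing_def lessThan_iff less_irrefl linorder_neqE_nat)

lemma decreasing_le: "decreasing N x \<Longrightarrow> i \<le> j \<Longrightarrow> j < N \<Longrightarrow> x j \<le> x i"
  by (metis decreasing_def le_less order.order_iff_strict)

lemma lessThan_minus_split: "i < N \<Longrightarrow> {..<N} - {i} = {..<i} \<union> {i<..<N}" for i N :: nat
  by auto

lemma decreasing_sgn_nodes:
  assumes "decreasing N x" "i < N"
  shows "0 < (-1) ^ i * (\<Prod>j\<in>{..<N} - {i}. x i - x j)"
  unfolding lessThan_minus_split[OF assms(2)]
  by (rule sgn_prod_split) (use assms in \<open>auto simp: decreasing_def\<close>)

lemma divide_pos_of_sgn:
  fixes a b :: real
  assumes "0 < (-1) ^ i * a" "0 < (-1) ^ i * b"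
  shows "0 < a / b"
  using assms by (cases "even i") (auto simp: zero_less_divide_iff)

lemma interlacing_sgn_upper:
  assumes "interlacing N x m" "i < Suc N"
  shows "0 < (-1) ^ i * (\<Prod>k<N. x i - m k)"
proof -
  note dec = interlacing_decreasing[OF assms(1)]
  have "0 < (-1) ^ i * (\<Prod>k\<in>{..<i} \<union> {i..<N}. x i - m k)"
  proof (rule sgn_prod_split)
    fix k assume "k < i"
    then have "x i \<le> x (Suc k)" using dec(1) assms(2) by (auto intro: decreasing_le)
    also have "\<dots> < m k" using assms \<open>k < i\<close> by (auto simp: interlacing_def)
    finally show "x i - m k < 0" by simp
  next
    fix k assume k: "k \<in> {i..<N}"
    then have "m k < x k" using assms by (auto simp: interlacing_def)
    also have "\<dots> \<le> x i" using dec(1) k by (auto intro: decreasing_le)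
    finally show "0 < x i - m k" by simp
  qed auto
  moreover have "{..<i} \<union> {i..<N} = {..<N}" using assms(2) by auto
  ultimately show ?thesis by simp
qed

lemma interlacing_sgn_lower:
  assumes "interlacing N x m" "i < N"
  shows "0 < (-1) ^ Suc i * (\<Prod>k<Suc N. m i - x k)"
proof -
  note dec = interlacing_decreasing[OF assms(1)]
  have "0 < (-1) ^ Suc i * (\<Prod>k\<in>{..<Suc i} \<union> {Suc i..<Suc N}. m i - x k)"
  proof (rule sgn_prod_split)
    fix k assume "k < Suc i"
    then have "x i \<le> x k" using dec(1) assms(2) by (auto intro: decreasing_le)
    moreover have "m i < x i" using assms by (auto simp: interlacing_def)
    ultimately show "m i - x k < 0" by simp
  next
    fix k assume k: "k \<in> {Suc i..<Suc N}"
    then have "x k \<le> x (Suc i)" using dec(1) by (auto intro: decreasing_le)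
    moreover have "x (Suc i) < m i" using assms by (auto simp: interlacing_def)
    ultimately show "0 < m i - x k" by simp
  qed auto
  moreover have "{..<Suc i} \<union> {Suc i..<Suc N} = {..<Suc N}" using assms(2) by auto
  ultimately show ?thesis by metis
qed

text \<open>Above \<open>x i\<close> lie \<open>i\<close> points of \<open>m\<close> and
  \<open>i\<close> points of \<open>x\<close>, so numerator and node product have the same
  sign.\<close>

lemma interlacing_residue_pos:
  assumes "interlacing N x m" "i < Suc N"
  shows "0 < pf_residue (Suc N) x N m i"
  unfolding pf_residue_def
  by (rule divide_pos_of_sgn[of i])
    (use interlacing_sgn_upper[OF assms] decreasing_sgn_nodes[OF interlacing_decreasing(1)[OF assms(1)] assms(2)] in auto)

text \<open>Above \<open>m i\<close> lies one more point of \<open>x\<close> than of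
  \<open>m\<close>, so numerator and node product have opposite signs.\<close>

lemma interlacing_residue_neg:
  assumes "interlacing N x m" "i < N"
  shows "pf_residue N m (Suc N) x i < 0"
proof -
  have "0 < (- (\<Prod>k<Suc N. m i - x k)) / (\<Prod>j\<in>{..<N} - {i}. m i - m j)"
    by (rule divide_pos_of_sgn[of i])
      (use interlacing_sgn_lower[OF assms] decreasing_sgn_nodes[OF interlacing_decreasing(2)[OF assms(1)] assms(2)] in auto)
  then show ?thesis unfolding pf_residue_def by simp
qed

section \<open>Interlacing points with prescribed residues\<close>

lemma poly_sum_nodes:
  fixes x q :: "nat \<Rightarrow> real"
  assumes "i < N"
  shows "poly (\<Sum>k<N. smult (q k) (\<Prod>j\<in>{..<N} - {k}. [:- x j, 1:])) (x i) = q i * (\<Prod>j\<in>{..<N} - {i}. x i - x j)"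
proof -
  have "poly (\<Sum>k<N. smult (q k) (\<Prod>j\<in>{..<N} - {k}. [:- x j, 1:])) (x i)
      = (\<Sum>k<N. q k * (\<Prod>j\<in>{..<N} - {k}. x i - x j))"
    by (simp add: poly_sum poly_linear_prod)
  also have "\<dots> = (\<Sum>k<N. if k = i then q i * (\<Prod>j\<in>{..<N} - {i}. x i - x j) else 0)"
    by (rule sum.cong) (use assms in \<open>auto intro!: bexI[of _ i]\<close>)
  finally show ?thesis using assms by simp
qed

lemma degree_sum_nodes:
  "degree (\<Sum>k<Suc N. smult (q k) (\<Prod>j\<in>{..<Suc N} - {k}. [:- x j, 1:])) \<le> N" for x q :: "nat \<Rightarrow> real"
proof (rule degree_sum_le)
  fix k assume k: "k \<in> {..<Suc N}"
  have "degree (smult (q k) (\<Prod>j\<in>{..<Suc N} - {k}. [:- x j, 1:])) \<le> degree (\<Prod>j\<in>{..<Suc N} - {k}. [:- x j, 1:])"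
    by (rule degree_smult_le)
  also have "\<dots> = N" using k by (subst monic_linear_prod) auto
  finally show "degree (smult (q k) (\<Prod>j\<in>{..<Suc N} - {k}. [:- x j, 1:])) \<le> N" .
qed simp

text \<open>\<open>p\<close> is the numerator of the sum of the \<open>q i / (z - x i)\<close>. At
  \<open>x i\<close> a single summand survives, so positive weights force alternating signs, and
  total weight 1 makes \<open>p\<close> monic.\<close>

lemma exists_interlacing_lower:
  assumes dec: "decreasing (Suc N) x" and q: "\<And>i. i < Suc N \<Longrightarrow> 0 < q i" and q1: "(\<Sum>i<Suc N. q i) = 1"
  obtains m where "interlacing N x m" "\<And>i. i < Suc N \<Longrightarrow> q i = pf_residue (Suc N) x N m i"
proof -
  define p where "p = (\<Sum>k<Suc N. smult (q k) (\<Prod>j\<in>{..<Suc N} - {k}. [:- x j, 1:]))"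
  have px: "poly p (x i) = q i * (\<Prod>j\<in>{..<Suc N} - {i}. x i - x j)" if "i < Suc N" for i
    unfolding p_def using that by (rule poly_sum_nodes)
  have "coeff p N = (\<Sum>k<Suc N. q k * coeff (\<Prod>j\<in>{..<Suc N} - {k}. [:- x j, 1:]) N)"
    by (simp add: p_def coeff_sum del: sum.lessThan_Suc)
  also have "\<dots> = (\<Sum>k<Suc N. q k * 1)"
  proof (rule sum.cong)
    fix k assume "k \<in> {..<Suc N}"
    then have "card ({..<Suc N} - {k}) = N" by auto
    then show "q k * coeff (\<Prod>j\<in>{..<Suc N} - {k}. [:- x j, 1:]) N = q k * 1"
      using monic_linear_prod(2)[of "{..<Suc N} - {k}" x] by simp
  qed simp
  finally have lc: "coeff p N = 1" using q1 by simp
  have deg: "degree p \<le> N" unfolding p_def by (rule degree_sum_nodes)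
  have "\<exists>m. (\<forall>i<N. x (Suc i) < m i \<and> m i < x i) \<and> (\<forall>z. poly p z = (\<Prod>i<N. z - m i))"
  proof (rule real_roots_of_alternating_signs[OF deg lc])
    show "x (Suc i) < x i" if "i < N" for i using dec that by (auto simp: decreasing_def)
    show "0 < (-1) ^ i * poly p (x i)" if "i \<le> N" for i
      using decreasing_sgn_nodes[OF dec, of i] q[of i] that
      by (auto simp: px mult.left_commute intro!: mult_pos_pos)
  qed
  then obtain m where m: "\<And>i. i < N \<Longrightarrow> x (Suc i) < m i \<and> m i < x i" "\<And>z. poly p z = (\<Prod>i<N. z - m i)"
    by blast
  show ?thesis
  proof
    show "interlacing N x m" using m(1) by (auto simp: interlacing_def)
    show "q i = pf_residue (Suc N) x N m i" if i: "i < Suc N" for i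
    proof -
      have "(\<Prod>j\<in>{..<Suc N} - {i}. x i - x j) \<noteq> 0" using decreasing_sgn_nodes[OF dec i] by fastforce
      then show ?thesis unfolding pf_residue_def using px[OF i] m(2)[of "x i"]
        by (metis nonzero_mult_div_cancel_right)
    qed
  qed
qed

text \<open>\<open>p\<close> is the characteristic polynomial of the diagonal matrix
  \<open>m\<close> bordered by the corner \<open>a\<close> and a column with squared entries
  \<open>w i\<close>. Positive weights give alternating signs at the \<open>m i\<close>; the two
  outermost roots are caught by a test point beyond each end.\<close>

lemma exists_interlacing_upper:
  assumes dec: "decreasing N m" and w: "\<And>i. i < N \<Longrightarrow> 0 < w i"
  obtains x where "interlacing N x m" "\<And>i. i < N \<Longrightarrow> w i = - pf_residue N m (Suc N) x i"
    "a = (\<Sum>i<Suc N. x i) - (\<Sum>i<N. m i)"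
proof -
  define r where "r = (\<Sum>k<N. smult (w k) (\<Prod>j\<in>{..<N} - {k}. [:- m j, 1:]))"
  define p where "p = (\<Prod>i<N. [:- m i, 1:]) * [:- a, 1:] - r"
  have pm: "poly p (m i) = - w i * (\<Prod>j\<in>{..<N} - {i}. m i - m j)" if "i < N" for i
  proof -
    have "(\<Prod>j<N. m i - m j) = 0" using that by auto
    then show ?thesis using poly_sum_nodes[OF that, of w m] by (simp add: p_def r_def poly_linear_prod)
  qed
  have dr: "degree r \<le> N - 1"
    using degree_sum_nodes[where N = "N - 1" and q = w and x = m] by (cases N) (auto simp: r_def)
  have cr: "coeff r (Suc N) = 0" by (rule coeff_eq_0) (use dr in auto)
  have d1: "degree ((\<Prod>i<N. [:- m i, 1:]) * [:- a, 1:]) = Suc N"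
    using monic_linear_prod(1)[of "{..<N}" m] by (subst degree_mult_eq) auto
  have "lead_coeff ((\<Prod>i<N. [:- m i, 1:]) * [:- a, 1:]) = 1"
    by (simp only: lead_coeff_mult lead_coeff_prod) simp
  then have "coeff ((\<Prod>i<N. [:- m i, 1:]) * [:- a, 1:]) (Suc N) = 1" unfolding d1 .
  then have lc: "coeff p (Suc N) = 1" by (simp only: p_def coeff_diff cr)
  have deg: "degree p \<le> Suc N"
    unfolding p_def by (rule degree_diff_le) (use d1 dr in auto)
  then have degp: "degree p = Suc N" using lc by (metis le_antisym le_degree zero_neq_one)
  obtain B0 where B0: "\<And>z. z \<ge> B0 \<Longrightarrow> 1 \<le> poly p z"
    using poly_pinfty_gt_lc[of p] lc degp by auto
  \<comment> \<open>Reflection turns the sign at minus infinity into one at plus infinity; the power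
    of -1 makes the leading coefficient 1 again.\<close>
  define p' where "p' = smult ((-1) ^ Suc N) (pcompose p [:0, -1:])"
  have "lead_coeff (pcompose p [:0, -1:]) = (-1) ^ Suc N"
    using lead_coeff_comp[of "[:0, -1 :: real:]" p] lc degp by simp
  then have "lead_coeff p' = 1" unfolding p'_def by (simp add: lead_coeff_smult flip: power_mult_distrib)
  then obtain b0 where b0: "\<And>z. z \<ge> b0 \<Longrightarrow> 1 \<le> poly p' z"
    using poly_pinfty_gt_lc[of p'] by auto
  have p'p: "poly p' z = (-1) ^ Suc N * poly p (- z)" for z
    by (simp add: p'_def poly_pcompose)
  define B where "B = Max (insert B0 (m ` {..<N})) + 1"
  \<comment> \<open>The entry \<open>B - 1\<close> ensures \<open>b < B\<close> also when there are
    no nodes in between.\<close>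
  define b where "b = Min (insert (min (- b0) (B - 1)) (m ` {..<N})) - 1"
  have B: "B0 < B" "\<And>i. i < N \<Longrightarrow> m i < B"
  proof -
    have "B0 \<le> B - 1" unfolding B_def by simp
    then show "B0 < B" by simp
    fix i assume "i < N"
    then have "m i \<le> B - 1" unfolding B_def by simp
    then show "m i < B" by simp
  qed
  have b: "b < - b0" "b < B" "\<And>i. i < N \<Longrightarrow> b < m i"
  proof -
    have "b + 1 \<le> min (- b0) (B - 1)" unfolding b_def diff_add_cancel by (rule Min_le) auto
    then show "b < - b0" "b < B" by auto
    fix i assume "i < N"
    then have "b + 1 \<le> m i" unfolding b_def by simp
    then show "b < m i" by simp
  qed
  define \<tau> where "\<tau> i = (if i = 0 then B else if i \<le> N then m (i - 1) else b)" for i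
  have "\<exists>x. (\<forall>i<Suc N. \<tau> (Suc i) < x i \<and> x i < \<tau> i) \<and> (\<forall>z. poly p z = (\<Prod>i<Suc N. z - x i))"
  proof (rule real_roots_of_alternating_signs[OF deg lc])
    show "\<tau> (Suc i) < \<tau> i" if "i < Suc N" for i
      using dec that B b by (cases "i = 0"; cases "i = N") (auto simp: \<tau>_def decreasing_def)
    show "0 < (-1) ^ i * poly p (\<tau> i)" if "i \<le> Suc N" for i
    proof -
      consider "i = 0" | k where "i = Suc k" "k < N" | "i = Suc N" using \<open>i \<le> Suc N\<close>
        by (cases i) (auto simp: le_less)
      then show ?thesis
      proof cases
        case 1
        then show ?thesis using B0[of B] B(1) by (simp add: \<tau>_def)
      next
        case 2
        have "0 < w k * ((-1) ^ k * (\<Prod>j\<in>{..<N} - {k}. m k - m j))"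
          using decreasing_sgn_nodes[OF dec 2(2)] w[OF 2(2)] by (rule mult_pos_pos[rotated])
        then show ?thesis using 2 pm[OF 2(2)] by (simp add: \<tau>_def mult_ac)
      next
        case 3
        have "1 \<le> poly p' (- b)" using b(1) by (intro b0) simp
        then show ?thesis using 3 p'p[of "- b"] by (simp add: \<tau>_def)
      qed
    qed
  qed
  then obtain x where x: "\<And>i. i < Suc N \<Longrightarrow> \<tau> (Suc i) < x i \<and> x i < \<tau> i" "\<And>z. poly p z = (\<Prod>i<Suc N. z - x i)"
    by blast
  have int: "interlacing N x m"
    unfolding interlacing_def
  proof (intro allI impI)
    fix j assume "j < N"
    then show "x (Suc j) < m j \<and> m j < x j"
      using x(1)[of j] x(1)[of "Suc j"] by (auto simp: \<tau>_def)
  qed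
  have wr: "w i = - pf_residue N m (Suc N) x i" if i: "i < N" for i
  proof -
    have "(\<Prod>j\<in>{..<N} - {i}. m i - m j) \<noteq> 0" using decreasing_sgn_nodes[OF dec i] by fastforce
    then have "- w i = pf_residue N m (Suc N) x i" unfolding pf_residue_def using pm[OF i] x(2)[of "m i"]
      by (metis nonzero_mult_div_cancel_right)
    then show ?thesis by simp
  qed
  have ne: "B \<noteq> m i" "B - m i \<noteq> 0" if "i < N" for i using B(2)[OF that] by auto
  \<comment> \<open>The corner is recovered from the single point \<open>B\<close>: both expansions
    of the quotient have the same residues, so their constants agree.\<close>
  define M where "M = (\<Prod>i<N. B - m i)"
  have "M \<noteq> 0" using ne by (simp add: M_def)
  have "poly r B = (\<Sum>k<N. w k * (\<Prod>j\<in>{..<N} - {k}. B - m j))"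
    by (simp add: r_def poly_sum poly_linear_prod)
  also have "\<dots> = (\<Sum>k<N. M * (w k / (B - m k)))"
  proof (rule sum.cong)
    fix k assume k: "k \<in> {..<N}"
    then have "M = (B - m k) * (\<Prod>j\<in>{..<N} - {k}. B - m j)"
      unfolding M_def by (intro prod.remove) auto
    then show "w k * (\<Prod>j\<in>{..<N} - {k}. B - m j) = M * (w k / (B - m k))"
      using ne k by simp
  qed simp
  finally have "poly p B = M * (B - a - (\<Sum>k<N. w k / (B - m k)))"
    by (simp add: p_def poly_linear_prod M_def sum_distrib_left algebra_simps)
  then have "(\<Prod>i<Suc N. B - x i) / M = B - a - (\<Sum>k<N. w k / (B - m k))"
    using x(2)[of B] \<open>M \<noteq> 0\<close> by (simp del: prod.lessThan_Suc)
  also have "(\<Sum>k<N. w k / (B - m k)) = - (\<Sum>i<N. pf_residue N m (Suc N) x i / (B - m i))"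
    using wr by (simp add: sum_negf)
  finally have "a = (\<Sum>i<Suc N. x i) - (\<Sum>i<N. m i)"
    using partial_fractions_Suc[OF decreasing_inj_on[OF dec] ne(1), of x] unfolding M_def by linarith
  with int wr show ?thesis using that by blast
qed

section \<open>Changes of variables on interlacing pairs\<close>

lemma measurable_interlacing[measurable]:
  "Measurable.pred (L (Suc N)) (\<lambda>x. interlacing N x m)"
  "Measurable.pred (L N) (\<lambda>m. interlacing N x m)"
  unfolding interlacing_def by measurable

text \<open>For fixed \<open>m\<close> the points \<open>x\<close> fill a product of intervals,
  while the corner and the negated residues range freely over the line and the positive orthant. In
  the new coordinates the domain is a product, which is what lets the matrix entries of a row appear
  as independent variables.\<close>

lemma nn_integral_interlacing_upper:
  assumes dec: "decreasing N m" and F[measurable]: "F \<in> borel_measurable (lborel \<Otimes>\<^sub>M L N)"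
  shows "(\<integral>\<^sup>+x. indicator {x. interlacing N x m} x *
      F ((\<Sum>i<Suc N. x i) - (\<Sum>i<N. m i), \<lambda>i\<in>{..<N}. - pf_residue N m (Suc N) x i) *
      ennreal (vandermonde (Suc N) x) \<partial>L (Suc N))
    = ennreal (vandermonde N m) * (\<integral>\<^sup>+w. \<integral>\<^sup>+a. indicator {w. \<forall>i<N. 0 < w i} w * F (a, w) \<partial>lborel \<partial>L N)"
proof -
  \<comment> \<open>The cells cut out by the nodes; the first is unbounded above and the last
    unbounded below.\<close>
  define I where "I i = {z. (i < N \<longrightarrow> m i < z) \<and> (0 < i \<longrightarrow> z < m (i - 1))}" for i
  have II: "(\<forall>i<Suc N. x i \<in> I i) \<longleftrightarrow> interlacing N x m" for x
  proof
    assume *: "\<forall>i<Suc N. x i \<in> I i"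
    show "interlacing N x m"
      unfolding interlacing_def
    proof (intro allI impI)
      fix j assume "j < N"
      then show "x (Suc j) < m j \<and> m j < x j"
        using *[rule_format, of j] *[rule_format, of "Suc j"] by (auto simp: I_def)
    qed
  next
    assume *: "interlacing N x m"
    show "\<forall>i<Suc N. x i \<in> I i"
    proof (intro allI impI)
      fix i assume "i < Suc N"
      then show "x i \<in> I i"
        using * unfolding interlacing_def I_def by (cases i) auto
    qed
  qed
  have Im: "I i \<in> sets borel" for i unfolding I_def by measurable
  have disj: "I i \<inter> I j = {}" if "i < j" "j < Suc N" for i j
  proof -
    have "m (j - 1) \<le> m i" using dec that by (intro decreasing_le[of N]) auto
    then show ?thesis using that by (auto simp: I_def)
  qed
  have mI: "m i \<notin> I j" if "i < N" "j < Suc N" for i j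
  proof (cases "i < j")
    case True
    then have "m (j - 1) \<le> m i" using dec that by (intro decreasing_le[of N]) auto
    then show ?thesis using True by (auto simp: I_def)
  next
    case False
    then have "m i \<le> m j" using dec that by (intro decreasing_le[of N]) auto
    then show ?thesis using False that by (auto simp: I_def)
  qed
  have cv: "residue_cv' N m I"
  proof (rule residue_cv_imp_cv')
    show "residue_cv N m I"
      by (rule residue_cv) (simp_all add: Im disj mI decreasing_inj_on[OF dec])
  qed (simp_all add: Im disj mI decreasing_inj_on[OF dec])
  define neg where "neg u = (\<lambda>i\<in>{..<N}. - u i)" for u :: "nat \<Rightarrow> real"
  have [measurable]: "neg \<in> measurable (L N) (L N)" unfolding neg_def[abs_def] by measurable
  \<comment> \<open>The value 0 off the positive orthant makes
    \<open>exists_interlacing_upper\<close> deliver the support condition of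
    \<open>residue_cv'\<close>.\<close>
  define F' where "F' = (\<lambda>p. if \<forall>i<N. 0 < neg (snd p) i then F (fst p, neg (snd p)) else 0)"
  have [measurable]: "Measurable.pred (lborel \<Otimes>\<^sub>M L N) (\<lambda>p. \<forall>i<N. 0 < neg (snd p) i)"
    by measurable
  have F'm: "F' \<in> borel_measurable (lborel \<Otimes>\<^sub>M L N)"
    unfolding F'_def by measurable
  have "(\<integral>\<^sup>+x. indicator {x. interlacing N x m} x *
      F ((\<Sum>i<Suc N. x i) - (\<Sum>i<N. m i), \<lambda>i\<in>{..<N}. - pf_residue N m (Suc N) x i) *
      ennreal (vandermonde (Suc N) x) \<partial>L (Suc N))
    = (\<integral>\<^sup>+x. indicator {x. \<forall>i<Suc N. x i \<in> I i} x *
        F' ((\<Sum>i<Suc N. x i) - (\<Sum>i<N. m i), \<lambda>i\<in>{..<N}. pf_residue N m (Suc N) x i) *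
        ennreal (vandermonde (Suc N) x) \<partial>L (Suc N))"
  proof (rule nn_integral_cong)
    fix x
    have "neg (\<lambda>i\<in>{..<N}. pf_residue N m (Suc N) x i) = (\<lambda>i\<in>{..<N}. - pf_residue N m (Suc N) x i)"
      by (auto simp: neg_def fun_eq_iff)
    then show "indicator {x. interlacing N x m} x *
      F ((\<Sum>i<Suc N. x i) - (\<Sum>i<N. m i), \<lambda>i\<in>{..<N}. - pf_residue N m (Suc N) x i) *
      ennreal (vandermonde (Suc N) x)
      = indicator {x. \<forall>i<Suc N. x i \<in> I i} x *
        F' ((\<Sum>i<Suc N. x i) - (\<Sum>i<N. m i), \<lambda>i\<in>{..<N}. pf_residue N m (Suc N) x i) *
        ennreal (vandermonde (Suc N) x)"
      unfolding II F'_def fst_conv snd_conv using interlacing_residue_neg[of N x m]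
      by (cases "interlacing N x m") (simp_all add: indicator_def del: sum.lessThan_Suc)
  qed
  also have "\<dots> = ennreal (vandermonde N m) * (\<integral>\<^sup>+u. \<integral>\<^sup>+s. F' (s, u) \<partial>lborel \<partial>L N)"
  proof (rule cv[unfolded residue_cv'_def, rule_format, OF F'm])
    fix s u assume u: "u \<in> space (L N)" and Fu: "F' (s, u) \<noteq> 0"
    then have "\<forall>i<N. 0 < - u i" by (auto simp: F'_def neg_def split: if_splits)
    then obtain x where x: "interlacing N x m" "\<And>i. i < N \<Longrightarrow> - u i = - pf_residue N m (Suc N) x i"
      "s = (\<Sum>i<Suc N. x i) - (\<Sum>i<N. m i)"
      using exists_interlacing_upper[OF dec, of "\<lambda>i. - u i" s] by auto
    have "u = (\<lambda>i\<in>{..<N}. pf_residue N m (Suc N) x i)"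
      using x(2) u by (auto simp: fun_eq_iff space_L extensional_def)
    then show "\<exists>x. (\<forall>i<Suc N. x i \<in> I i) \<and> s = (\<Sum>i<Suc N. x i) - (\<Sum>i<N. m i) \<and>
         u = (\<lambda>i\<in>{..<N}. pf_residue N m (Suc N) x i)"
      using x unfolding II by blast
  qed
  also have "(\<integral>\<^sup>+u. \<integral>\<^sup>+s. F' (s, u) \<partial>lborel \<partial>L N)
      = (\<integral>\<^sup>+w. \<integral>\<^sup>+a. indicator {w. \<forall>i<N. 0 < w i} w * F (a, w) \<partial>lborel \<partial>L N)"
  proof -
    have "F' (s, u) = indicator {w. \<forall>i<N. 0 < w i} (\<lambda>i\<in>{..<N}. - 1 * u i) * F (s, \<lambda>i\<in>{..<N}. - 1 * u i)" for s u
      by (simp add: F'_def neg_def indicator_def)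
    then have "(\<integral>\<^sup>+u. \<integral>\<^sup>+s. F' (s, u) \<partial>lborel \<partial>L N)
      = ennreal (\<Prod>i<N. \<bar>- 1\<bar>) * (\<integral>\<^sup>+u. (\<integral>\<^sup>+a. indicator {w. \<forall>i<N. 0 < w i} (\<lambda>i\<in>{..<N}. - 1 * u i) *
          F (a, \<lambda>i\<in>{..<N}. - 1 * u i) \<partial>lborel) \<partial>L N)"
      by simp
    also have "\<dots> = (\<integral>\<^sup>+w. \<integral>\<^sup>+a. indicator {w. \<forall>i<N. 0 < w i} w * F (a, w) \<partial>lborel \<partial>L N)"
    proof (rule nn_integral_L_scale)
      have [measurable]: "Measurable.pred (L N) (\<lambda>w. \<forall>i<N. 0 < w i)" by measurable
      show "(\<lambda>w. \<integral>\<^sup>+a. indicator {w. \<forall>i<N. 0 < w i} w * F (a, w) \<partial>lborel) \<in> borel_measurable (L N)"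
        by measurable
    qed simp
    finally show ?thesis .
  qed
  finally show ?thesis .
qed

text \<open>Positive weights \<open>v\<close> split into their total \<open>g\<close> and shares,
  and the shares are residues for points \<open>m\<close> interlacing \<open>x\<close>. The factor
  \<open>g ^ N\<close> is the Jacobian of passing from shares on the simplex to weights.\<close>

lemma nn_integral_interlacing_lower:
  assumes dec: "decreasing (Suc N) x" and G[measurable]: "G \<in> borel_measurable (L (Suc N))"
  shows "ennreal (vandermonde (Suc N) x) * (\<integral>\<^sup>+v. indicator {v. \<forall>i<Suc N. 0 < v i} v * G v \<partial>L (Suc N))
    = (\<integral>\<^sup>+g. indicator {0<..} g * ennreal (g ^ N) *
        (\<integral>\<^sup>+m. indicator {m. interlacing N x m} m *
            G (\<lambda>i\<in>{..<Suc N}. g * pf_residue (Suc N) x N m i) * ennreal (vandermonde N m) \<partial>L N) \<partial>lborel)"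
proof -
  define J where "J j = {x (Suc j)<..<x j}" for j
  have JJ: "(\<forall>j<N. m j \<in> J j) \<longleftrightarrow> interlacing N x m" for m
    by (auto simp: J_def interlacing_def)
  have Jm: "J i \<in> sets borel" for i unfolding J_def by measurable
  have disj: "J i \<inter> J j = {}" if "i < j" "j < N" for i j
  proof -
    have "x j \<le> x (Suc i)" using dec that by (intro decreasing_le[of "Suc N"]) auto
    then show ?thesis by (auto simp: J_def)
  qed
  have xJ: "x i \<notin> J j" if "i < N" "j < N" for i j
  proof (cases "i \<le> j")
    case True
    then have "x j \<le> x i" using dec that by (intro decreasing_le[of "Suc N"]) auto
    then show ?thesis by (auto simp: J_def)
  next
    case False
    then have "x i \<le> x (Suc j)" using dec that by (intro decreasing_le[of "Suc N"]) auto
    then show ?thesis by (auto simp: J_def)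
  qed
  have dec': "decreasing N x" using dec by (auto simp: decreasing_def)
  \<comment> \<open>Only the first \<open>N\<close> points of \<open>x\<close> serve as nodes here,
    to match the \<open>N\<close> roots \<open>m\<close>; the residue at \<open>x N\<close> is
    determined by the others.\<close>
  have cv: "residue_cv N x J"
    by (rule residue_cv) (simp_all add: Jm disj xJ decreasing_inj_on[OF dec'])
  have ne: "x i - x N \<noteq> 0" if "i < N" for i
    using dec[unfolded decreasing_def, rule_format, of i N] that by simp
  \<comment> \<open>The first \<open>N\<close> weights are free; the remaining one is what they
    leave of \<open>g\<close>, and it has to be positive.\<close>
  define H where "H g q = (if (\<forall>i<N. 0 < q i) \<and> (\<Sum>i<N. q i) < g then G (q(N := g - (\<Sum>i<N. q i))) else 0)" for g q
  have [measurable]: "(\<lambda>(g, q). H g q) \<in> borel_measurable (lborel \<Otimes>\<^sub>M L N)"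
    unfolding H_def by measurable
  have [measurable]: "(\<lambda>(q, g). H g q) \<in> borel_measurable (L N \<Otimes>\<^sub>M lborel)"
    unfolding H_def by measurable
  have inner: "ennreal (g ^ N) * (\<integral>\<^sup>+m. indicator {m. interlacing N x m} m *
            G (\<lambda>i\<in>{..<Suc N}. g * pf_residue (Suc N) x N m i) * ennreal (vandermonde N m) \<partial>L N)
      = ennreal (vandermonde (Suc N) x) * (\<integral>\<^sup>+q. H g q \<partial>L N)" if g: "0 < g" for g
  proof -
    \<comment> \<open>Scaling by \<open>g / (x i - x N)\<close> turns residues for \<open>N\<close>
      nodes into the weights for \<open>Suc N\<close> nodes with total \<open>g\<close>.\<close>
    define F where "F r = H g (\<lambda>i\<in>{..<N}. g / (x i - x N) * r i)" for r
    have Fm[measurable]: "F \<in> borel_measurable (L N)" unfolding F_def by measurable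
    have res: "F (\<lambda>i\<in>{..<N}. pf_residue N x N m i) = G (\<lambda>i\<in>{..<Suc N}. g * pf_residue (Suc N) x N m i)"
      if int: "interlacing N x m" for m
    proof -
      define q where "q i = pf_residue (Suc N) x N m i" for i
      have qpos: "0 < q i" if "i < Suc N" for i
        unfolding q_def by (rule interlacing_residue_pos[OF int that])
      have q1: "(\<Sum>i<Suc N. q i) = 1"
        unfolding q_def by (rule sum_pf_residue_lower[OF decreasing_inj_on[OF dec]])
      have "(\<lambda>i\<in>{..<N}. g / (x i - x N) * (\<lambda>i\<in>{..<N}. pf_residue N x N m i) i) = (\<lambda>i\<in>{..<N}. g * q i)"
        by (auto simp: fun_eq_iff q_def pf_residue_Suc_nodes)
      moreover have "(\<forall>i<N. 0 < (\<lambda>i\<in>{..<N}. g * q i) i)" using qpos g by simp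
      moreover have s: "(\<Sum>i<N. (\<lambda>i\<in>{..<N}. g * q i) i) = g - g * q N"
      proof -
        have "(\<Sum>i<N. q i) = 1 - q N" using q1 by simp
        then have "g * (\<Sum>i<N. q i) = g - g * q N" by (simp only: right_diff_distrib mult_1_right)
        then show ?thesis by (simp add: sum_distrib_left)
      qed
      moreover have "g - g * q N < g" using qpos g by simp
      moreover have "(\<lambda>i\<in>{..<N}. g * q i)(N := g - (g - g * q N)) = (\<lambda>i\<in>{..<Suc N}. g * q i)"
        by (auto simp: fun_eq_iff less_Suc_eq)
      ultimately show ?thesis unfolding F_def H_def q_def[symmetric] by simp
    qed
    have supp: "\<exists>m. (\<forall>j<N. m j \<in> J j) \<and> r = (\<lambda>i\<in>{..<N}. pf_residue N x N m i)"
      if r: "r \<in> space (L N)" and Fr: "F r \<noteq> 0" for r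
    proof -
      \<comment> \<open>The shares belonging to \<open>r\<close>, completed by a last one so that
        they sum to 1; this is the input of \<open>exists_interlacing_lower\<close>.\<close>
      define q where "q i = (if i < N then 1 / (x i - x N) * r i else 1 - (\<Sum>i<N. 1 / (x i - x N) * r i))" for i
      have gq: "(\<lambda>i\<in>{..<N}. g / (x i - x N) * r i) i = g * q i" if "i < N" for i
        using that by (simp add: q_def)
      have pos: "\<forall>i<N. 0 < (\<lambda>i\<in>{..<N}. g / (x i - x N) * r i) i"
        and lt: "(\<Sum>i<N. (\<lambda>i\<in>{..<N}. g / (x i - x N) * r i) i) < g"
        using Fr by (auto simp: F_def H_def split: if_splits)
      have "g * (\<Sum>i<N. q i) < g * 1" using lt gq by (simp add: sum_distrib_left)
      then have "(\<Sum>i<N. q i) < 1" using g by (simp only: mult_less_cancel_left_pos)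
      moreover have qN: "q N = 1 - (\<Sum>i<N. q i)" by (simp add: q_def)
      ultimately have "0 < q N" by simp
      moreover have "0 < q i" if "i < N" for i using pos gq[OF that] g that by (metis zero_less_mult_pos)
      ultimately have qpos: "0 < q i" if "i < Suc N" for i using that by (auto simp: less_Suc_eq)
      obtain m where m: "interlacing N x m" "\<And>i. i < Suc N \<Longrightarrow> q i = pf_residue (Suc N) x N m i"
        by (rule exists_interlacing_lower[OF dec qpos]) (use qN in auto)
      have "r i = pf_residue N x N m i" if "i < N" for i
        using m(2)[of i] that ne[OF that] by (simp add: q_def pf_residue_Suc_nodes)
      then have "r = (\<lambda>i\<in>{..<N}. pf_residue N x N m i)"
        using r by (auto simp: fun_eq_iff space_L extensional_def)
      then show ?thesis using m(1) unfolding JJ by blast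
    qed
    have "(\<integral>\<^sup>+m. indicator {m. interlacing N x m} m *
            G (\<lambda>i\<in>{..<Suc N}. g * pf_residue (Suc N) x N m i) * ennreal (vandermonde N m) \<partial>L N)
        = (\<integral>\<^sup>+m. indicator {m. \<forall>i<N. m i \<in> J i} m *
            F (\<lambda>i\<in>{..<N}. pf_residue N x N m i) * ennreal (vandermonde N m) \<partial>L N)"
      unfolding JJ by (rule nn_integral_cong) (auto simp: indicator_def res simp del: restrict_apply)
    also have "\<dots> = ennreal (vandermonde N x) * (\<integral>\<^sup>+r. F r \<partial>L N)"
      using cv supp Fm unfolding residue_cv_def by blast
    finally have "ennreal (g ^ N) * (\<integral>\<^sup>+m. indicator {m. interlacing N x m} m *
            G (\<lambda>i\<in>{..<Suc N}. g * pf_residue (Suc N) x N m i) * ennreal (vandermonde N m) \<partial>L N)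
        = ennreal (vandermonde N x) * ennreal (g ^ N) * (\<integral>\<^sup>+r. F r \<partial>L N)" by (simp add: mult_ac)
    moreover have gN: "ennreal (g ^ N) = ennreal (\<Prod>i<N. \<bar>x i - x N\<bar>) * ennreal (\<Prod>i<N. \<bar>g / (x i - x N)\<bar>)"
      using ne g by (simp add: prod_nonneg flip: ennreal_mult prod.distrib)
    moreover have "ennreal (vandermonde N x) * (ennreal (\<Prod>i<N. \<bar>x i - x N\<bar>) * ennreal (\<Prod>i<N. \<bar>g / (x i - x N)\<bar>)) * (\<integral>\<^sup>+r. F r \<partial>L N)
        = ennreal (vandermonde (Suc N) x) * (ennreal (\<Prod>i<N. \<bar>g / (x i - x N)\<bar>) * (\<integral>\<^sup>+r. F r \<partial>L N))"
      by (simp add: vandermonde_Suc ennreal_mult vandermonde_nonneg prod_nonneg mult.assoc)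
    moreover have "ennreal (\<Prod>i<N. \<bar>g / (x i - x N)\<bar>) * (\<integral>\<^sup>+r. F r \<partial>L N) = (\<integral>\<^sup>+q. H g q \<partial>L N)"
      unfolding F_def
    proof (rule nn_integral_L_scale)
      show "g / (x i - x N) \<noteq> 0" if "i < N" for i using ne[OF that] g by simp
    qed measurable
    ultimately show ?thesis by (simp only:)
  qed
  have "(\<integral>\<^sup>+g. indicator {0<..} g * ennreal (g ^ N) *
        (\<integral>\<^sup>+m. indicator {m. interlacing N x m} m *
            G (\<lambda>i\<in>{..<Suc N}. g * pf_residue (Suc N) x N m i) * ennreal (vandermonde N m) \<partial>L N) \<partial>lborel)
      = (\<integral>\<^sup>+g. ennreal (vandermonde (Suc N) x) * (indicator {0<..} g * (\<integral>\<^sup>+q. H g q \<partial>L N)) \<partial>lborel)"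
  proof (rule nn_integral_cong)
    fix g :: real
    show "indicator {0<..} g * ennreal (g ^ N) * (\<integral>\<^sup>+m. indicator {m. interlacing N x m} m *
            G (\<lambda>i\<in>{..<Suc N}. g * pf_residue (Suc N) x N m i) * ennreal (vandermonde N m) \<partial>L N)
      = ennreal (vandermonde (Suc N) x) * (indicator {0<..} g * (\<integral>\<^sup>+q. H g q \<partial>L N))"
      using inner[of g] by (cases "0 < g") (simp_all only: mult.assoc mult_1_left indicator_simps greaterThan_iff, simp_all)
  qed
  also have "\<dots> = ennreal (vandermonde (Suc N) x) * (\<integral>\<^sup>+g. \<integral>\<^sup>+q. indicator {0<..} g * H g q \<partial>L N \<partial>lborel)"
  proof -
    have "(\<integral>\<^sup>+q. indicator {0<..} g * H g q \<partial>L N) = indicator {0<..} g * (\<integral>\<^sup>+q. H g q \<partial>L N)" for g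
      by (rule nn_integral_cmult) measurable
    moreover have "(\<lambda>g. indicator {0<..} g * (\<integral>\<^sup>+q. H g q \<partial>L N)) \<in> borel_measurable lborel" by measurable
    ultimately show ?thesis by (simp only: nn_integral_cmult)
  qed
  also have "(\<integral>\<^sup>+g. \<integral>\<^sup>+q. indicator {0<..} g * H g q \<partial>L N \<partial>lborel)
      = (\<integral>\<^sup>+q. \<integral>\<^sup>+g. indicator {0<..} g * H g q \<partial>lborel \<partial>L N)"
    by (rule pair_sigma_finite.Fubini'[OF sigma_finite_pair_L(2)]) measurable
  also have "\<dots> = (\<integral>\<^sup>+q. \<integral>\<^sup>+y. indicator {v. \<forall>i<Suc N. 0 < v i} (q(N := y)) * G (q(N := y)) \<partial>lborel \<partial>L N)"
  proof (rule nn_integral_cong)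
    fix q assume "q \<in> space (L N)"
    then have [measurable]: "(\<lambda>y. G (q(N := y))) \<in> borel_measurable borel" by measurable
    define c where "c = (\<Sum>i<N. q i)"
    show "(\<integral>\<^sup>+g. indicator {0<..} g * H g q \<partial>lborel)
        = (\<integral>\<^sup>+y. indicator {v. \<forall>i<Suc N. 0 < v i} (q(N := y)) * G (q(N := y)) \<partial>lborel)"
    proof (cases "\<forall>i<N. 0 < q i")
      case True
      then have "0 \<le> c" unfolding c_def by (intro sum_nonneg) auto
      then have "(\<integral>\<^sup>+g. indicator {0<..} g * H g q \<partial>lborel) = (\<integral>\<^sup>+g. indicator {c<..} g * G (q(N := g - c)) \<partial>lborel)"
        using True by (intro nn_integral_cong) (auto simp: indicator_def H_def c_def)
      also have "\<dots> = (\<integral>\<^sup>+y. indicator {c<..} (c + y) * G (q(N := c + y - c)) \<partial>lborel)"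
        using nn_integral_real_affine[of "\<lambda>g. indicator {c<..} g * G (q(N := g - c))" 1 c]
        by (simp del: fun_upd_apply)
      also have "\<dots> = (\<integral>\<^sup>+y. indicator {v. \<forall>i<Suc N. 0 < v i} (q(N := y)) * G (q(N := y)) \<partial>lborel)"
        using True by (intro nn_integral_cong) (auto simp: indicator_def less_Suc_eq)
      finally show ?thesis .
    next
      case False
      then have "(indicator {v. \<forall>i<Suc N. 0 < v i} (q(N := y)) :: ennreal) = 0" for y
        by (auto simp: indicator_def less_Suc_eq)
      moreover have "H g q = 0" for g using False by (auto simp: H_def)
      ultimately show ?thesis by (simp only: mult_zero_left mult_zero_right)
    qed
  qed
  also have "\<dots> = (\<integral>\<^sup>+v. indicator {v. \<forall>i<Suc N. 0 < v i} v * G v \<partial>L (Suc N))"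
    by (rule nn_integral_L_Suc[symmetric]) (unfold indicator_def, measurable)
  finally show ?thesis ..
qed

subsection \<open>The Riccati recursion for the Weyl function\<close>

lemma vandermonde_power2: "(\<Prod>i<N. \<Prod>j\<in>{..<N} - {i}. \<bar>x i - x j\<bar>) = (vandermonde N x)\<^sup>2"
proof -
  have "(\<Prod>i<N. \<Prod>j<i. \<bar>x i - x j\<bar>) = vandermonde N x"
    by (induction N) (simp_all add: vandermonde_Suc abs_minus_commute)
  moreover have "(\<Prod>i<N. \<Prod>j\<in>{..<N} - {i}. \<bar>x i - x j\<bar>)
      = (\<Prod>i<N. (\<Prod>j<i. \<bar>x i - x j\<bar>) * (\<Prod>j\<in>{i<..<N}. \<bar>x i - x j\<bar>))"
  proof (rule prod.cong)
    fix i assume "i \<in> {..<N}"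
    then have "{..<N} - {i} = {..<i} \<union> {i<..<N}" by (simp add: lessThan_minus_split)
    moreover have "{..<i} \<inter> {i<..<N} = {}" by auto
    ultimately show "(\<Prod>j\<in>{..<N} - {i}. \<bar>x i - x j\<bar>) = (\<Prod>j<i. \<bar>x i - x j\<bar>) * (\<Prod>j\<in>{i<..<N}. \<bar>x i - x j\<bar>)"
      by (simp add: prod.union_disjoint)
  qed simp
  ultimately show ?thesis by (simp add: prod.distrib power2_eq_square) (simp add: vandermonde_def)
qed

lemma vandermonde_pos: "decreasing N x \<Longrightarrow> 0 < vandermonde N x"
  unfolding vandermonde_def
proof (intro prod_pos)
  fix j k assume "decreasing N x" "k \<in> {j<..<N}"
  then have "x k < x j" by (auto simp: decreasing_def)
  then show "0 < \<bar>x j - x k\<bar>" by simp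
qed

definition gamma_weight :: "real \<Rightarrow> real \<Rightarrow> real" where
  "gamma_weight \<theta> v = (if 0 < v then v powr (\<theta> - 1) * exp (- v) else 0)"

lemma gamma_weight_nonneg: "0 \<le> gamma_weight \<theta> v"
  by (simp add: gamma_weight_def)

lemma measurable_gamma_weight[measurable]: "gamma_weight \<theta> \<in> borel_measurable borel"
  unfolding gamma_weight_def[abs_def] by measurable

lemma nn_integral_gamma_weight:
  assumes "0 < \<theta>"
  shows "(\<integral>\<^sup>+g. ennreal (gamma_weight \<theta> g / Gamma \<theta>) \<partial>lborel) = 1"
proof -
  have G: "0 < Gamma \<theta>" using assms by (rule Gamma_real_pos)
  have "(\<integral>\<^sup>+g. ennreal (g powr (\<theta> - 1) / exp g) * indicator {0..} g \<partial>lborel) = ennreal (Gamma \<theta>)"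
    by (rule nn_integral_has_integral_lebesgue'[OF _ Gamma_integral_real[OF assms]]) simp
  moreover have "(\<integral>\<^sup>+g. ennreal (gamma_weight \<theta> g / Gamma \<theta>) \<partial>lborel)
      = (\<integral>\<^sup>+g. ennreal (1 / Gamma \<theta>) * (ennreal (g powr (\<theta> - 1) / exp g) * indicator {0..} g) \<partial>lborel)"
    using G by (intro nn_integral_cong)
      (auto simp: gamma_weight_def indicator_def exp_minus field_simps simp flip: ennreal_mult')
  ultimately show ?thesis using G by (simp add: nn_integral_cmult flip: ennreal_mult')
qed

lemma nn_integral_std_normal_density: "(\<integral>\<^sup>+a. ennreal (std_normal_density a) \<partial>lborel) = 1"
  by (subst nn_integral_eq_integral) auto

text \<open>Up to sign the resultant of the polynomials with roots \<open>x\<close> and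
  \<open>m\<close>. Both products of residues equal it up to squared Vandermonde factors, which
  links the two changes of variables.\<close>

definition cross_prod :: "nat \<Rightarrow> (nat \<Rightarrow> real) \<Rightarrow> (nat \<Rightarrow> real) \<Rightarrow> real" where
  "cross_prod N x m = (\<Prod>i<Suc N. \<Prod>k<N. \<bar>x i - m k\<bar>)"

lemma interlacing_prod_lower:
  assumes "interlacing N x m"
  shows "(\<Prod>i<Suc N. pf_residue (Suc N) x N m i) = cross_prod N x m / (vandermonde (Suc N) x)\<^sup>2"
proof -
  have "(\<Prod>i<Suc N. pf_residue (Suc N) x N m i) = (\<Prod>i<Suc N. \<bar>pf_residue (Suc N) x N m i\<bar>)"
    by (rule prod.cong) (use interlacing_residue_pos[OF assms] in \<open>auto simp: less_imp_le\<close>)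
  then show ?thesis
    unfolding vandermonde_power2[symmetric] cross_prod_def pf_residue_def
    by (simp only: abs_divide abs_prod prod_dividef)
qed

lemma interlacing_prod_upper:
  assumes "interlacing N x m"
  shows "(\<Prod>i<N. - pf_residue N m (Suc N) x i) * (vandermonde N m)\<^sup>2 = cross_prod N x m"
proof -
  have "(\<Prod>i<N. - pf_residue N m (Suc N) x i) = (\<Prod>i<N. \<bar>pf_residue N m (Suc N) x i\<bar>)"
    by (rule prod.cong) (use interlacing_residue_neg[OF assms] in \<open>auto simp: less_imp_le\<close>)
  also have "\<dots> = (\<Prod>i<N. \<Prod>k<Suc N. \<bar>m i - x k\<bar>) / (vandermonde N m)\<^sup>2"
    unfolding vandermonde_power2[symmetric] pf_residue_def
    by (simp only: abs_divide abs_prod prod_dividef)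
  also have "(\<Prod>i<N. \<Prod>k<Suc N. \<bar>m i - x k\<bar>) = cross_prod N x m"
    unfolding cross_prod_def by (subst prod.swap) (simp only: abs_minus_commute)
  finally show ?thesis using vandermonde_pos[OF interlacing_decreasing(2)[OF assms]] by simp
qed

lemma cross_prod_pos:
  assumes "interlacing N x m" shows "0 < cross_prod N x m"
proof -
  have "x i - m k \<noteq> 0" if "i < Suc N" "k < N" for i k
  proof (cases "i \<le> k")
    case True
    then have "x k \<le> x i" using interlacing_decreasing(1)[OF assms] that by (intro decreasing_le[of "Suc N"]) auto
    then show ?thesis using assms that by (auto simp: interlacing_def)
  next
    case False
    then have "x i \<le> x (Suc k)" using interlacing_decreasing(1)[OF assms] that by (intro decreasing_le[of "Suc N"]) auto
    then show ?thesis using assms that by (auto simp: interlacing_def)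
  qed
  then show ?thesis unfolding cross_prod_def by (intro prod_pos) (simp add: prod_pos)
qed

text \<open>Once the \<open>m i\<close> are below \<open>t\<close>, interlacing puts every point
  except \<open>x 0\<close> below \<open>t\<close>, so the sign of one quotient, the next pivot,
  decides.\<close>

lemma interlacing_below_iff:
  assumes int: "interlacing N x m" and m: "\<forall>i<N. m i < t"
  shows "(\<forall>i<Suc N. x i < t) \<longleftrightarrow> 0 < (\<Prod>k<Suc N. t - x k) / (\<Prod>i<N. t - m i)"
proof -
  have "x (Suc i) < t" if "i < N" for i using int m that by (auto simp: interlacing_def intro: less_trans)
  then have P: "0 < (\<Prod>i<N. t - x (Suc i))" and Q: "(\<forall>i<Suc N. x i < t) \<longleftrightarrow> x 0 < t"
    by (auto intro!: prod_pos simp: less_Suc_eq_0_disj)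
  have "0 < (\<Prod>i<N. t - m i)" using m by (auto intro!: prod_pos)
  then have "0 < (\<Prod>k<Suc N. t - x k) / (\<Prod>i<N. t - m i) \<longleftrightarrow> x 0 < t"
    using P by (simp add: prod.lessThan_Suc_shift zero_less_divide_iff zero_less_mult_iff del: prod.lessThan_Suc)
  then show ?thesis using Q by simp
qed

lemma interlacing_below_imp:
  assumes int: "interlacing N x m" and x: "\<forall>i<Suc N. x i < t"
  shows "\<forall>i<N. m i < t"
  using assms by (auto simp: interlacing_def intro: less_trans)

text \<open>The argument of \<open>\<phi>\<close> is the Weyl function \<open>\<Sum>i. v i / (t - x i)\<close> of the random spectral measure with
  atoms \<open>x i\<close> and independent gamma weights \<open>v i\<close>; the value 1 marks the event that some point is
  at least \<open>t\<close>.\<close>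

definition beta_functional :: "real \<Rightarrow> real \<Rightarrow> (real \<Rightarrow> ennreal) \<Rightarrow> nat \<Rightarrow> ennreal" where
  "beta_functional b t \<phi> N = (\<integral>\<^sup>+x. indicator {x. decreasing N x} x *
      ennreal (vandermonde N x powr (2 * b) * exp (- (\<Sum>i<N. (x i)\<^sup>2) / 2)) *
      (\<integral>\<^sup>+v. ennreal (\<Prod>i<N. gamma_weight b (v i)) *
         (if \<forall>i<N. x i < t then \<phi> (\<Sum>i<N. v i / (t - x i)) else 1) \<partial>L N) \<partial>L N)"

text \<open>One row of the Dumitriu--Edelman tridiagonal matrix: \<open>t - a - s\<close> is the next pivot of
  the Gaussian elimination of \<open>t\<close> minus the matrix, and \<open>g\<close> is the next squared off-diagonal entry.\<close>

definition riccati_op :: "real \<Rightarrow> real \<Rightarrow> (real \<Rightarrow> ennreal) \<Rightarrow> real \<Rightarrow> ennreal" where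
  "riccati_op t \<theta> \<phi> s = (\<integral>\<^sup>+a. ennreal (std_normal_density a) *
     (\<integral>\<^sup>+g. ennreal (gamma_weight \<theta> g / Gamma \<theta>) *
        (if 0 < t - a - s then \<phi> (g / (t - a - s)) else 1) \<partial>lborel) \<partial>lborel)"

lemma measurable_riccati_op[measurable]:
  assumes [measurable]: "\<phi> \<in> borel_measurable borel"
  shows "riccati_op t \<theta> \<phi> \<in> borel_measurable borel"
  unfolding riccati_op_def[abs_def] by measurable

lemma measurable_decreasing[measurable]: "Measurable.pred (L N) (\<lambda>x. decreasing N x)"
proof -
  have "decreasing N x \<longleftrightarrow> (\<forall>j<N. \<forall>i<j. x j < x i)" for x by (auto simp: decreasing_def)
  then show ?thesis by simp
qed

section \<open>One Riccati step from size \<open>Suc N\<close> to size \<open>N\<close>\<close>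

context
  fixes b t :: real and \<phi> :: "real \<Rightarrow> ennreal" and N :: nat
  assumes b: "0 < b" and phi[measurable]: "\<phi> \<in> borel_measurable borel"
begin

text \<open>The unnormalised joint density of the points and the zeros of their Weyl function, of
  Dixon-Anderson type: both Vandermonde products occur to the first power, and \<open>b\<close>
  enters only through the exponent of \<open>cross_prod\<close>.\<close>

definition interlacing_kernel :: "(nat \<Rightarrow> real) \<Rightarrow> (nat \<Rightarrow> real) \<Rightarrow> ennreal" where
  "interlacing_kernel x m = indicator {m. interlacing N x m} m *
     ennreal (vandermonde (Suc N) x * cross_prod N x m powr (b - 1) * vandermonde N m * exp (- (\<Sum>i<Suc N. (x i)\<^sup>2) / 2))"

text \<open>\<open>g\<close> is the total of \<open>Suc N\<close> independent gamma weights of shape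
  \<open>b\<close>, whence its shape. The argument of \<open>\<phi>\<close> is the Weyl function,
  with zeros \<open>m\<close> and poles \<open>x\<close>.\<close>

definition edge_kernel :: "(nat \<Rightarrow> real) \<Rightarrow> (nat \<Rightarrow> real) \<Rightarrow> real \<Rightarrow> ennreal" where
  "edge_kernel x m g = ennreal (gamma_weight (real (Suc N) * b) g) *
     (if \<forall>i<Suc N. x i < t then \<phi> (g * ((\<Prod>i<N. t - m i) / (\<Prod>i<Suc N. t - x i))) else 1)"

text \<open>With \<open>x\<close> fixed, the weights are exchanged for \<open>g\<close> and
  \<open>m\<close>. The product of the shares is \<open>cross_prod\<close> over the squared
  Vandermonde product, which lowers the Vandermonde exponent from \<open>2 * b\<close> to 1.\<close>

lemma beta_functional_step_lower:
  assumes dec: "decreasing (Suc N) x"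
  shows "ennreal (vandermonde (Suc N) x powr (2 * b) * exp (- (\<Sum>i<Suc N. (x i)\<^sup>2) / 2)) *
      (\<integral>\<^sup>+v. ennreal (\<Prod>i<Suc N. gamma_weight b (v i)) *
         (if \<forall>i<Suc N. x i < t then \<phi> (\<Sum>i<Suc N. v i / (t - x i)) else 1) \<partial>L (Suc N))
     = (\<integral>\<^sup>+g. \<integral>\<^sup>+m. interlacing_kernel x m * edge_kernel x m g \<partial>L N \<partial>lborel)"
proof -
  define V where "V = vandermonde (Suc N) x"
  have V: "0 < V" unfolding V_def by (rule vandermonde_pos[OF dec])
  define e where "e = exp (- (\<Sum>i<Suc N. (x i)\<^sup>2) / 2)"
  have e: "0 < e" by (simp add: e_def)
  \<comment> \<open>The gamma weights without their support condition, which the indicator of the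
    positive orthant takes over.\<close>
  define G where "G v = ennreal ((\<Prod>i<Suc N. v i powr (b - 1)) * exp (- (\<Sum>i<Suc N. v i))) *
     (if \<forall>i<Suc N. x i < t then \<phi> (\<Sum>i<Suc N. v i / (t - x i)) else 1)" for v
  have [measurable]: "G \<in> borel_measurable (L (Suc N))" unfolding G_def by measurable
  have G_restrict: "G (\<lambda>i\<in>{..<Suc N}. f i) = G f" for f
  proof -
    have "(\<Prod>i<Suc N. (\<lambda>i\<in>{..<Suc N}. f i) i powr (b - 1)) = (\<Prod>i<Suc N. f i powr (b - 1))"
      by (rule prod.cong) auto
    moreover have "(\<Sum>i<Suc N. (\<lambda>i\<in>{..<Suc N}. f i) i) = (\<Sum>i<Suc N. f i)"
      by (rule sum.cong) auto
    moreover have "(\<Sum>i<Suc N. (\<lambda>i\<in>{..<Suc N}. f i) i / (t - x i)) = (\<Sum>i<Suc N. f i / (t - x i))"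
      by (rule sum.cong) auto
    ultimately show ?thesis unfolding G_def by (simp only:)
  qed
  have 1: "ennreal (\<Prod>i<Suc N. gamma_weight b (v i)) *
         (if \<forall>i<Suc N. x i < t then \<phi> (\<Sum>i<Suc N. v i / (t - x i)) else 1)
      = indicator {v. \<forall>i<Suc N. 0 < v i} v * G v" for v
  proof (cases "\<forall>i<Suc N. 0 < v i")
    case True
    then have "(\<Prod>i<Suc N. gamma_weight b (v i)) = (\<Prod>i<Suc N. v i powr (b - 1) * exp (- v i))"
      by (intro prod.cong) (auto simp: gamma_weight_def)
    also have "\<dots> = (\<Prod>i<Suc N. v i powr (b - 1)) * exp (- (\<Sum>i<Suc N. v i))"
      by (simp only: prod.distrib exp_sum[symmetric] finite_lessThan sum_negf)
    finally show ?thesis using True by (simp add: G_def del: prod.lessThan_Suc sum.lessThan_Suc)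
  next
    case False
    then have "(\<Prod>i<Suc N. gamma_weight b (v i)) = 0"
      by (intro prod_zero) (auto simp: gamma_weight_def)
    moreover have "indicator {v. \<forall>i<Suc N. 0 < v i} v = (0 :: ennreal)" using False by (simp add: indicator_def)
    ultimately show ?thesis by (simp only: ennreal_0 mult_zero_left)
  qed
  \<comment> \<open>The exponent is \<open>2 * b - 1\<close> because one factor \<open>V\<close> is
    consumed by \<open>nn_integral_interlacing_lower\<close>.\<close>
  have 2: "ennreal (V powr (2 * b - 1) * e) * (indicator {0<..} g * ennreal (g ^ N) *
        (\<integral>\<^sup>+m. indicator {m. interlacing N x m} m *
            G (\<lambda>i\<in>{..<Suc N}. g * pf_residue (Suc N) x N m i) * ennreal (vandermonde N m) \<partial>L N))
      = (\<integral>\<^sup>+m. interlacing_kernel x m * edge_kernel x m g \<partial>L N)" for g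
  proof (cases "0 < g")
    case False
    then show ?thesis by (simp add: edge_kernel_def gamma_weight_def)
  next
    case g: True
    have "ennreal (V powr (2 * b - 1) * e) * (indicator {0<..} g * ennreal (g ^ N) *
        (\<integral>\<^sup>+m. indicator {m. interlacing N x m} m *
            G (\<lambda>i\<in>{..<Suc N}. g * pf_residue (Suc N) x N m i) * ennreal (vandermonde N m) \<partial>L N))
      = ennreal (V powr (2 * b - 1) * e * g ^ N) *
        (\<integral>\<^sup>+m. indicator {m. interlacing N x m} m *
            G (\<lambda>i\<in>{..<Suc N}. g * pf_residue (Suc N) x N m i) * ennreal (vandermonde N m) \<partial>L N)"
      using g e by (simp add: ennreal_mult mult.assoc)
    also have "\<dots> = (\<integral>\<^sup>+m. ennreal (V powr (2 * b - 1) * e * g ^ N) * (indicator {m. interlacing N x m} m *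
            G (\<lambda>i\<in>{..<Suc N}. g * pf_residue (Suc N) x N m i) * ennreal (vandermonde N m)) \<partial>L N)"
      by (rule nn_integral_cmult[symmetric]) measurable
    also have "\<dots> = (\<integral>\<^sup>+m. interlacing_kernel x m * edge_kernel x m g \<partial>L N)"
    proof (rule nn_integral_cong)
      fix m
      show "ennreal (V powr (2 * b - 1) * e * g ^ N) * (indicator {m. interlacing N x m} m *
            G (\<lambda>i\<in>{..<Suc N}. g * pf_residue (Suc N) x N m i) * ennreal (vandermonde N m)) = interlacing_kernel x m * edge_kernel x m g"
      proof (cases "interlacing N x m")
        case False
        then show ?thesis by (simp add: interlacing_kernel_def)
      next
        case int: True
        define q where "q i = pf_residue (Suc N) x N m i" for i
        have q: "0 < q i" if "i < Suc N" for i using interlacing_residue_pos[OF int that] by (simp add: q_def)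
        have q1: "(\<Sum>i<Suc N. q i) = 1" unfolding q_def by (rule sum_pf_residue_lower[OF decreasing_inj_on[OF dec]])
        have qR: "(\<Prod>i<Suc N. q i) = cross_prod N x m / V\<^sup>2"
          unfolding q_def V_def by (rule interlacing_prod_lower[OF int])
        define R where "R = cross_prod N x m"
        have R: "0 < R" unfolding R_def by (rule cross_prod_pos[OF int])
        have prod: "(\<Prod>i<Suc N. (g * q i) powr (b - 1)) = g powr (real (Suc N) * (b - 1)) * (R powr (b - 1) / V powr (2 * (b - 1)))"
        proof -
          have "(\<Prod>i<Suc N. (g * q i) powr (b - 1)) = (\<Prod>i<Suc N. g * q i) powr (b - 1)"
            by (rule prod_powr_distrib[symmetric])
          also have "(\<Prod>i<Suc N. g * q i) = g ^ Suc N * (R / V\<^sup>2)"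
            unfolding prod.distrib qR R_def by simp
          also have "\<dots> powr (b - 1) = (g ^ Suc N) powr (b - 1) * (R powr (b - 1) / (V\<^sup>2) powr (b - 1))"
            using g R V by (simp add: powr_mult powr_divide)
          also have "(g ^ Suc N) powr (b - 1) = g powr (real (Suc N) * (b - 1))"
            using g by (simp only: powr_realpow[symmetric] powr_powr)
          also have "(V\<^sup>2) powr (b - 1) = V powr (2 * (b - 1))"
            using V by (simp add: powr_powr flip: powr_numeral)
          finally show ?thesis .
        qed
        \<comment> \<open>N + (N + 1) (b - 1) = (N + 1) b - 1: the simplex Jacobian raises the
          exponent to that of the gamma law of the total.\<close>
        have gN: "g ^ N * g powr (real (Suc N) * (b - 1)) = g powr (real (Suc N) * b - 1)"
          using g by (simp add: powr_realpow[symmetric] powr_add[symmetric] algebra_simps)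
        have VV: "V powr (2 * b - 1) / V powr (2 * (b - 1)) = V"
        proof -
          have "V powr (2 * b - 1) / V powr (2 * (b - 1)) = V powr ((2 * b - 1) - 2 * (b - 1))" by (rule powr_diff[symmetric])
          also have "(2 * b - 1) - 2 * (b - 1) = 1" by simp
          finally show ?thesis using V by simp
        qed
        have real_eq: "V powr (2 * b - 1) * e * g ^ N * ((\<Prod>i<Suc N. (g * q i) powr (b - 1)) * exp (- (\<Sum>i<Suc N. g * q i)))
            = V * R powr (b - 1) * e * gamma_weight (real (Suc N) * b) g"
        proof -
          have "(\<Sum>i<Suc N. g * q i) = g" using q1 by (simp add: sum_distrib_left[symmetric] del: sum.lessThan_Suc)
          then have "V powr (2 * b - 1) * e * g ^ N * ((\<Prod>i<Suc N. (g * q i) powr (b - 1)) * exp (- (\<Sum>i<Suc N. g * q i)))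
            = (V powr (2 * b - 1) / V powr (2 * (b - 1))) * R powr (b - 1) * e * ((g ^ N * g powr (real (Suc N) * (b - 1))) * exp (- g))"
            unfolding prod by simp
          then show ?thesis unfolding VV gN using g by (simp add: gamma_weight_def)
        qed
        have arg: "(\<Sum>i<Suc N. g * q i / (t - x i)) = g * ((\<Prod>i<N. t - m i) / (\<Prod>i<Suc N. t - x i))"
          if below: "\<forall>i<Suc N. x i < t"
        proof -
          have ne: "t \<noteq> x i" if "i < Suc N" for i using below that by auto
          have "(\<Prod>i<N. t - m i) / (\<Prod>i<Suc N. t - x i) = (\<Sum>i<Suc N. q i / (t - x i))"
            unfolding q_def by (rule partial_fractions_lower[OF decreasing_inj_on[OF dec] ne])
          then have "g * ((\<Prod>i<N. t - m i) / (\<Prod>i<Suc N. t - x i)) = g * (\<Sum>i<Suc N. q i / (t - x i))"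
            by (rule arg_cong)
          also have "\<dots> = (\<Sum>i<Suc N. g * q i / (t - x i))"
            by (simp only: sum_distrib_left times_divide_eq_right)
          finally show ?thesis ..
        qed
        have "G (\<lambda>i\<in>{..<Suc N}. g * q i) = ennreal ((\<Prod>i<Suc N. (g * q i) powr (b - 1)) * exp (- (\<Sum>i<Suc N. g * q i))) *
          (if \<forall>i<Suc N. x i < t then \<phi> (g * ((\<Prod>i<N. t - m i) / (\<Prod>i<Suc N. t - x i))) else 1)"
          (is "_ = ennreal ?P * ?c")
        proof (cases "\<forall>i<Suc N. x i < t")
          case True
          show ?thesis unfolding G_restrict by (simp only: G_def arg[OF True] if_P[OF True])
        next
          case False
          show ?thesis unfolding G_restrict by (simp only: G_def if_not_P[OF False])
        qed
        then have "ennreal (V powr (2 * b - 1) * e * g ^ N) * (G (\<lambda>i\<in>{..<Suc N}. g * q i) * ennreal (vandermonde N m))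
          = ennreal (V powr (2 * b - 1) * e * g ^ N * ?P) * ennreal (vandermonde N m) * ?c"
          using g e by (simp add: ennreal_mult prod_nonneg mult_ac del: prod.lessThan_Suc sum.lessThan_Suc)
        also have "\<dots> = ennreal (V * R powr (b - 1) * vandermonde N m * e) * (ennreal (gamma_weight (real (Suc N) * b) g) * ?c)"
          unfolding real_eq using V R e
          by (simp add: ennreal_mult gamma_weight_nonneg vandermonde_nonneg mult_ac del: prod.lessThan_Suc of_nat_Suc)
        finally show ?thesis using int
          unfolding interlacing_kernel_def edge_kernel_def V_def[symmetric] R_def[symmetric] e_def[symmetric] q_def[symmetric]
          by (simp only: indicator_simps mem_Collect_eq mult_1_left)
      qed
    qed
    finally show ?thesis .
  qed
  have [measurable]: "Measurable.pred (lborel \<Otimes>\<^sub>M L N) (\<lambda>p. interlacing N x (snd p))"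
    unfolding interlacing_def by measurable
  have [measurable]: "(\<lambda>p. pf_residue (Suc N) x N (snd p) i) \<in> borel_measurable (lborel \<Otimes>\<^sub>M L N)" for i
    unfolding pf_residue_def by measurable
  have "(\<lambda>p. \<lambda>i\<in>{..<Suc N}. fst p * pf_residue (Suc N) x N (snd p) i) \<in> measurable (lborel \<Otimes>\<^sub>M L N) (L (Suc N))"
    by measurable
  from measurable_compose[OF this \<open>G \<in> _\<close>]
  have Gm: "(\<lambda>p. G (\<lambda>i\<in>{..<Suc N}. fst p * pf_residue (Suc N) x N (snd p) i)) \<in> borel_measurable (lborel \<Otimes>\<^sub>M L N)" .
  have "(\<lambda>(g, m). indicator {m. interlacing N x m} m *
            G (\<lambda>i\<in>{..<Suc N}. g * pf_residue (Suc N) x N m i) * ennreal (vandermonde N m)) \<in> borel_measurable (lborel \<Otimes>\<^sub>M L N)"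
    unfolding case_prod_beta by (intro borel_measurable_times_ennreal Gm) measurable
  note [measurable] = borel_measurable_nn_integral_L[OF this]
  have "ennreal (V powr (2 * b) * e) = ennreal (V powr (2 * b - 1) * e) * ennreal V"
    using V e by (simp add: ennreal_mult[symmetric] powr_diff mult_ac)
  then have "ennreal (V powr (2 * b) * e) * (\<integral>\<^sup>+v. indicator {v. \<forall>i<Suc N. 0 < v i} v * G v \<partial>L (Suc N))
    = ennreal (V powr (2 * b - 1) * e) * (ennreal V * (\<integral>\<^sup>+v. indicator {v. \<forall>i<Suc N. 0 < v i} v * G v \<partial>L (Suc N)))"
    by (simp only: mult.assoc)
  also have "\<dots> = (\<integral>\<^sup>+g. ennreal (V powr (2 * b - 1) * e) * (indicator {0<..} g * ennreal (g ^ N) *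
        (\<integral>\<^sup>+m. indicator {m. interlacing N x m} m *
            G (\<lambda>i\<in>{..<Suc N}. g * pf_residue (Suc N) x N m i) * ennreal (vandermonde N m) \<partial>L N)) \<partial>lborel)"
    unfolding V_def nn_integral_interlacing_lower[OF dec \<open>G \<in> _\<close>]
    by (rule nn_integral_cmult[symmetric]) measurable
  finally show ?thesis unfolding 1 2[symmetric] V_def e_def .
qed

text \<open>With \<open>m\<close> fixed, \<open>x\<close> is exchanged for the corner and the border
  weights. The squares of the points sum to those of \<open>m\<close> plus the squared corner plus
  twice the total border weight, so the Gaussian factor splits into a normal density and
  exponentials; \<open>cross_prod\<close> supplies the powers that complete the gamma
  weights.\<close>

lemma beta_functional_step_upper:
  assumes dec: "decreasing N m"
  shows "(\<integral>\<^sup>+x. interlacing_kernel x m * (\<integral>\<^sup>+g. edge_kernel x m g \<partial>lborel) \<partial>L (Suc N))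
     = ennreal (Gamma (real (Suc N) * b) * sqrt (2 * pi)) *
       (ennreal (vandermonde N m powr (2 * b) * exp (- (\<Sum>i<N. (m i)\<^sup>2) / 2)) *
      (\<integral>\<^sup>+w. ennreal (\<Prod>i<N. gamma_weight b (w i)) *
         (if \<forall>i<N. m i < t then riccati_op t (real (Suc N) * b) \<phi> (\<Sum>i<N. w i / (t - m i)) else 1) \<partial>L N))"
proof -
  define \<theta> where "\<theta> = real (Suc N) * b"
  have \<theta>: "0 < \<theta>" using b by (simp add: \<theta>_def)
  define V where "V = vandermonde N m"
  have V: "0 < V" unfolding V_def by (rule vandermonde_pos[OF dec])
  define e where "e = exp (- (\<Sum>i<N. (m i)\<^sup>2) / 2)"
  have e: "0 < e" by (simp add: e_def)
  have inj: "inj_on m {..<N}" by (rule decreasing_inj_on[OF dec])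
  \<comment> \<open>The next pivot: the product of the \<open>t - x k\<close> over that of the
    \<open>t - m i\<close>, in the coordinates \<open>a\<close> and \<open>w\<close>.\<close>
  define d where "d a w = t - a - (\<Sum>i<N. w i / (t - m i))" for a :: real and w :: "nat \<Rightarrow> real"
  define X where "X a w g = (if (\<forall>i<N. m i < t) \<and> 0 < d a w then \<phi> (g / d a w) else 1)" for a w g
  define F where "F = (\<lambda>(a, w). ennreal (V * ((\<Prod>i<N. w i) * V\<^sup>2) powr (b - 1) *
      (e * exp (- a\<^sup>2 / 2) * exp (- (\<Sum>i<N. w i)))) * (\<integral>\<^sup>+g. ennreal (gamma_weight \<theta> g) * X a w g \<partial>lborel))"
  have [measurable]: "(\<lambda>p. d (fst p) (snd p)) \<in> borel_measurable (lborel \<Otimes>\<^sub>M L N)"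
    unfolding d_def by measurable
  have [measurable]: "(\<lambda>p. X (fst (fst p)) (snd (fst p)) (snd p)) \<in> borel_measurable ((lborel \<Otimes>\<^sub>M L N) \<Otimes>\<^sub>M lborel)"
    unfolding X_def by measurable
  have Fm: "F \<in> borel_measurable (lborel \<Otimes>\<^sub>M L N)"
    unfolding F_def case_prod_beta by measurable
  have "(\<integral>\<^sup>+x. interlacing_kernel x m * (\<integral>\<^sup>+g. edge_kernel x m g \<partial>lborel) \<partial>L (Suc N))
    = (\<integral>\<^sup>+x. indicator {x. interlacing N x m} x *
      F ((\<Sum>i<Suc N. x i) - (\<Sum>i<N. m i), \<lambda>i\<in>{..<N}. - pf_residue N m (Suc N) x i) *
      ennreal (vandermonde (Suc N) x) \<partial>L (Suc N))"
  proof (rule nn_integral_cong)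
    fix x
    show "interlacing_kernel x m * (\<integral>\<^sup>+g. edge_kernel x m g \<partial>lborel) = indicator {x. interlacing N x m} x *
      F ((\<Sum>i<Suc N. x i) - (\<Sum>i<N. m i), \<lambda>i\<in>{..<N}. - pf_residue N m (Suc N) x i) *
      ennreal (vandermonde (Suc N) x)"
    proof (cases "interlacing N x m")
      case False
      then show ?thesis by (simp add: interlacing_kernel_def)
    next
      case int: True
      define s where "s = (\<Sum>i<Suc N. x i) - (\<Sum>i<N. m i)"
      define w where "w = (\<lambda>i\<in>{..<N}. - pf_residue N m (Suc N) x i)"
      have sw: "(\<Sum>i<N. w i) = - (\<Sum>i<N. pf_residue N m (Suc N) x i)"
        by (simp add: w_def sum_negf)
      have "(\<Prod>i<N. w i) = (\<Prod>i<N. - pf_residue N m (Suc N) x i)"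
        by (rule prod.cong) (auto simp: w_def)
      then have cp: "cross_prod N x m = (\<Prod>i<N. w i) * V\<^sup>2"
        using interlacing_prod_upper[OF int] by (simp add: V_def)
      have "(\<Sum>i<Suc N. (x i)\<^sup>2) = (\<Sum>i<N. (m i)\<^sup>2) + s\<^sup>2 + 2 * (\<Sum>i<N. w i)"
        unfolding sw sum_squares_roots[OF inj] s_def by simp
      then have "- (\<Sum>i<Suc N. (x i)\<^sup>2) / 2 = - (\<Sum>i<N. (m i)\<^sup>2) / 2 + - s\<^sup>2 / 2 + - (\<Sum>i<N. w i)"
        by (simp only:) (simp add: field_simps)
      then have ex: "exp (- (\<Sum>i<Suc N. (x i)\<^sup>2) / 2) = e * exp (- s\<^sup>2 / 2) * exp (- (\<Sum>i<N. w i))"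
        unfolding e_def by (simp only: exp_add)
      have "edge_kernel x m g = ennreal (gamma_weight \<theta> g) * X s w g" for g
      proof (cases "\<forall>i<N. m i < t")
        case True
        then have ne: "t \<noteq> m i" if "i < N" for i using that by auto
        have "(\<Prod>k<Suc N. t - x k) / (\<Prod>i<N. t - m i) = t - s + (\<Sum>i<N. pf_residue N m (Suc N) x i / (t - m i))"
          unfolding s_def by (rule partial_fractions_Suc[OF inj ne])
        also have "(\<Sum>i<N. pf_residue N m (Suc N) x i / (t - m i)) = - (\<Sum>i<N. w i / (t - m i))"
          by (simp add: w_def sum_negf)
        finally have d: "(\<Prod>k<Suc N. t - x k) / (\<Prod>i<N. t - m i) = d s w" by (simp add: d_def)
        then have d': "(\<Prod>i<N. t - m i) / (\<Prod>k<Suc N. t - x k) = 1 / d s w"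
          by (metis inverse_divide inverse_eq_divide)
        have iff: "(\<forall>i<Suc N. x i < t) \<longleftrightarrow> (\<forall>i<N. m i < t) \<and> 0 < d s w"
          using interlacing_below_iff[OF int True] True unfolding d by blast
        show ?thesis unfolding edge_kernel_def X_def d' iff \<theta>_def times_divide_eq_right mult_1_right ..
      next
        case False
        then have "\<not> (\<forall>i<Suc N. x i < t)" using interlacing_below_imp[OF int] by blast
        then show ?thesis using False unfolding edge_kernel_def X_def \<theta>_def by (simp only: if_False simp_thms)
      qed
      then have "F (s, w) = ennreal (V * cross_prod N x m powr (b - 1) * exp (- (\<Sum>i<Suc N. (x i)\<^sup>2) / 2)) *
          (\<integral>\<^sup>+g. edge_kernel x m g \<partial>lborel)"
        by (simp only: F_def prod.case cp ex)
      then show ?thesis using int V unfolding s_def[symmetric] w_def[symmetric] interlacing_kernel_def V_def[symmetric]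
        by (simp add: ennreal_mult vandermonde_nonneg mult_ac del: sum.lessThan_Suc)
    qed
  qed
  also have "\<dots> = ennreal V * (\<integral>\<^sup>+w. \<integral>\<^sup>+a. indicator {w. \<forall>i<N. 0 < w i} w * F (a, w) \<partial>lborel \<partial>L N)"
    unfolding V_def by (rule nn_integral_interlacing_upper[OF dec Fm])
  also have "\<dots> = (\<integral>\<^sup>+w. ennreal V * (\<integral>\<^sup>+a. indicator {w. \<forall>i<N. 0 < w i} w * F (a, w) \<partial>lborel) \<partial>L N)"
  proof (rule nn_integral_cmult[symmetric])
    have [measurable]: "(\<lambda>p. F (snd p, fst p)) \<in> borel_measurable (L N \<Otimes>\<^sub>M lborel)"
      using measurable_compose[OF _ Fm, of "\<lambda>p. (snd p, fst p)" "L N \<Otimes>\<^sub>M lborel"] by simp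
    show "(\<lambda>w. \<integral>\<^sup>+a. indicator {w. \<forall>i<N. 0 < w i} w * F (a, w) \<partial>lborel) \<in> borel_measurable (L N)"
      unfolding indicator_def by measurable
  qed
  also have "\<dots> = (\<integral>\<^sup>+w. ennreal (Gamma \<theta> * sqrt (2 * pi) * (V powr (2 * b) * e)) *
      (ennreal (\<Prod>i<N. gamma_weight b (w i)) *
         (if \<forall>i<N. m i < t then riccati_op t \<theta> \<phi> (\<Sum>i<N. w i / (t - m i)) else 1)) \<partial>L N)"
  proof (rule nn_integral_cong)
    fix w assume w[measurable]: "w \<in> space (L N)"
    show "ennreal V * (\<integral>\<^sup>+a. indicator {w. \<forall>i<N. 0 < w i} w * F (a, w) \<partial>lborel)
      = ennreal (Gamma \<theta> * sqrt (2 * pi) * (V powr (2 * b) * e)) *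
      (ennreal (\<Prod>i<N. gamma_weight b (w i)) *
         (if \<forall>i<N. m i < t then riccati_op t \<theta> \<phi> (\<Sum>i<N. w i / (t - m i)) else 1))"
    proof (cases "\<forall>i<N. 0 < w i")
      case False
      then have "(\<Prod>i<N. gamma_weight b (w i)) = 0"
        by (intro prod_zero) (auto simp: gamma_weight_def)
      moreover have "indicator {w. \<forall>i<N. 0 < w i} w = (0 :: ennreal)" using False by (simp add: indicator_def)
      ultimately show ?thesis by (simp only: mult_zero_left mult_zero_right ennreal_0 nn_integral_const)
    next
      case True
      define P where "P = (\<Prod>i<N. w i)"
      have P: "0 < P" unfolding P_def using True by (intro prod_pos) auto
      have "(\<Prod>i<N. gamma_weight b (w i)) = (\<Prod>i<N. w i powr (b - 1) * exp (- w i))"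
        by (rule prod.cong) (use True in \<open>auto simp: gamma_weight_def\<close>)
      also have "\<dots> = P powr (b - 1) * exp (- (\<Sum>i<N. w i))"
        by (simp add: P_def prod.distrib prod_powr_distrib exp_sum flip: sum_negf)
      finally have gw: "(\<Prod>i<N. gamma_weight b (w i)) = P powr (b - 1) * exp (- (\<Sum>i<N. w i))" .
      have Gp: "0 < Gamma \<theta>" using \<theta> by (rule Gamma_real_pos)
      \<comment> \<open>\<open>Gamma \<theta>\<close> and \<open>sqrt (2 * pi)\<close> are pulled
        out so that two probability densities remain under the integrals.\<close>
      define K where "K = V * (P * V\<^sup>2) powr (b - 1) * e * exp (- (\<Sum>i<N. w i)) * (Gamma \<theta> * sqrt (2 * pi))"
      have K: "0 \<le> K" using V e Gp by (simp add: K_def)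
      have [measurable]: "(\<lambda>p. X (fst p) w (snd p)) \<in> borel_measurable (lborel \<Otimes>\<^sub>M lborel)"
        unfolding X_def d_def by measurable
      have [measurable]: "(\<lambda>g. X a w g) \<in> borel_measurable lborel" for a
        unfolding X_def d_def by measurable
      have F: "F (a, w) = ennreal K * (ennreal (std_normal_density a) *
          (\<integral>\<^sup>+g. ennreal (gamma_weight \<theta> g / Gamma \<theta>) * X a w g \<partial>lborel))" for a
      proof -
        have "(\<integral>\<^sup>+g. ennreal (gamma_weight \<theta> g) * X a w g \<partial>lborel)
            = (\<integral>\<^sup>+g. ennreal (Gamma \<theta>) * (ennreal (gamma_weight \<theta> g / Gamma \<theta>) * X a w g) \<partial>lborel)"
          using Gp by (intro nn_integral_cong) (simp add: mult.assoc[symmetric] flip: ennreal_mult')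
        also have "\<dots> = ennreal (Gamma \<theta>) * (\<integral>\<^sup>+g. ennreal (gamma_weight \<theta> g / Gamma \<theta>) * X a w g \<partial>lborel)"
          by (rule nn_integral_cmult) measurable
        finally have "F (a, w) = ennreal (V * (P * V\<^sup>2) powr (b - 1) * (e * exp (- a\<^sup>2 / 2) * exp (- (\<Sum>i<N. w i)))) *
            (ennreal (Gamma \<theta>) * (\<integral>\<^sup>+g. ennreal (gamma_weight \<theta> g / Gamma \<theta>) * X a w g \<partial>lborel))"
          by (simp add: F_def P_def)
        also have "\<dots> = ennreal (V * (P * V\<^sup>2) powr (b - 1) * (e * exp (- a\<^sup>2 / 2) * exp (- (\<Sum>i<N. w i))) * Gamma \<theta>) *
             (\<integral>\<^sup>+g. ennreal (gamma_weight \<theta> g / Gamma \<theta>) * X a w g \<partial>lborel)"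
          using Gp V e by (simp add: ennreal_mult mult.assoc)
        also have "V * (P * V\<^sup>2) powr (b - 1) * (e * exp (- a\<^sup>2 / 2) * exp (- (\<Sum>i<N. w i))) * Gamma \<theta>
            = K * std_normal_density a"
          by (simp add: K_def std_normal_density_def)
        finally show ?thesis using K by (simp add: ennreal_mult mult.assoc)
      qed
      \<comment> \<open>If some \<open>m i\<close> is at least \<open>t\<close>, then
        \<open>X\<close> is constantly 1, and the total masses 1 of both densities reproduce the
        failure value.\<close>
      have inner: "(\<integral>\<^sup>+a. ennreal (std_normal_density a) *
          (\<integral>\<^sup>+g. ennreal (gamma_weight \<theta> g / Gamma \<theta>) * X a w g \<partial>lborel) \<partial>lborel)
        = (if \<forall>i<N. m i < t then riccati_op t \<theta> \<phi> (\<Sum>i<N. w i / (t - m i)) else 1)"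
      proof (cases "\<forall>i<N. m i < t")
        case below: True
        then have "X a w g = (if 0 < d a w then \<phi> (g / d a w) else 1)" for a g by (simp add: X_def)
        then show ?thesis unfolding if_P[OF below] riccati_op_def by (simp only: d_def)
      next
        case False
        then have "X a w g = 1" for a g unfolding X_def by (simp only: if_False simp_thms)
        then show ?thesis unfolding if_not_P[OF False]
          by (simp add: nn_integral_gamma_weight[OF \<theta>] nn_integral_std_normal_density)
      qed
      have "(\<integral>\<^sup>+a. indicator {w. \<forall>i<N. 0 < w i} w * F (a, w) \<partial>lborel) = (\<integral>\<^sup>+a. F (a, w) \<partial>lborel)"
        using True by simp
      also have "\<dots> = ennreal K * (\<integral>\<^sup>+a. ennreal (std_normal_density a) *
          (\<integral>\<^sup>+g. ennreal (gamma_weight \<theta> g / Gamma \<theta>) * X a w g \<partial>lborel) \<partial>lborel)"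
        unfolding F by (rule nn_integral_cmult) measurable
      finally have "ennreal V * (\<integral>\<^sup>+a. indicator {w. \<forall>i<N. 0 < w i} w * F (a, w) \<partial>lborel)
        = ennreal (V * K) * (if \<forall>i<N. m i < t then riccati_op t \<theta> \<phi> (\<Sum>i<N. w i / (t - m i)) else 1)"
        using inner V K by (simp add: ennreal_mult mult.assoc)
      also have "V * K = Gamma \<theta> * sqrt (2 * pi) * (V powr (2 * b) * e) * (\<Prod>i<N. gamma_weight b (w i))"
      proof -
        have "(P * V\<^sup>2) powr (b - 1) = P powr (b - 1) * V powr (2 * (b - 1))"
          using P V by (simp add: powr_mult powr_powr flip: powr_numeral)
        \<comment> \<open>One factor \<open>V\<close> comes from the substitution, one from
          \<open>interlacing_kernel\<close>, and the power from \<open>cross_prod\<close>.\<close>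
        moreover have "V * (V * V powr (2 * (b - 1))) = V powr (2 * b)"
        proof -
          have "V powr (2 * b) = V powr (2 + 2 * (b - 1))" by (simp add: algebra_simps)
          also have "\<dots> = V powr 2 * V powr (2 * (b - 1))" by (rule powr_add)
          also have "V powr 2 = V * V" using V by (simp add: power2_eq_square)
          finally show ?thesis by simp
        qed
        ultimately have "V * K = Gamma \<theta> * sqrt (2 * pi) * ((V * (V * V powr (2 * (b - 1)))) * e) * (P powr (b - 1) * exp (- (\<Sum>i<N. w i)))"
          by (simp add: K_def)
        then show ?thesis unfolding gw \<open>V * (V * V powr (2 * (b - 1))) = V powr (2 * b)\<close> .
      qed
      finally show ?thesis using V e Gp
        by (simp add: ennreal_mult prod_nonneg gamma_weight_nonneg mult.assoc)
    qed
  qed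
  also have "\<dots> = ennreal (Gamma \<theta> * sqrt (2 * pi) * (V powr (2 * b) * e)) *
      (\<integral>\<^sup>+w. ennreal (\<Prod>i<N. gamma_weight b (w i)) *
         (if \<forall>i<N. m i < t then riccati_op t \<theta> \<phi> (\<Sum>i<N. w i / (t - m i)) else 1) \<partial>L N)"
    by (rule nn_integral_cmult) measurable
  finally show ?thesis
    using e \<theta> unfolding \<theta>_def[symmetric] V_def[symmetric] e_def[symmetric]
    by (simp add: ennreal_mult Gamma_real_pos less_imp_le mult.assoc)
qed

text \<open>The same integral over \<open>x\<close>, \<open>m\<close> and \<open>g\<close> is
  evaluated with \<open>x\<close> fixed and with \<open>m\<close> fixed. The kernel vanishes off
  interlacing pairs, which disposes of configurations that are not strictly decreasing.\<close>

lemma beta_functional_Suc: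
  "beta_functional b t \<phi> (Suc N) = ennreal (Gamma (real (Suc N) * b) * sqrt (2 * pi)) *
     beta_functional b t (riccati_op t (real (Suc N) * b) \<phi>) N"
proof -
  have [measurable]: "(\<lambda>p. cross_prod N (fst p) (snd p)) \<in> borel_measurable (L (Suc N) \<Otimes>\<^sub>M L N)"
    unfolding cross_prod_def by measurable
  have [measurable]: "Measurable.pred (L (Suc N) \<Otimes>\<^sub>M L N) (\<lambda>p. interlacing N (fst p) (snd p))"
    unfolding interlacing_def by measurable
  have interlacing_kernel: "(\<lambda>p. interlacing_kernel (fst p) (snd p)) \<in> borel_measurable (L (Suc N) \<Otimes>\<^sub>M L N)"
    unfolding interlacing_kernel_def indicator_def by measurable
  have edge_kernel: "(\<lambda>p. edge_kernel (fst (fst p)) (snd (fst p)) (snd p)) \<in> borel_measurable ((L (Suc N) \<Otimes>\<^sub>M L N) \<Otimes>\<^sub>M lborel)"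
    unfolding edge_kernel_def by measurable
  have "beta_functional b t \<phi> (Suc N) = (\<integral>\<^sup>+x. \<integral>\<^sup>+g. \<integral>\<^sup>+m. interlacing_kernel x m * edge_kernel x m g \<partial>L N \<partial>lborel \<partial>L (Suc N))"
    unfolding beta_functional_def
  proof (rule nn_integral_cong)
    fix x
    have "interlacing_kernel x m = 0" if "\<not> decreasing (Suc N) x" for m
      using interlacing_decreasing(1)[of N x m] that by (auto simp: interlacing_kernel_def indicator_def)
    then show "indicator {x. decreasing (Suc N) x} x *
      ennreal (vandermonde (Suc N) x powr (2 * b) * exp (- (\<Sum>i<Suc N. (x i)\<^sup>2) / 2)) *
      (\<integral>\<^sup>+v. ennreal (\<Prod>i<Suc N. gamma_weight b (v i)) *
         (if \<forall>i<Suc N. x i < t then \<phi> (\<Sum>i<Suc N. v i / (t - x i)) else 1) \<partial>L (Suc N))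
      = (\<integral>\<^sup>+g. \<integral>\<^sup>+m. interlacing_kernel x m * edge_kernel x m g \<partial>L N \<partial>lborel)"
      by (cases "decreasing (Suc N) x")
        (simp_all only: mem_Collect_eq indicator_simps mult_1_left mult.assoc beta_functional_step_lower[unfolded mult.assoc], simp)
  qed
  also have "\<dots> = (\<integral>\<^sup>+x. \<integral>\<^sup>+m. interlacing_kernel x m * (\<integral>\<^sup>+g. edge_kernel x m g \<partial>lborel) \<partial>L N \<partial>L (Suc N))"
  proof (rule nn_integral_cong)
    fix x assume x[measurable]: "x \<in> space (L (Suc N))"
    have [measurable]: "(\<lambda>m. interlacing_kernel x m) \<in> borel_measurable (L N)"
      using measurable_compose[OF measurable_Pair1'[OF x] interlacing_kernel] by simp
    have m2[measurable]: "(\<lambda>p. edge_kernel x (fst p) (snd p)) \<in> borel_measurable (L N \<Otimes>\<^sub>M lborel)"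
      using measurable_compose[OF _ edge_kernel, of "\<lambda>p. ((x, fst p), snd p)" "L N \<Otimes>\<^sub>M lborel"] x by simp
    have m3[measurable]: "(\<lambda>g. edge_kernel x m g) \<in> borel_measurable lborel" for m
      unfolding edge_kernel_def by measurable
    have "(\<integral>\<^sup>+g. \<integral>\<^sup>+m. interlacing_kernel x m * edge_kernel x m g \<partial>L N \<partial>lborel) = (\<integral>\<^sup>+m. \<integral>\<^sup>+g. interlacing_kernel x m * edge_kernel x m g \<partial>lborel \<partial>L N)"
      by (rule pair_sigma_finite.Fubini'[OF sigma_finite_pair_L(2)]) (unfold case_prod_beta, measurable)
    also have "\<dots> = (\<integral>\<^sup>+m. interlacing_kernel x m * (\<integral>\<^sup>+g. edge_kernel x m g \<partial>lborel) \<partial>L N)"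
      by (intro nn_integral_cong nn_integral_cmult) measurable
    finally show "(\<integral>\<^sup>+g. \<integral>\<^sup>+m. interlacing_kernel x m * edge_kernel x m g \<partial>L N \<partial>lborel) = (\<integral>\<^sup>+m. interlacing_kernel x m * (\<integral>\<^sup>+g. edge_kernel x m g \<partial>lborel) \<partial>L N)" .
  qed
  also have "\<dots> = (\<integral>\<^sup>+m. \<integral>\<^sup>+x. interlacing_kernel x m * (\<integral>\<^sup>+g. edge_kernel x m g \<partial>lborel) \<partial>L (Suc N) \<partial>L N)"
  proof (rule pair_sigma_finite.Fubini'[OF sigma_finite_pair_L(1), symmetric])
    have "(\<lambda>p. \<integral>\<^sup>+g. edge_kernel (fst p) (snd p) g \<partial>lborel) \<in> borel_measurable (L (Suc N) \<Otimes>\<^sub>M L N)"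
      by (rule lborel.borel_measurable_nn_integral) (use edge_kernel in \<open>simp add: case_prod_beta\<close>)
    with interlacing_kernel show "(\<lambda>(x, m). interlacing_kernel x m * (\<integral>\<^sup>+g. edge_kernel x m g \<partial>lborel)) \<in> borel_measurable (L (Suc N) \<Otimes>\<^sub>M L N)"
      unfolding case_prod_beta by (rule borel_measurable_times_ennreal)
  qed
  also have "\<dots> = (\<integral>\<^sup>+m. ennreal (Gamma (real (Suc N) * b) * sqrt (2 * pi)) * (indicator {x. decreasing N x} m *
      ennreal (vandermonde N m powr (2 * b) * exp (- (\<Sum>i<N. (m i)\<^sup>2) / 2)) *
      (\<integral>\<^sup>+w. ennreal (\<Prod>i<N. gamma_weight b (w i)) *
         (if \<forall>i<N. m i < t then riccati_op t (real (Suc N) * b) \<phi> (\<Sum>i<N. w i / (t - m i)) else 1) \<partial>L N)) \<partial>L N)"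
  proof (rule nn_integral_cong)
    fix m
    show "(\<integral>\<^sup>+x. interlacing_kernel x m * (\<integral>\<^sup>+g. edge_kernel x m g \<partial>lborel) \<partial>L (Suc N))
      = ennreal (Gamma (real (Suc N) * b) * sqrt (2 * pi)) * (indicator {x. decreasing N x} m *
      ennreal (vandermonde N m powr (2 * b) * exp (- (\<Sum>i<N. (m i)\<^sup>2) / 2)) *
      (\<integral>\<^sup>+w. ennreal (\<Prod>i<N. gamma_weight b (w i)) *
         (if \<forall>i<N. m i < t then riccati_op t (real (Suc N) * b) \<phi> (\<Sum>i<N. w i / (t - m i)) else 1) \<partial>L N))"
    proof (cases "decreasing N m")
      case True
      show ?thesis unfolding beta_functional_step_upper[OF True] using True
        by (simp only: mem_Collect_eq indicator_simps mult_1_left mult.assoc)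
    next
      case False
      then have "interlacing_kernel x m = 0" for x
        using interlacing_decreasing(2)[of N x m] by (auto simp: interlacing_kernel_def indicator_def)
      then show ?thesis using False by simp
    qed
  qed
  also have "\<dots> = ennreal (Gamma (real (Suc N) * b) * sqrt (2 * pi)) *
     beta_functional b t (riccati_op t (real (Suc N) * b) \<phi>) N"
    unfolding beta_functional_def
  proof (rule nn_integral_cmult)
    have [measurable]: "Measurable.pred (L N \<Otimes>\<^sub>M L N) (\<lambda>p. \<forall>i<N. fst p i < t)" by measurable
    show "(\<lambda>m. indicator {x. decreasing N x} m *
      ennreal (vandermonde N m powr (2 * b) * exp (- (\<Sum>i<N. (m i)\<^sup>2) / 2)) *
      (\<integral>\<^sup>+w. ennreal (\<Prod>i<N. gamma_weight b (w i)) *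
         (if \<forall>i<N. m i < t then riccati_op t (real (Suc N) * b) \<phi> (\<Sum>i<N. w i / (t - m i)) else 1) \<partial>L N))
      \<in> borel_measurable (L N)"
      by measurable
  qed
  finally show ?thesis .
qed

end

subsection \<open>Monotonicity of the recursion\<close>

text \<open>After removal of the common part, the two excesses have equal mass. Where the first
  lives \<open>h\<close> is at most \<open>c\<close>, where the second lives it is at least
  \<open>c\<close>, so \<open>c\<close> times that mass separates the two sides.\<close>

lemma nn_integral_mono_single_crossing:
  fixes f f' :: "'a \<Rightarrow> real" and h :: "'a \<Rightarrow> ennreal"
  assumes [measurable]: "f \<in> borel_measurable M" "f' \<in> borel_measurable M" "h \<in> borel_measurable M"
    and nonneg: "\<And>x. 0 \<le> f x" "\<And>x. 0 \<le> f' x"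
    and mass: "(\<integral>\<^sup>+x. ennreal (f x) \<partial>M) = 1" "(\<integral>\<^sup>+x. ennreal (f' x) \<partial>M) = 1"
    and le: "\<And>x. f' x < f x \<Longrightarrow> h x \<le> c" and ge: "\<And>x. f x < f' x \<Longrightarrow> c \<le> h x"
  shows "(\<integral>\<^sup>+x. ennreal (f x) * h x \<partial>M) \<le> (\<integral>\<^sup>+x. ennreal (f' x) * h x \<partial>M)"
proof -
  define k where "k x = ennreal (min (f x) (f' x))" for x
  define p where "p x = ennreal (f x - min (f x) (f' x))" for x
  define q where "q x = ennreal (f' x - min (f x) (f' x))" for x
  have [measurable]: "k \<in> borel_measurable M" "p \<in> borel_measurable M" "q \<in> borel_measurable M"
    unfolding k_def[abs_def] p_def[abs_def] q_def[abs_def] by measurable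
  have f: "ennreal (f x) = k x + p x" for x
    using nonneg[of x] by (simp add: k_def p_def flip: ennreal_plus)
  have f': "ennreal (f' x) = k x + q x" for x
    using nonneg[of x] by (simp add: k_def q_def flip: ennreal_plus)
  have "(\<integral>\<^sup>+x. k x \<partial>M) + (\<integral>\<^sup>+x. p x \<partial>M) = 1" "(\<integral>\<^sup>+x. k x \<partial>M) + (\<integral>\<^sup>+x. q x \<partial>M) = 1"
    using mass by (simp_all add: f f' nn_integral_add)
  \<comment> \<open>The common part has mass at most 1, so it may be cancelled.\<close>
  then have pq: "(\<integral>\<^sup>+x. p x \<partial>M) = (\<integral>\<^sup>+x. q x \<partial>M)"
    by (metis ennreal_add_left_cancel ennreal_one_neq_top ennreal_add_eq_top)
  have "(\<integral>\<^sup>+x. ennreal (f x) * h x \<partial>M) = (\<integral>\<^sup>+x. k x * h x \<partial>M) + (\<integral>\<^sup>+x. p x * h x \<partial>M)"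
    by (simp add: f distrib_right nn_integral_add)
  also have "\<dots> \<le> (\<integral>\<^sup>+x. k x * h x \<partial>M) + (\<integral>\<^sup>+x. p x * c \<partial>M)"
  proof (intro add_left_mono nn_integral_mono)
    fix x show "p x * h x \<le> p x * c"
      using le[of x] by (cases "f' x < f x") (auto simp: p_def intro: mult_left_mono)
  qed
  also have "\<dots> = (\<integral>\<^sup>+x. k x * h x \<partial>M) + (\<integral>\<^sup>+x. q x * c \<partial>M)"
    by (simp add: nn_integral_multc pq)
  also have "\<dots> \<le> (\<integral>\<^sup>+x. k x * h x \<partial>M) + (\<integral>\<^sup>+x. q x * h x \<partial>M)"
  proof (intro add_left_mono nn_integral_mono)
    fix x show "q x * c \<le> q x * h x"
      using ge[of x] by (cases "f x < f' x") (auto simp: q_def intro: mult_left_mono)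
  qed
  also have "\<dots> = (\<integral>\<^sup>+x. ennreal (f' x) * h x \<partial>M)"
    by (simp add: f' distrib_right nn_integral_add)
  finally show ?thesis .
qed

text \<open>The quotient of the two densities is a multiple of
  \<open>g powr (\<theta>' - \<theta>)\<close>, which increases with \<open>g\<close>, so for
  distinct shapes the densities cross once.\<close>

lemma gamma_distribution_mono:
  assumes \<theta>: "0 < \<theta>" "\<theta> \<le> \<theta>'" and [measurable]: "h \<in> borel_measurable borel"
    and mono: "\<And>x y. 0 < x \<Longrightarrow> x \<le> y \<Longrightarrow> h x \<le> h y"
  shows "(\<integral>\<^sup>+g. ennreal (gamma_weight \<theta> g / Gamma \<theta>) * h g \<partial>lborel)
    \<le> (\<integral>\<^sup>+g. ennreal (gamma_weight \<theta>' g / Gamma \<theta>') * h g \<partial>lborel)"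
proof (cases "\<theta> = \<theta>'")
  case False
  with \<theta> have lt: "\<theta> < \<theta>'" "0 < \<theta>'" by auto
  have G: "0 < Gamma \<theta>" "0 < Gamma \<theta>'" using \<theta> lt by (auto intro: Gamma_real_pos)
  define r where "r = Gamma \<theta>' / Gamma \<theta>"
  \<comment> \<open>The crossing point, where the quotient of the densities is 1.\<close>
  define g0 where "g0 = r powr (1 / (\<theta>' - \<theta>))"
  have r: "0 < r" using G by (simp add: r_def)
  have g0: "0 < g0" using r by (simp add: g0_def)
  have g0r: "g0 powr (\<theta>' - \<theta>) = r" using lt r by (simp add: g0_def powr_powr)
  have ratio: "gamma_weight \<theta>' g / Gamma \<theta>' = gamma_weight \<theta> g / Gamma \<theta> * (g powr (\<theta>' - \<theta>) / r)" if "0 < g" for g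
  proof -
    have "g powr (\<theta>' - 1) = g powr (\<theta> - 1) * g powr (\<theta>' - \<theta>)" by (simp flip: powr_add)
    then show ?thesis using that G by (simp add: gamma_weight_def r_def)
  qed
  have pos: "0 < gamma_weight \<theta> g / Gamma \<theta>" if "0 < g" for g
    using that G by (simp add: gamma_weight_def)
  show ?thesis
  proof (rule nn_integral_mono_single_crossing[where c = "h g0"])
    fix g assume *: "gamma_weight \<theta>' g / Gamma \<theta>' < gamma_weight \<theta> g / Gamma \<theta>"
    then have g: "0 < g" by (cases "0 < g") (auto simp: gamma_weight_def)
    then have "\<not> g0 \<le> g"
    proof -
      have "1 \<le> g powr (\<theta>' - \<theta>) / r" if "g0 \<le> g"
        using powr_mono2[of "\<theta>' - \<theta>" g0 g] that g0 lt g0r r by (simp add: le_divide_eq)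
      then show ?thesis using * unfolding ratio[OF g] using pos[OF g]
        by (smt (verit) mult_le_cancel_left1)
    qed
    then show "h g \<le> h g0" using g by (intro mono) auto
  next
    fix g assume *: "gamma_weight \<theta> g / Gamma \<theta> < gamma_weight \<theta>' g / Gamma \<theta>'"
    then have g: "0 < g" by (cases "0 < g") (auto simp: gamma_weight_def)
    then have "\<not> g \<le> g0"
    proof -
      have "g powr (\<theta>' - \<theta>) / r \<le> 1" if "g \<le> g0"
        using powr_mono2[of "\<theta>' - \<theta>" g g0] that g lt g0r r by (simp add: divide_le_eq)
      then show ?thesis using * unfolding ratio[OF g] using pos[OF g]
        by (smt (verit) mult_le_cancel_left2)
    qed
    then show "h g0 \<le> h g" using g0 by (intro mono) auto
  qed (use G \<theta> lt in \<open>auto simp: gamma_weight_nonneg nn_integral_gamma_weight\<close>)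
qed simp

text \<open>The nonnegative axis is where Weyl functions take their values as long as all points are
  below \<open>t\<close>. The bound 1 makes the value attached to a failed pivot the largest, so
  monotonicity survives the passage to failure.\<close>

definition unit_mono :: "(real \<Rightarrow> ennreal) \<Rightarrow> bool" where
  "unit_mono \<phi> \<longleftrightarrow> \<phi> \<in> borel_measurable borel \<and> (\<forall>x. \<phi> x \<le> 1) \<and> (\<forall>x y. 0 \<le> x \<longrightarrow> x \<le> y \<longrightarrow> \<phi> x \<le> \<phi> y)"

lemma unit_monoD: "unit_mono \<phi> \<Longrightarrow> 0 \<le> x \<Longrightarrow> x \<le> y \<Longrightarrow> \<phi> x \<le> \<phi> y"
  by (simp add: unit_mono_def)

lemma gamma_weight_mult_mono:
  "(0 < g \<Longrightarrow> x \<le> y) \<Longrightarrow> ennreal (gamma_weight \<theta> g / Gamma \<theta>) * x \<le> ennreal (gamma_weight \<theta> g / Gamma \<theta>) * y"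
  by (cases "0 < g") (auto simp: gamma_weight_def intro: mult_left_mono)

lemma riccati_op_mono:
  assumes "\<And>a g. 0 < g \<Longrightarrow> (if 0 < t - a - s then \<phi> (g / (t - a - s)) else 1)
      \<le> (if 0 < t - a - s' then \<psi> (g / (t - a - s')) else 1)"
  shows "riccati_op t \<theta> \<phi> s \<le> riccati_op t \<theta> \<psi> s'"
  unfolding riccati_op_def
  by (intro nn_integral_mono mult_left_mono gamma_weight_mult_mono assms) auto

lemma riccati_op_const_1:
  assumes "0 < \<theta>" shows "riccati_op t \<theta> (\<lambda>_. 1) = (\<lambda>_. 1)"
  using assms by (simp add: riccati_op_def fun_eq_iff nn_integral_gamma_weight nn_integral_std_normal_density)

text \<open>A failed pivot replaces \<open>c\<close> by 1, which can only raise the average.\<close>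

lemma riccati_op_const_le:
  assumes "0 < \<theta>" "c \<le> 1"
  shows "c \<le> riccati_op t \<theta> (\<lambda>_. c) s"
proof -
  have "c = (\<integral>\<^sup>+a. ennreal (std_normal_density a) * (\<integral>\<^sup>+g. ennreal (gamma_weight \<theta> g / Gamma \<theta>) * c \<partial>lborel) \<partial>lborel)"
    using assms by (simp add: nn_integral_multc nn_integral_gamma_weight nn_integral_std_normal_density)
  also have "\<dots> \<le> riccati_op t \<theta> (\<lambda>_. c) s"
    unfolding riccati_op_def using assms(2)
    by (intro nn_integral_mono mult_left_mono gamma_weight_mult_mono) auto
  finally show ?thesis .
qed

text \<open>A larger \<open>s\<close> shrinks the pivot, which either enlarges
  \<open>g / (t - a - s)\<close> or makes the pivot fail.\<close>

lemma unit_mono_riccati_op: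
  assumes "0 < \<theta>" "unit_mono \<phi>"
  shows "unit_mono (riccati_op t \<theta> \<phi>)"
  unfolding unit_mono_def
proof (intro conjI allI impI)
  show "riccati_op t \<theta> \<phi> \<in> borel_measurable borel"
    using assms by (intro measurable_riccati_op) (simp add: unit_mono_def)
  have "riccati_op t \<theta> \<phi> s \<le> riccati_op t \<theta> (\<lambda>_. 1) s" for s
    by (rule riccati_op_mono) (use assms in \<open>auto simp: unit_mono_def\<close>)
  then show "riccati_op t \<theta> \<phi> s \<le> 1" for s
    using riccati_op_const_1[OF assms(1)] by metis
  fix s s' :: real assume "s \<le> s'"
  then show "riccati_op t \<theta> \<phi> s \<le> riccati_op t \<theta> \<phi> s'"
    using assms(2) by (intro riccati_op_mono) (auto simp: unit_mono_def intro!: unit_monoD[OF assms(2)] divide_left_mono)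
qed

lemma riccati_op_mono_shape:
  assumes "0 < \<theta>" "\<theta> \<le> \<theta>'" "unit_mono \<phi>"
  shows "riccati_op t \<theta> \<phi> s \<le> riccati_op t \<theta>' \<phi> s"
  unfolding riccati_op_def
proof (rule nn_integral_mono, rule mult_left_mono)
  fix a
  have [measurable]: "\<phi> \<in> borel_measurable borel" using assms by (simp add: unit_mono_def)
  show "(\<integral>\<^sup>+g. ennreal (gamma_weight \<theta> g / Gamma \<theta>) * (if 0 < t - a - s then \<phi> (g / (t - a - s)) else 1) \<partial>lborel)
    \<le> (\<integral>\<^sup>+g. ennreal (gamma_weight \<theta>' g / Gamma \<theta>') * (if 0 < t - a - s then \<phi> (g / (t - a - s)) else 1) \<partial>lborel)"
    by (rule gamma_distribution_mono[OF assms(1,2)])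
      (auto intro!: unit_monoD[OF assms(3)] divide_right_mono)
qed auto

text \<open>The first step applied to \<open>\<phi>\<close> has the largest index; this aligns chains of different lengths at the
  end at which the index times the shape increment equals \<open>\<beta>\<^sub>1 m / 2 = \<beta>\<^sub>2 n / 2\<close>.\<close>

primrec riccati_chain :: "real \<Rightarrow> (nat \<Rightarrow> real) \<Rightarrow> (real \<Rightarrow> ennreal) \<Rightarrow> nat \<Rightarrow> ennreal" where
  "riccati_chain t \<theta> \<phi> 0 = \<phi> 0"
| "riccati_chain t \<theta> \<phi> (Suc N) = riccati_chain t \<theta> (riccati_op t (\<theta> (Suc N)) \<phi>) N"

text \<open>Rows placed in front of a matrix replace the starting value 0 of the Weyl function by
  something nonnegative or by a failure, and neither lowers the result.\<close>

lemma riccati_chain_ge: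
  assumes "\<And>i. 0 < i \<Longrightarrow> 0 < \<theta> i" "unit_mono \<phi>"
  shows "\<phi> 0 \<le> riccati_chain t \<theta> \<phi> N"
  using assms(2)
proof (induction N arbitrary: \<phi>)
  case (Suc N)
  have "\<phi> 0 \<le> riccati_op t (\<theta> (Suc N)) (\<lambda>_. \<phi> 0) 0"
    using assms Suc.prems by (intro riccati_op_const_le) (auto simp: unit_mono_def)
  also have "\<dots> \<le> riccati_op t (\<theta> (Suc N)) \<phi> 0"
    using Suc.prems by (intro riccati_op_mono) (auto simp: unit_mono_def)
  also have "\<dots> \<le> riccati_chain t \<theta> (riccati_op t (\<theta> (Suc N)) \<phi>) N"
    using assms Suc.prems by (intro Suc.IH unit_mono_riccati_op) auto
  finally show ?case by simp
qed simp

text \<open>Both chains are peeled from the highest index, which changes both test functions, so two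
  of them are compared throughout. When the shorter chain is used up, the \<open>r\<close> rows of
  lowest index remain in the longer one and \<open>riccati_chain_ge\<close> applies.\<close>

lemma riccati_chain_mono:
  assumes "\<And>i. 0 < i \<Longrightarrow> 0 < \<theta> i" "\<And>i. 0 < i \<Longrightarrow> 0 < \<theta>' i"
    and "\<And>i. 0 < i \<Longrightarrow> i \<le> n \<Longrightarrow> \<theta> i \<le> \<theta>' (r + i)"
    and "unit_mono \<phi>" "unit_mono \<psi>" "\<And>x. 0 \<le> x \<Longrightarrow> \<phi> x \<le> \<psi> x"
  shows "riccati_chain t \<theta> \<phi> n \<le> riccati_chain t \<theta>' \<psi> (r + n)"
  using assms(3-)
proof (induction n arbitrary: \<phi> \<psi>)
  case 0
  have "\<phi> 0 \<le> \<psi> 0" using 0 by simp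
  also have "\<dots> \<le> riccati_chain t \<theta>' \<psi> r" using assms 0 by (intro riccati_chain_ge)
  finally show ?case by simp
next
  case (Suc n)
  have "riccati_op t (\<theta> (Suc n)) \<phi> s \<le> riccati_op t (\<theta>' (r + Suc n)) \<psi> s" for s
  proof -
    have "riccati_op t (\<theta> (Suc n)) \<phi> s \<le> riccati_op t (\<theta>' (r + Suc n)) \<phi> s"
      using assms(1)[of "Suc n"] Suc.prems(1)[of "Suc n"] Suc.prems(2) by (intro riccati_op_mono_shape) auto
    also have "\<dots> \<le> riccati_op t (\<theta>' (r + Suc n)) \<psi> s"
      using Suc.prems by (intro riccati_op_mono) auto
    finally show ?thesis .
  qed
  then have "riccati_chain t \<theta> (riccati_op t (\<theta> (Suc n)) \<phi>) n
      \<le> riccati_chain t \<theta>' (riccati_op t (\<theta>' (r + Suc n)) \<psi>) (r + n)"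
    using assms Suc.prems by (intro Suc.IH unit_mono_riccati_op) auto
  then show ?case by simp
qed

lemma riccati_chain_const_1:
  assumes "\<And>i. 0 < i \<Longrightarrow> 0 < \<theta> i"
  shows "riccati_chain t \<theta> (\<lambda>_. 1) N = 1"
  using assms by (induction N) (simp_all add: riccati_op_const_1)

text \<open>The constant depends on neither \<open>\<phi>\<close> nor \<open>t\<close>, so it
  cancels in the quotient that is a tail probability.\<close>

lemma beta_functional_eq_riccati_chain:
  assumes b: "0 < b" and "\<phi> \<in> borel_measurable borel"
  shows "beta_functional b t \<phi> N = ennreal (\<Prod>k<N. Gamma (real (Suc k) * b) * sqrt (2 * pi)) *
    riccati_chain t (\<lambda>k. real k * b) \<phi> N"
  using assms(2)
proof (induction N arbitrary: \<phi>)
  case 0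
  show ?case unfolding beta_functional_def nn_integral_L_0 by (simp add: decreasing_def)
next
  case (Suc N)
  have G: "0 < Gamma (real (Suc k) * b)" for k using b by (intro Gamma_real_pos) simp
  have "0 \<le> (\<Prod>k<N. Gamma (real (Suc k) * b) * sqrt (2 * pi))"
    using G by (intro prod_nonneg) (auto intro: less_imp_le)
  then show ?case
    using beta_functional_Suc[OF b Suc.prems, of t N] Suc.IH[OF measurable_riccati_op[OF Suc.prems], of t "real (Suc N) * b"] G[of N]
    by (simp add: ennreal_mult mult_ac del: of_nat_Suc)
qed

subsection \<open>The Hermite ensemble\<close>

lemma vandermonde_scale:
  assumes "0 < c"
  shows "vandermonde N (\<lambda>i. c * x i) = (\<Prod>j<N. \<Prod>k\<in>{j<..<N}. c) * vandermonde N x"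
proof -
  have "\<bar>c * x j - c * x k\<bar> = c * \<bar>x j - x k\<bar>" for j k
    using assms by (simp add: abs_mult flip: right_diff_distrib)
  then show ?thesis by (simp only: vandermonde_def prod.distrib)
qed

lemma nn_integral_gamma_weight_power:
  assumes "0 < b"
  shows "(\<integral>\<^sup>+v. ennreal (\<Prod>i<N. gamma_weight b (v i)) \<partial>L N) = ennreal (Gamma b ^ N)"
proof -
  have G: "0 < Gamma b" using assms by (rule Gamma_real_pos)
  have "(\<integral>\<^sup>+g. ennreal (gamma_weight b g) \<partial>lborel) = (\<integral>\<^sup>+g. ennreal (Gamma b) * ennreal (gamma_weight b g / Gamma b) \<partial>lborel)"
    using G by (intro nn_integral_cong) (simp flip: ennreal_mult')
  also have "\<dots> = ennreal (Gamma b)"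
    by (simp add: nn_integral_cmult nn_integral_gamma_weight[OF assms])
  finally have 1: "(\<integral>\<^sup>+g. ennreal (gamma_weight b g) \<partial>lborel) = ennreal (Gamma b)" .
  have "(\<integral>\<^sup>+v. ennreal (\<Prod>i<N. gamma_weight b (v i)) \<partial>L N) = (\<integral>\<^sup>+v. (\<Prod>i<N. ennreal (gamma_weight b (v i))) \<partial>L N)"
    by (simp add: prod_ennreal gamma_weight_nonneg)
  also have "\<dots> = (\<Prod>i<N. \<integral>\<^sup>+g. ennreal (gamma_weight b g) \<partial>lborel)"
    by (rule lborel_product.product_nn_integral_prod) auto
  finally show ?thesis using G by (simp add: 1 ennreal_power)
qed

lemma measurable_L_component: "i < N \<Longrightarrow> (\<lambda>x. x i) \<in> borel_measurable (L N)"
  using measurable_component_singleton[of i "{..<N}" "\<lambda>_. lborel :: real measure"] by simp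

text \<open>The chamber admits ties, but there a factor of the Vandermonde product is 0 and the
  weight vanishes.\<close>

lemma hermite_weight_eq:
  assumes "0 < \<beta>"
  shows "indicator (hermite_chamber N) x * hermite_weight \<beta> N x =
    indicator {x. decreasing N x} x * indicator (space (L N)) x * (vandermonde N x powr \<beta> * exp (- (\<beta> / 4) * (\<Sum>i<N. (x i)\<^sup>2)))"
proof -
  have w: "hermite_weight \<beta> N x = vandermonde N x powr \<beta> * exp (- (\<beta> / 4) * (\<Sum>i<N. (x i)\<^sup>2))"
    by (simp add: hermite_weight_def vandermonde_def prod_powr_distrib sum_distrib_left exp_sum flip: sum_negf)
  show ?thesis
  proof (cases "x \<in> space (L N) \<and> \<not> decreasing N x \<and> x \<in> hermite_chamber N")
    case True
    then obtain i j where ij: "i < j" "j < N" "\<not> x j < x i" by (auto simp: decreasing_def)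
    moreover have "x j \<le> x i" using True ij by (auto simp: hermite_chamber_def)
    ultimately have "x i - x j = 0" by simp
    with ij have z: "(\<Prod>k\<in>{i<..<N}. \<bar>x i - x k\<bar>) = 0"
      by (intro prod_zero bexI[of _ j]) simp_all
    have "i \<in> {..<N}" using ij by simp
    then have "vandermonde N x = 0"
      unfolding vandermonde_def by (subst prod.remove[of _ i]) (simp_all only: z mult_zero_left finite_lessThan)
    then show ?thesis using assms by (simp add: w)
  next
    case False
    then have "x \<in> hermite_chamber N \<longleftrightarrow> decreasing N x \<and> x \<in> space (L N)"
      using decreasing_le[of N x] by (auto simp: hermite_chamber_def config_space_def)
    then show ?thesis by (simp add: w indicator_def)
  qed
qed

lemma measurable_hermite_density:
  assumes "0 < \<beta>"
  shows "(\<lambda>x. ennreal (indicator (hermite_chamber N) x * hermite_weight \<beta> N x)) \<in> borel_measurable (L N)"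
  unfolding hermite_weight_eq[OF assms] by measurable

text \<open>For a constant test function the auxiliary weights integrate to a constant. The test
  function 1 yields the total mass and 0 the mass of the event, and all constants cancel in the
  quotient.\<close>

lemma hermite_ensemble_tail:
  assumes \<beta>: "0 < \<beta>" and N: "0 < N"
  shows "emeasure (hermite_ensemble \<beta> N) {x \<in> space (hermite_ensemble \<beta> N). s \<le> x 0}
    = riccati_chain (sqrt (\<beta> / 2) * s) (\<lambda>k. real k * (\<beta> / 2)) (\<lambda>_. 0) N"
proof -
  have [measurable]: "Measurable.pred (L N) (\<lambda>x. x 0 < r)" "Measurable.pred (L N) (\<lambda>x. r \<le> x 0)" for r
    using measurable_L_component[OF N] by measurable
  define b where "b = \<beta> / 2"
  \<comment> \<open>Scaling by \<open>\<sigma>\<close> turns \<beta>/4 times a square into half a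
    square; the Vandermonde exponent \<open>2 * b\<close> is \<beta>.\<close>
  define \<sigma> where "\<sigma> = sqrt b"
  define t where "t = \<sigma> * s"
  have b: "0 < b" using \<beta> by (simp add: b_def)
  have \<sigma>: "0 < \<sigma>" "\<sigma>\<^sup>2 = b" using b by (auto simp: \<sigma>_def)
  define C where "C = (\<Prod>k<N. Gamma (real (Suc k) * b) * sqrt (2 * pi))"
  have C: "0 < C" unfolding C_def using b by (intro prod_pos) (auto intro!: mult_pos_pos Gamma_real_pos)
  have Gb: "0 < Gamma b ^ N" using b by (simp add: Gamma_real_pos)
  define D where "D = (\<Prod>j<N. \<Prod>k\<in>{j<..<N}. \<sigma>)"
  have D: "0 < D" unfolding D_def using \<sigma> by (intro prod_pos) auto
  \<comment> \<open>The three factors come from the auxiliary weights, the Jacobian of the scaling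
    and its effect on the Vandermonde product.\<close>
  define \<kappa> where "\<kappa> = Gamma b ^ N * \<sigma> ^ N * D powr \<beta>"
  have \<kappa>: "0 < \<kappa>" using Gb \<sigma> D by (simp add: \<kappa>_def)
  define f where "f x = ennreal (indicator (hermite_chamber N) x * hermite_weight \<beta> N x)" for x
  have f: "f x = indicator {x. decreasing N x} x * ennreal (vandermonde N x powr \<beta> * exp (- (\<beta> / 4) * (\<Sum>i<N. (x i)\<^sup>2)))"
    if "x \<in> space (L N)" for x
    unfolding f_def hermite_weight_eq[OF \<beta>] using that by (auto simp: indicator_def)
  have [measurable]: "f \<in> borel_measurable (L N)"
    unfolding f_def[abs_def] by (rule measurable_hermite_density[OF \<beta>])
  have key: "ennreal \<kappa> * (\<integral>\<^sup>+x. f x * (if x 0 < s then c else 1) \<partial>L N) = ennreal C * riccati_chain t (\<lambda>k. real k * b) (\<lambda>_. c) N" for c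
  proof -
    define F where "F x = indicator {x. decreasing N x} x *
      ennreal (vandermonde N x powr (2 * b) * exp (- (\<Sum>i<N. (x i)\<^sup>2) / 2)) * (if x 0 < t then c else 1)" for x
    have [measurable]: "F \<in> borel_measurable (L N)" unfolding F_def by measurable
    have below: "(\<forall>i<N. x i < t) \<longleftrightarrow> x 0 < t" if "decreasing N x" for x
      using N decreasing_le[OF that, of 0] by (auto intro: le_less_trans)
    have "beta_functional b t (\<lambda>_. c) N = (\<integral>\<^sup>+x. ennreal (Gamma b ^ N) * F x \<partial>L N)"
      unfolding beta_functional_def
    proof (rule nn_integral_cong)
      fix x
      have "(\<integral>\<^sup>+v. ennreal (\<Prod>i<N. gamma_weight b (v i)) * (if \<forall>i<N. x i < t then c else 1) \<partial>L N)
          = ennreal (Gamma b ^ N) * (if \<forall>i<N. x i < t then c else 1)"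
        by (subst nn_integral_multc) (measurable, simp only: nn_integral_gamma_weight_power[OF b])
      then show "indicator {x. decreasing N x} x *
         ennreal (vandermonde N x powr (2 * b) * exp (- (\<Sum>i<N. (x i)\<^sup>2) / 2)) *
         (\<integral>\<^sup>+v. ennreal (\<Prod>i<N. gamma_weight b (v i)) * (if \<forall>i<N. x i < t then c else 1) \<partial>L N)
         = ennreal (Gamma b ^ N) * F x"
        using below[of x] by (cases "decreasing N x") (auto simp: F_def mult_ac)
    qed
    also have "\<dots> = ennreal (Gamma b ^ N) * integral\<^sup>N (L N) F" by (rule nn_integral_cmult) measurable
    also have "integral\<^sup>N (L N) F = ennreal (\<Prod>i<N. \<bar>\<sigma>\<bar>) * (\<integral>\<^sup>+x. F (\<lambda>i\<in>{..<N}. \<sigma> * x i) \<partial>L N)"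
      by (rule nn_integral_L_scale[symmetric]) (use \<sigma> in auto)
    also have "(\<integral>\<^sup>+x. F (\<lambda>i\<in>{..<N}. \<sigma> * x i) \<partial>L N) = (\<integral>\<^sup>+x. ennreal (D powr \<beta>) * (f x * (if x 0 < s then c else 1)) \<partial>L N)"
    proof (rule nn_integral_cong)
      fix x assume x: "x \<in> space (L N)"
      have d: "decreasing N (\<lambda>i\<in>{..<N}. \<sigma> * x i) \<longleftrightarrow> decreasing N x"
        using \<sigma> by (auto simp: decreasing_def)
      have "vandermonde N (\<lambda>i\<in>{..<N}. \<sigma> * x i) = vandermonde N (\<lambda>i. \<sigma> * x i)"
        by (rule vandermonde_cong) simp
      then have v: "vandermonde N (\<lambda>i\<in>{..<N}. \<sigma> * x i) powr (2 * b) = D powr \<beta> * vandermonde N x powr \<beta>"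
        using \<sigma> by (simp add: vandermonde_scale D_def b_def powr_mult)
      have sq: "- (\<Sum>i<N. ((\<lambda>i\<in>{..<N}. \<sigma> * x i) i)\<^sup>2) / 2 = - (\<beta> / 4) * (\<Sum>i<N. (x i)\<^sup>2)"
        using \<sigma> by (simp add: power_mult_distrib b_def flip: sum_distrib_left)
      have lt: "(\<lambda>i\<in>{..<N}. \<sigma> * x i) 0 < t \<longleftrightarrow> x 0 < s" using N \<sigma> by (simp add: t_def)
      show "F (\<lambda>i\<in>{..<N}. \<sigma> * x i) = ennreal (D powr \<beta>) * (f x * (if x 0 < s then c else 1))"
        unfolding F_def v sq lt f[OF x] by (simp add: d indicator_def ennreal_mult mult_ac)
    qed
    also have "\<dots> = ennreal (D powr \<beta>) * (\<integral>\<^sup>+x. f x * (if x 0 < s then c else 1) \<partial>L N)"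
      by (intro nn_integral_cmult) measurable
    finally have "beta_functional b t (\<lambda>_. c) N = ennreal \<kappa> * (\<integral>\<^sup>+x. f x * (if x 0 < s then c else 1) \<partial>L N)"
      using Gb \<sigma> D by (simp add: \<kappa>_def ennreal_mult ennreal_power mult.assoc)
    then show ?thesis
      using beta_functional_eq_riccati_chain[OF b, of "\<lambda>_. c" t N] by (simp add: C_def)
  qed
  define Z where "Z = (\<integral>\<^sup>+x. f x \<partial>L N)"
  define A where "A = (\<integral>\<^sup>+x. f x * (if x 0 < s then 0 else 1) \<partial>L N)"
  have \<kappa>Z: "ennreal \<kappa> * Z = ennreal C"
    using key[of 1] b by (simp add: Z_def riccati_chain_const_1)
  have \<kappa>A: "ennreal \<kappa> * A = ennreal C * riccati_chain t (\<lambda>k. real k * b) (\<lambda>_. 0) N"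
    unfolding A_def by (rule key)
  \<comment> \<open>The chain of the constant 1 is 1, so the recursion itself shows that the
    normalising integral is finite and nonzero.\<close>
  have Z: "Z \<noteq> 0" "Z \<noteq> top" using \<kappa>Z \<kappa> C by (auto simp: ennreal_mult_eq_top_iff)
  have "ennreal \<kappa> * A = ennreal \<kappa> * (riccati_chain t (\<lambda>k. real k * b) (\<lambda>_. 0) N * Z)"
    unfolding \<kappa>A by (simp flip: \<kappa>Z add: mult_ac)
  then have AZ: "A = riccati_chain t (\<lambda>k. real k * b) (\<lambda>_. 0) N * Z"
    using \<kappa> by (simp add: ennreal_mult_cancel_left)
  have HZ: "hermite_Z \<beta> N = Z" by (simp add: hermite_Z_def Z_def f_def config_space_def)
  have [measurable]: "{x \<in> space (L N). s \<le> x 0} \<in> sets (L N)" by measurable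
  have "emeasure (hermite_ensemble \<beta> N) {x \<in> space (hermite_ensemble \<beta> N). s \<le> x 0}
      = (\<integral>\<^sup>+x. f x / Z * indicator {x \<in> space (L N). s \<le> x 0} x \<partial>L N)"
    unfolding hermite_ensemble_def HZ config_space_def f_def[symmetric] space_density
    by (rule emeasure_density) measurable
  also have "\<dots> = (\<integral>\<^sup>+x. f x * (if x 0 < s then 0 else 1) / Z \<partial>L N)"
    by (rule nn_integral_cong) (auto simp: indicator_def)
  also have "\<dots> = A / Z" unfolding A_def by (intro nn_integral_divide) measurable
  also have "\<dots> = riccati_chain t (\<lambda>k. real k * b) (\<lambda>_. 0) N"
    unfolding AZ using Z by (simp add: ennreal_mult_divide_eq)
  finally show ?thesis unfolding t_def \<sigma>_def b_def .
qed

text \<open>The powers 2/3 of \<beta> and \<open>N\<close> merge, and so do the square roots from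
  the two scalings. Hence \<beta> and \<open>N\<close> enter the threshold through their product
  only, and ensembles with equal products can be compared at one threshold.\<close>

lemma hermite_edge_tail:
  assumes \<beta>: "0 < \<beta>" and N: "0 < N"
  shows "emeasure (hermite_ensemble \<beta> N) {x \<in> space (hermite_ensemble \<beta> N). \<tau> \<le> \<beta> powr (2/3) * H_edge N x}
    = riccati_chain (sqrt (\<beta> * real N / 2) * (2 + \<tau> / (\<beta> * real N) powr (2/3))) (\<lambda>k. real k * (\<beta> / 2)) (\<lambda>_. 0) N"
proof -
  define c where "c = (\<beta> * real N) powr (2/3)"
  have c: "0 < c" using \<beta> N by (simp add: c_def)
  have le_iff: "\<tau> \<le> \<beta> powr (2/3) * H_edge N x \<longleftrightarrow> sqrt (real N) * (2 + \<tau> / c) \<le> x 0" for x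
  proof -
    have "\<beta> powr (2/3) * H_edge N x = c * (x 0 / sqrt (real N) - 2)"
      using \<beta> by (simp add: H_edge_def c_def powr_mult)
    then have "\<tau> \<le> \<beta> powr (2/3) * H_edge N x \<longleftrightarrow> \<tau> / c \<le> x 0 / sqrt (real N) - 2"
      using c by (simp add: divide_le_eq mult.commute)
    also have "\<dots> \<longleftrightarrow> 2 + \<tau> / c \<le> x 0 / sqrt (real N)" by linarith
    also have "\<dots> \<longleftrightarrow> sqrt (real N) * (2 + \<tau> / c) \<le> x 0" using N by (simp add: le_divide_eq mult.commute)
    finally show ?thesis .
  qed
  have eq: "sqrt (\<beta> / 2) * (sqrt (real N) * (2 + \<tau> / c)) = sqrt (\<beta> * real N / 2) * (2 + \<tau> / c)"
    by (simp add: real_sqrt_divide real_sqrt_mult)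
  show ?thesis unfolding c_def[symmetric] le_iff hermite_ensemble_tail[OF assms] eq ..
qed

section \<open>From tail estimates to stochastic domination\<close>

lemma measurable_H_edge:
  assumes "0 < N"
  shows "H_edge N \<in> borel_measurable (hermite_ensemble \<beta> N)"
proof -
  note [measurable] = measurable_L_component[OF assms]
  show ?thesis unfolding H_edge_def[abs_def] hermite_ensemble_def config_space_def by measurable
qed

text \<open>The recursion controls closed tails; the open tail at \<open>t\<close> is the increasing
  union of the closed tails at \<open>t + 1 / (k + 1)\<close>. Finiteness of \<open>M\<close>
  matters in the passage to \<open>measure\<close>, which assigns 0 to sets of infinite
  measure.\<close>

lemma stoch_dominatesI:
  assumes M: "finite_measure M" "X \<in> borel_measurable M" and Y[measurable]: "Y \<in> borel_measurable M'"
    and le: "\<And>s. emeasure M' {\<omega> \<in> space M'. s \<le> Y \<omega>} \<le> emeasure M {\<omega> \<in> space M. s \<le> X \<omega>}"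
  shows "stoch_dominates M X M' Y"
  unfolding stoch_dominates_def
proof
  fix t :: real
  note [measurable] = M(2)
  define A where "A k = {\<omega> \<in> space M'. t + 1 / real (Suc k) \<le> Y \<omega>}" for k
  have "{\<omega> \<in> space M'. t < Y \<omega>} = (\<Union>k. A k)"
  proof (intro equalityI subsetI)
    fix \<omega> assume \<omega>: "\<omega> \<in> {\<omega> \<in> space M'. t < Y \<omega>}"
    then obtain k where "inverse (real (Suc k)) < Y \<omega> - t" using reals_Archimedean[of "Y \<omega> - t"] by auto
    then show "\<omega> \<in> (\<Union>k. A k)" using \<omega> by (auto simp: A_def inverse_eq_divide intro!: exI[of _ k])
  next
    fix \<omega> assume "\<omega> \<in> (\<Union>k. A k)"
    then obtain k where k: "\<omega> \<in> space M'" "t + 1 / real (Suc k) \<le> Y \<omega>" by (auto simp: A_def)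
    have "0 < 1 / real (Suc k)" by simp
    then have "t < Y \<omega>" using k(2) by linarith
    then show "\<omega> \<in> {\<omega> \<in> space M'. t < Y \<omega>}" using k(1) by simp
  qed
  moreover have "incseq A"
  proof (rule incseq_SucI)
    fix k
    have "1 / real (Suc (Suc k)) \<le> 1 / real (Suc k)" by (simp add: field_simps)
    then show "A k \<subseteq> A (Suc k)" by (auto simp: A_def)
  qed
  moreover have "A k \<in> sets M'" for k unfolding A_def by measurable
  ultimately have "emeasure M' {\<omega> \<in> space M'. t < Y \<omega>} = (SUP k. emeasure M' (A k))"
    by (auto intro!: SUP_emeasure_incseq[symmetric])
  also have "\<dots> \<le> emeasure M {\<omega> \<in> space M. t < X \<omega>}"
  proof (rule SUP_least)
    fix k
    have "emeasure M' (A k) \<le> emeasure M {\<omega> \<in> space M. t + 1 / real (Suc k) \<le> X \<omega>}"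
      unfolding A_def by (rule le)
    also have "\<dots> \<le> emeasure M {\<omega> \<in> space M. t < X \<omega>}"
    proof (rule emeasure_mono)
      have "t < t + 1 / real (Suc k)" by simp
      then show "{\<omega> \<in> space M. t + 1 / real (Suc k) \<le> X \<omega>} \<subseteq> {\<omega> \<in> space M. t < X \<omega>}"
        using less_le_trans by blast
    qed measurable
    finally show "emeasure M' (A k) \<le> emeasure M {\<omega> \<in> space M. t < X \<omega>}" .
  qed
  finally show "measure M {\<omega> \<in> space M. X \<omega> > t} \<ge> measure M' {\<omega> \<in> space M'. Y \<omega> > t}"
    unfolding measure_def using finite_measure.emeasure_finite[OF M(1)] by (intro enn2real_mono) (auto simp: less_top)
qed

text \<open>In \<open>ennreal\<close> the quotient of a number by itself is finite, also for 0 and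
  infinity, so the total mass is finite without an evaluation of the integral.\<close>

lemma finite_measure_hermite_ensemble:
  assumes "0 < \<beta>"
  shows "finite_measure (hermite_ensemble \<beta> N)"
proof
  define f where "f x = ennreal (indicator (hermite_chamber N) x * hermite_weight \<beta> N x)" for x
  have [measurable]: "f \<in> borel_measurable (L N)"
    unfolding f_def[abs_def] by (rule measurable_hermite_density[OF assms])
  have "emeasure (hermite_ensemble \<beta> N) (space (hermite_ensemble \<beta> N)) = (\<integral>\<^sup>+x. f x / hermite_Z \<beta> N * indicator (space (L N)) x \<partial>L N)"
    unfolding hermite_ensemble_def config_space_def f_def[symmetric] space_density
    by (rule emeasure_density) measurable
  also have "\<dots> = (\<integral>\<^sup>+x. f x / hermite_Z \<beta> N \<partial>L N)" by (rule nn_integral_cong) simp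
  also have "\<dots> = hermite_Z \<beta> N / hermite_Z \<beta> N"
    by (subst nn_integral_divide) (measurable, simp add: hermite_Z_def f_def[abs_def] config_space_def)
  also have "\<dots> \<noteq> \<infinity>" by (simp add: divide_ennreal_def ennreal_mult_eq_top_iff)
  finally show "emeasure (hermite_ensemble \<beta> N) (space (hermite_ensemble \<beta> N)) \<noteq> \<infinity>" .
qed

theorem theorem1:
  fixes \<beta>\<^sub>1 \<beta>\<^sub>2 :: real and m n :: nat
  assumes "0 < \<beta>\<^sub>1" and "\<beta>\<^sub>1 < \<beta>\<^sub>2"
    and "0 < m" and "0 < n"
    and "\<beta>\<^sub>2 / \<beta>\<^sub>1 = real m / real n"
  shows "stoch_dominates
           (hermite_ensemble \<beta>\<^sub>1 m) (\<lambda>x. \<beta>\<^sub>1 powr (2/3) * H_edge m x)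
           (hermite_ensemble \<beta>\<^sub>2 n) (\<lambda>x. \<beta>\<^sub>2 powr (2/3) * H_edge n x)"
proof (rule stoch_dominatesI[OF finite_measure_hermite_ensemble[OF assms(1)]])
  note [measurable] = measurable_H_edge[OF \<open>0 < m\<close>] measurable_H_edge[OF \<open>0 < n\<close>]
  show "(\<lambda>x. \<beta>\<^sub>1 powr (2/3) * H_edge m x) \<in> borel_measurable (hermite_ensemble \<beta>\<^sub>1 m)" by measurable
  show "(\<lambda>x. \<beta>\<^sub>2 powr (2/3) * H_edge n x) \<in> borel_measurable (hermite_ensemble \<beta>\<^sub>2 n)" by measurable
  fix s
  have c: "\<beta>\<^sub>1 * real m = \<beta>\<^sub>2 * real n" using assms by (simp add: field_simps)
  have "real n \<le> real m"
  proof -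
    have "\<beta>\<^sub>1 * real n \<le> \<beta>\<^sub>1 * real m" unfolding c using assms by (intro mult_right_mono) auto
    then show ?thesis using assms by simp
  qed
  then have nm: "n \<le> m" by simp
  \<comment> \<open>The larger matrix has \<open>m - n\<close> additional rows of lowest index, and
    index \<open>i\<close> of the smaller chain faces index \<open>m - n + i\<close>. The threshold
    is arbitrary here; by \<open>c\<close> it is the same for both ensembles.\<close>
  have "riccati_chain t (\<lambda>k. real k * (\<beta>\<^sub>2 / 2)) (\<lambda>_. 0) n \<le> riccati_chain t (\<lambda>k. real k * (\<beta>\<^sub>1 / 2)) (\<lambda>_. 0) ((m - n) + n)" for t
  proof (rule riccati_chain_mono)
    fix i assume i: "0 < i" "i \<le> n"
    \<comment> \<open>Each shape is the common top value minus \<open>n - i\<close> times half of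
      its own parameter, so the smaller parameter has the larger shape.\<close>
    have "(real n - real i) * \<beta>\<^sub>1 \<le> (real n - real i) * \<beta>\<^sub>2" using i assms by (intro mult_left_mono) auto
    then show "real i * (\<beta>\<^sub>2 / 2) \<le> real (m - n + i) * (\<beta>\<^sub>1 / 2)"
      using c nm by (simp add: of_nat_diff algebra_simps)
  qed (use assms in \<open>auto simp: unit_mono_def\<close>)
  then show "emeasure (hermite_ensemble \<beta>\<^sub>2 n) {x \<in> space (hermite_ensemble \<beta>\<^sub>2 n). s \<le> \<beta>\<^sub>2 powr (2/3) * H_edge n x}
    \<le> emeasure (hermite_ensemble \<beta>\<^sub>1 m) {x \<in> space (hermite_ensemble \<beta>\<^sub>1 m). s \<le> \<beta>\<^sub>1 powr (2/3) * H_edge m x}"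
    unfolding hermite_edge_tail[OF \<open>0 < \<beta>\<^sub>1\<close> \<open>0 < m\<close>] hermite_edge_tail[OF less_trans[OF assms(1,2)] \<open>0 < n\<close>] c
      le_add_diff_inverse2[OF nm] .
qed

end
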